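(* For $0\le r\le m$ write $\mathrm{FW}_r=\Sigma_r\cap\mathrm{Trop}(\bigcap_{q=1}^rH_q)$. Let $0\le r\le m-1$ and let $\Gamma'\in\mathrm{FW}_{r+1}$. (a) $\Gamma'$ has exactly $r+1$ edges, and they can be numbered $e_1',\dots,e_{r+1}'$ so that $\tfrac12B^{n-3-q}\le\mathrm{len}(e_q')\le nB^{n-3-q}$ for all $q$ (so the lengths are all of different orders of magnitude, and $e'_{r+1}$ is the shortest edge). (b) There is a unique $\Gamma\in\mathrm{FW}_r$ whose underlying tree is obtained from that of $\Gamma'$ by contracting the shortest edge $e'_{r+1}$, and whose other edges differ in length from those of $\Gamma'$ by at most the order of magnitude of $\mathrm{len}(e'_{r+1})$; precisely, if $e_q$ is the edge of $\Gamma$ corresponding to $e_q'$, then $|\mathrm{len}(e_q')-\mathrm{len}(e_q)|<n\,2^n\,B^{n-3-(r+1)}$ for $q=1,\dots,r$. (c) Conversely, given $\Gamma\in\mathrm{FW}_r$, the set of those $\Gamma'\in\mathrm{FW}_{r+1}$ whose associated element of $\mathrm{FW}_r$ in (b) is $\Gamma$ is exactly the set of metric trees obtained from $\Gamma$ by inserting an allowable edge and readjusting edge lengths.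
   Context: Let $\mathbf k$ be an algebraically closed field of characteristic zero and $K=\mathbf k((t))$ with the $t$-adic valuation. Let $n\ge 3$, $[n]=\{1,\dots,n\}$, and $\mathcal M_{0,n}$ the moduli space of smooth rational $n$-marked curves over $\mathbf k$. Tropical moduli space. $\mathcal M_{0,n}^{\mathrm{trop}}$ is the space of metric trees whose underlying tree is a stable $[n]$-marked tree (legs labelled by $[n]$, every vertex of valence at least 3 counting legs), with positive edge lengths $\mathrm{len}(e)$ and infinite legs (edges do not include legs). $\mathcal M_{0,n}$ embeds in $\mathbb G_m^{\binom n2}/\mathbb G_m^n$ (where $(\lambda_\ell)$ acts by $p_{ab}\mapsto\lambda_a\lambda_bp_{ab}$) by sending $(\mathbb P^1,p_\bullet)$ to the $2\times2$ minors of the $2\times n$ matrix with columns $p_\ell$, and $\Gamma\mapsto-\frac12(d_{ab})_{a,b}$ ($d_{ab}$ the distance between attaching points of legs $a,b$) identifies $\mathcal M_{0,n}^{\mathrm{trop}}$ with $\mathrm{Trop}(\mathcal M_{0,n})\subseteq\mathbb R^{\binom n2}/\mathbb R^n$. $\Sigma_r$ is the set of metric trees with at most $r$ edges (the $r$-skeleton). For a closed subscheme $X\subseteq\mathcal M_{0,n}^K$, $\mathrm{Trop}(X)\subseteq\mathcal M_{0,n}^{\mathrm{trop}}$ is the set of coordinatewise valuations of points of $X$ over valued extension fields of $K$. An empty intersection of hypersurfaces is $\mathcal M_{0,n}^K$, so $\mathrm{FW}_0$ is the cone point. The hypersurfaces. Let $m\le n-3$; for $q=1,\dots,m$ fix $S_q\subseteq[n]$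 with $|S_q|\ge3$ and distinct $i_q,j_q\in S_q$. Fix an integer $B\ge 2n+1$. $H_q\subseteq\mathcal M_{0,n}^K$ is the hypersurface $\sum_{\ell\in S_q\setminus\{i_q,j_q\}}t^{\ell B^{n-3-q}}x_\ell=0$, where for $(\mathbb P^1,p_\bullet)$ one chooses the coordinate on $\mathbb P^1$ with $p_{i_q}=\infty$, $p_{j_q}=0$, and $x_\ell$ is the coordinate of $p_\ell$ (well-defined up to a common scalar). Minimizing indices. For a metric tree $\Gamma$ and $\ell\in S_q\setminus\{i_q,j_q\}$, let $\underline d^q_\ell$ be the distance from the attaching point of leg $i_q$ to the point nearest to leg $\ell$ on the path from leg $i_q$ to leg $j_q$. For $\Gamma\in\mathrm{FW}_r$ and $q\le r$, the minimum of $\underline d^q_\alpha+\alpha B^{n-3-q}$ over $\alpha\in S_q\setminus\{i_q,j_q\}$ is attained by exactly two indices, denoted $k_q<\ell_q$. Allowable edge insertion. Let $\Gamma\in\mathrm{FW}_r$ with underlying tree $\tau$. Let $v$ be the vertex of $\tau$ at which the leg $i_{r+1}$ (extended by the path leading to it) meets the rest of the convex hull of the legs in $S_{r+1}$; i.e. $v$ is the vertex closest to leg $i_{r+1}$ such that at least three branches at $v$ contain elements of $S_{r+1}$. Branches at $v$ are the connected components of $\tau\setminus v$ (including legs); their set is $\mathcal B(v)$. Let $I$, $J$ be the branches containing $i_{r+1}$, $j_{r+1}$ (if $I=J$ there is no allowable insertion). Let $k_{r+1}$ be the minimal element of $S_{r+1}$ not lying on $I\cup J$, and $K_v$ the branch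 containing $k_{r+1}$. An allowable partition is a set partition $\mathcal B(v)=\mathcal B_1\sqcup\mathcal B_2$ with $I\in\mathcal B_1$, $J,K_v\in\mathcal B_2$, and such that some branch in $\mathcal B_1\setminus\{I\}$ contains an element of $S_{r+1}$. Given such a partition, $\tau'$ is the stable tree obtained by replacing $v$ by two vertices $v_1,v_2$ joined by a new edge $e_{r+1}$, with the branches of $\mathcal B_1$ attached at $v_1$ and those of $\mathcal B_2$ at $v_2$. Let $\ell_{r+1}$ be the minimal element of $S_{r+1}$ lying on a branch in $\mathcal B_1\setminus\{I\}$. For $q=1,\dots,r+1$ let $P_q$ be the set of edges of $\tau'$ separating the legs $\{i_q,\ell_q\}$ from $\{j_q,k_q\}$. There is a unique assignment of lengths to the edges of $\tau'$ such that $\sum_{e\in P_q}\mathrm{len}(e)=(\ell_q-k_q)B^{n-3-q}$ for all $q=1,\dots,r+1$, and these lengths are positive; the resulting metric tree is said to be obtained from $\Gamma$ by inserting an allowable edge and readjusting edge lengths. *)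

theory Defs
  imports
    "HOL-Algebra.Algebraic_Closure_Type"
    "HOL-Computational_Algebra.Formal_Laurent_Series"
    Complex_Main
begin

section \<open>Marked trees and metric trees\<close>

text \<open>The legs are labelled by \<open>{1..n}\<close>, and leg \<open>l\<close> is attached at the vertex \<open>att T l\<close>; \<open>edges\<close>
  does not include the legs. Values of \<open>att\<close> off \<open>{1..n}\<close> and of \<open>len\<close> off the edge set carry no
  meaning. Trees are given by representatives, with natural numbers as vertex names; equality of
  points of the moduli space is \<open>isometric\<close> below.\<close>

record tree =
  verts :: "nat set"
  edges :: "nat set set"
  att :: "nat \<Rightarrow> nat"

record mtree = tree +
  len :: "nat set \<Rightarrow> real"

definition is_path :: "nat set set \<Rightarrow> nat \<Rightarrow> nat list \<Rightarrow> nat \<Rightarrow> bool" where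
  "is_path E u p w \<longleftrightarrow>
     p \<noteq> [] \<and> distinct p \<and> hd p = u \<and> last p = w \<and> successively (\<lambda>a b. {a, b} \<in> E) p"

definition is_tree :: "nat set \<Rightarrow> nat set set \<Rightarrow> bool" where
  "is_tree V E \<longleftrightarrow>
     finite V \<and> V \<noteq> {} \<and> (\<forall>e\<in>E. e \<subseteq> V \<and> card e = 2) \<and> (\<forall>u\<in>V. \<forall>w\<in>V. \<exists>!p. is_path E u p w)"

definition stable_tree :: "nat \<Rightarrow> 'a tree_scheme \<Rightarrow> bool" where
  "stable_tree n T \<longleftrightarrow>
     is_tree (verts T) (edges T) \<and> (\<forall>l\<in>{1..n}. att T l \<in> verts T) \<and>
     (\<forall>v\<in>verts T. card {e \<in> edges T. v \<in> e} + card {l \<in> {1..n}. att T l = v} \<ge> 3)"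

definition M0n_trop :: "nat \<Rightarrow> mtree set" where
  "M0n_trop n = {\<Gamma>. stable_tree n \<Gamma> \<and> (\<forall>e\<in>edges \<Gamma>. len \<Gamma> e > 0)}"

definition isometric :: "nat \<Rightarrow> mtree \<Rightarrow> mtree \<Rightarrow> bool" where
  "isometric n \<Gamma> \<Gamma>' \<longleftrightarrow>
     (\<exists>f. bij_betw f (verts \<Gamma>) (verts \<Gamma>') \<and> edges \<Gamma>' = (\<lambda>e. f ` e) ` edges \<Gamma> \<and>
          (\<forall>l\<in>{1..n}. att \<Gamma>' l = f (att \<Gamma> l)) \<and> (\<forall>e\<in>edges \<Gamma>. len \<Gamma>' (f ` e) = len \<Gamma> e))"

definition tree_path :: "'a tree_scheme \<Rightarrow> nat \<Rightarrow> nat \<Rightarrow> nat list" where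
  "tree_path T u w = (THE p. is_path (edges T) u p w)"

definition tree_dist :: "mtree \<Rightarrow> nat \<Rightarrow> nat \<Rightarrow> real" where
  "tree_dist \<Gamma> u w =
     (let p = tree_path \<Gamma> u w in \<Sum>m<length p - 1. len \<Gamma> {p ! m, p ! Suc m})"

abbreviation leg_dist :: "mtree \<Rightarrow> nat \<Rightarrow> nat \<Rightarrow> real" where
  "leg_dist \<Gamma> a b \<equiv> tree_dist \<Gamma> (att \<Gamma> a) (att \<Gamma> b)"

definition skeleton :: "nat \<Rightarrow> nat \<Rightarrow> mtree set" where
  "skeleton n r = {\<Gamma> \<in> M0n_trop n. card (edges \<Gamma>) \<le> r}"


section \<open>Points over valued extension fields and tropicalization\<close>

definition valued_extension ::
    "'u ring \<Rightarrow> ('k::field fls \<Rightarrow> 'u) \<Rightarrow> ('u \<Rightarrow> real) \<Rightarrow> bool" where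
  "valued_extension L \<iota> val \<longleftrightarrow>
     field L \<and> \<iota> \<in> ring_hom (ring_of_type_algebra :: 'k fls ring) L \<and>
     (\<forall>x\<in>carrier L - {\<zero>\<^bsub>L\<^esub>}. \<forall>y\<in>carrier L - {\<zero>\<^bsub>L\<^esub>}.
        val (x \<otimes>\<^bsub>L\<^esub> y) = val x + val y \<and>
        (x \<oplus>\<^bsub>L\<^esub> y \<noteq> \<zero>\<^bsub>L\<^esub> \<longrightarrow> min (val x) (val y) \<le> val (x \<oplus>\<^bsub>L\<^esub> y))) \<and>
     (\<forall>f. f \<noteq> 0 \<longrightarrow> val (\<iota> f) = real_of_int (fls_subdegree f))"

text \<open>An \<open>L\<close>-valued point of \<open>M\<^sub>0\<^sub>,\<^sub>n\<close> is given by \<open>n\<close> distinct points of the projective line over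
  \<open>L\<close>, the \<open>l\<close>-th one having homogeneous coordinates \<open>p l\<close>, i.e. by a \<open>2 \<times> n\<close> matrix all of whose
  \<open>2 \<times> 2\<close> minors are nonzero.\<close>

definition minor :: "'u ring \<Rightarrow> (nat \<Rightarrow> 'u \<times> 'u) \<Rightarrow> nat \<Rightarrow> nat \<Rightarrow> 'u" where
  "minor L p a b =
     (fst (p a) \<otimes>\<^bsub>L\<^esub> snd (p b)) \<ominus>\<^bsub>L\<^esub> (fst (p b) \<otimes>\<^bsub>L\<^esub> snd (p a))"

definition M0n_points :: "'u ring \<Rightarrow> nat \<Rightarrow> (nat \<Rightarrow> 'u \<times> 'u) set" where
  "M0n_points L n =
     {p. (\<forall>a\<in>{1..n}. p a \<in> carrier L \<times> carrier L) \<and>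
         (\<forall>a\<in>{1..n}. \<forall>b\<in>{1..n}. a \<noteq> b \<longrightarrow> minor L p a b \<noteq> \<zero>\<^bsub>L\<^esub>)}"

text \<open>A closed subscheme of \<open>M\<^sub>0\<^sub>,\<^sub>n\<close> over \<open>k((t))\<close> enters through its sets of points over
  extension fields.\<close>

type_synonym ('k, 'u) subscheme =
  "'u ring \<Rightarrow> ('k fls \<Rightarrow> 'u) \<Rightarrow> (nat \<Rightarrow> 'u \<times> 'u) \<Rightarrow> bool"

text \<open>The valuation vector of the minors and \<open>-1/2\<close> times the distance vector are compared modulo
  the action of \<open>\<real>\<^sup>n\<close> by \<open>\<lambda>\<^sub>a + \<lambda>\<^sub>b\<close>. The extension field ranges over all fields with carrier in the type
  \<open>'u\<close>. A point over any valued extension \<open>L\<close> is defined over the subfield of \<open>L\<close> generated over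
  \<open>k((t))\<close> by finitely many coordinates, which has the cardinality of \<open>k((t))\<close>; so nothing is lost as
  soon as \<open>'u\<close> is at least as large as \<open>'k fls\<close>.\<close>

definition trop :: "nat \<Rightarrow> ('k::field, 'u) subscheme \<Rightarrow> mtree set" where
  "trop n Z =
     {\<Gamma> \<in> M0n_trop n. \<exists>L (\<iota> :: 'k fls \<Rightarrow> 'u) val p lam.
        valued_extension L \<iota> val \<and> p \<in> M0n_points L n \<and> Z L \<iota> p \<and>
        (\<forall>a\<in>{1..n}. \<forall>b\<in>{1..n}. a < b \<longrightarrow>
           val (minor L p a b) = lam a + lam b + (- 1/2) * leg_dist \<Gamma> a b)}"


section \<open>The hypersurfaces and their tropical intersections\<close>

text \<open>The coordinate is the image under the projective transformation with matrix
  \<open>((a, b), (c, d))\<close>, chosen such that \<open>p (i q)\<close> goes to infinity and \<open>p (j q)\<close> to \<open>0\<close>.\<close>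

definition hypersurface ::
    "nat \<Rightarrow> nat \<Rightarrow> (nat \<Rightarrow> nat set) \<Rightarrow> (nat \<Rightarrow> nat) \<Rightarrow> (nat \<Rightarrow> nat) \<Rightarrow> nat \<Rightarrow>
     ('k::field, 'u) subscheme" where
  "hypersurface n B S i j q L \<iota> p \<longleftrightarrow>
     (\<exists>a\<in>carrier L. \<exists>b\<in>carrier L. \<exists>c\<in>carrier L. \<exists>d\<in>carrier L.
        let num = (\<lambda>l. a \<otimes>\<^bsub>L\<^esub> fst (p l) \<oplus>\<^bsub>L\<^esub> b \<otimes>\<^bsub>L\<^esub> snd (p l));
            den = (\<lambda>l. c \<otimes>\<^bsub>L\<^esub> fst (p l) \<oplus>\<^bsub>L\<^esub> d \<otimes>\<^bsub>L\<^esub> snd (p l));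
            x = (\<lambda>l. num l \<otimes>\<^bsub>L\<^esub> inv\<^bsub>L\<^esub> den l)
        in (a \<otimes>\<^bsub>L\<^esub> d) \<ominus>\<^bsub>L\<^esub> (b \<otimes>\<^bsub>L\<^esub> c) \<noteq> \<zero>\<^bsub>L\<^esub> \<and>
           den (i q) = \<zero>\<^bsub>L\<^esub> \<and> num (j q) = \<zero>\<^bsub>L\<^esub> \<and>
           (\<Oplus>\<^bsub>L\<^esub>l\<in>S q - {i q, j q}. \<iota> (fls_X ^ (l * B ^ (n - 3 - q))) \<otimes>\<^bsub>L\<^esub> x l) = \<zero>\<^bsub>L\<^esub>)"

text \<open>The two type arguments fix the ground field and the range of extension fields in \<open>trop\<close>.\<close>

definition FW ::
    "'k::field itself \<Rightarrow> 'u itself \<Rightarrow> nat \<Rightarrow> nat \<Rightarrow> (nat \<Rightarrow> nat set) \<Rightarrow> (nat \<Rightarrow> nat) \<Rightarrow> (nat \<Rightarrow> nat) \<Rightarrow>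
     nat \<Rightarrow> mtree set" where
  "FW _ _ n B S i j r =
     skeleton n r \<inter>
     trop n ((\<lambda>L \<iota> p. \<forall>q\<in>{1..r}. hypersurface n B S i j q L \<iota> p) :: ('k, 'u) subscheme)"


section \<open>Edge numbering and contraction\<close>

definition edge_numbering :: "nat \<Rightarrow> nat \<Rightarrow> nat \<Rightarrow> mtree \<Rightarrow> (nat \<Rightarrow> nat set) \<Rightarrow> bool" where
  "edge_numbering n B s \<Gamma> e \<longleftrightarrow>
     bij_betw e {1..s} (edges \<Gamma>) \<and>
     (\<forall>q\<in>{1..s}. 1/2 * real B ^ (n - 3 - q) \<le> len \<Gamma> (e q) \<and>
                 len \<Gamma> (e q) \<le> real n * real B ^ (n - 3 - q))"

text \<open>\<open>contraction n \<pi> T' e T\<close>: the tree \<open>T\<close> is, via the map \<open>\<pi>\<close> of vertices, the contraction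
  of the edge \<open>e\<close> of \<open>T'\<close>. The edge \<open>e' \<noteq> e\<close> of \<open>T'\<close> corresponds to the edge \<open>\<pi> ` e'\<close> of \<open>T\<close>.\<close>

definition contraction ::
    "nat \<Rightarrow> (nat \<Rightarrow> nat) \<Rightarrow> 'a tree_scheme \<Rightarrow> nat set \<Rightarrow> 'b tree_scheme \<Rightarrow> bool" where
  "contraction n \<pi> T' e T \<longleftrightarrow>
     e \<in> edges T' \<and> verts T = \<pi> ` verts T' \<and>
     (\<forall>u\<in>verts T'. \<forall>w\<in>verts T'. \<pi> u = \<pi> w \<longleftrightarrow> u = w \<or> {u, w} = e) \<and>
     edges T = (\<lambda>e'. \<pi> ` e') ` (edges T' - {e}) \<and>
     (\<forall>l\<in>{1..n}. att T l = \<pi> (att T' l))"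

definition near_contraction :: "nat \<Rightarrow> nat \<Rightarrow> nat \<Rightarrow> mtree \<Rightarrow> mtree \<Rightarrow> bool" where
  "near_contraction n B r \<Gamma>' \<Gamma> \<longleftrightarrow>
     (\<exists>e' \<pi>. edge_numbering n B (r + 1) \<Gamma>' e' \<and> contraction n \<pi> \<Gamma>' (e' (r + 1)) \<Gamma> \<and>
        (\<forall>q\<in>{1..r}. \<bar>len \<Gamma>' (e' q) - len \<Gamma> (\<pi> ` e' q)\<bar>
                      < real n * 2 ^ n * real B ^ (n - 3 - (r + 1))))"


section \<open>Minimizing indices\<close>

definition proj_dist :: "mtree \<Rightarrow> nat \<Rightarrow> nat \<Rightarrow> nat \<Rightarrow> real" where
  "proj_dist \<Gamma> a b l =
     tree_dist \<Gamma> (att \<Gamma> a)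
       (arg_min_on (\<lambda>u. tree_dist \<Gamma> u (att \<Gamma> l)) (set (tree_path \<Gamma> (att \<Gamma> a) (att \<Gamma> b))))"

definition minimizers ::
    "nat \<Rightarrow> nat \<Rightarrow> (nat \<Rightarrow> nat set) \<Rightarrow> (nat \<Rightarrow> nat) \<Rightarrow> (nat \<Rightarrow> nat) \<Rightarrow> mtree \<Rightarrow> nat \<Rightarrow> nat set" where
  "minimizers n B S i j \<Gamma> q =
     {\<alpha>. is_arg_min (\<lambda>\<beta>. proj_dist \<Gamma> (i q) (j q) \<beta> + real \<beta> * real B ^ (n - 3 - q))
                      (\<lambda>\<beta>. \<beta> \<in> S q - {i q, j q}) \<alpha>}"

definition min_pair ::
    "nat \<Rightarrow> nat \<Rightarrow> (nat \<Rightarrow> nat set) \<Rightarrow> (nat \<Rightarrow> nat) \<Rightarrow> (nat \<Rightarrow> nat) \<Rightarrow> mtree \<Rightarrow> nat \<Rightarrow> nat \<times> nat" where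
  "min_pair n B S i j \<Gamma> q =
     (THE kl. fst kl < snd kl \<and> minimizers n B S i j \<Gamma> q = {fst kl, snd kl})"


section \<open>Insertion of an allowable edge\<close>

text \<open>Branches at a vertex consist of vertices and legs.\<close>

datatype site = Vertex nat | Leg nat

definition sites :: "nat \<Rightarrow> 'a tree_scheme \<Rightarrow> site set" where
  "sites n T = Vertex ` verts T \<union> Leg ` {1..n}"

definition incident :: "nat \<Rightarrow> 'a tree_scheme \<Rightarrow> (site \<times> site) set" where
  "incident n T =
     {(Vertex u, Vertex w) | u w. {u, w} \<in> edges T} \<union>
     {(Vertex (att T l), Leg l) | l. l \<in> {1..n}} \<union> {(Leg l, Vertex (att T l)) | l. l \<in> {1..n}}"

definition branch :: "nat \<Rightarrow> 'a tree_scheme \<Rightarrow> nat \<Rightarrow> site \<Rightarrow> site set" where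
  "branch n T v x =
     (incident n T \<inter> (sites n T - {Vertex v}) \<times> (sites n T - {Vertex v}))\<^sup>* `` {x}"

definition branches :: "nat \<Rightarrow> 'a tree_scheme \<Rightarrow> nat \<Rightarrow> site set set" where
  "branches n T v = branch n T v ` (sites n T - {Vertex v})"

definition meets :: "site set \<Rightarrow> nat set \<Rightarrow> bool" where
  "meets \<beta> A \<longleftrightarrow> (\<exists>s\<in>A. Leg s \<in> \<beta>)"

text \<open>The vertex at which leg \<open>a \<in> A\<close> meets the rest of the convex hull of the legs in \<open>A\<close>.\<close>

definition hull_vertex :: "nat \<Rightarrow> mtree \<Rightarrow> nat set \<Rightarrow> nat \<Rightarrow> nat \<Rightarrow> bool" where
  "hull_vertex n \<Gamma> A a v \<longleftrightarrow>
     is_arg_min (\<lambda>u. tree_dist \<Gamma> (att \<Gamma> a) u)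
       (\<lambda>u. u \<in> verts \<Gamma> \<and> card {\<beta> \<in> branches n \<Gamma> u. meets \<beta> A} \<ge> 3) v"

definition k_new :: "nat \<Rightarrow> mtree \<Rightarrow> nat set \<Rightarrow> nat \<Rightarrow> nat \<Rightarrow> nat \<Rightarrow> nat" where
  "k_new n \<Gamma> A a b v = Min {s \<in> A. Leg s \<notin> branch n \<Gamma> v (Leg a) \<union> branch n \<Gamma> v (Leg b)}"

definition l_new :: "nat \<Rightarrow> mtree \<Rightarrow> nat set \<Rightarrow> nat \<Rightarrow> nat \<Rightarrow> site set set \<Rightarrow> nat" where
  "l_new n \<Gamma> A a v \<B>1 = Min {s \<in> A. \<exists>\<beta>\<in>\<B>1 - {branch n \<Gamma> v (Leg a)}. Leg s \<in> \<beta>}"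

definition allowable_partition ::
    "nat \<Rightarrow> mtree \<Rightarrow> nat set \<Rightarrow> nat \<Rightarrow> nat \<Rightarrow> nat \<Rightarrow> site set set \<Rightarrow> site set set \<Rightarrow> bool" where
  "allowable_partition n \<Gamma> A a b v \<B>1 \<B>2 \<longleftrightarrow>
     \<B>1 \<union> \<B>2 = branches n \<Gamma> v \<and> \<B>1 \<inter> \<B>2 = {} \<and>
     branch n \<Gamma> v (Leg a) \<in> \<B>1 \<and> branch n \<Gamma> v (Leg b) \<in> \<B>2 \<and>
     branch n \<Gamma> v (Leg (k_new n \<Gamma> A a b v)) \<in> \<B>2 \<and>
     (\<exists>\<beta>\<in>\<B>1 - {branch n \<Gamma> v (Leg a)}. meets \<beta> A)"

text \<open>In the splitting of \<open>v\<close>, the old vertex \<open>v\<close> plays the role of \<open>v\<^sub>2\<close>, and \<open>w\<close> is the new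
  vertex \<open>v\<^sub>1\<close>, to which the branches in \<open>\<B>1\<close> are moved.\<close>

definition split_vertex :: "'a tree_scheme \<Rightarrow> nat \<Rightarrow> nat \<Rightarrow> site set set \<Rightarrow> tree" where
  "split_vertex T v w \<B>1 =
     \<lparr> verts = insert w (verts T),
       edges = insert {v, w}
         ((\<lambda>e. if v \<in> e \<and> (\<exists>u\<in>e. Vertex u \<in> \<Union>\<B>1) then insert w (e - {v}) else e) ` edges T),
       att = (\<lambda>l. if att T l = v \<and> Leg l \<in> \<Union>\<B>1 then w else att T l) \<rparr>"

definition linked :: "nat set set \<Rightarrow> nat \<Rightarrow> nat \<Rightarrow> bool" where
  "linked E u w \<longleftrightarrow> (u, w) \<in> {(x, y). {x, y} \<in> E}\<^sup>*"

definition separating_edges :: "'a tree_scheme \<Rightarrow> nat \<Rightarrow> nat \<Rightarrow> nat \<Rightarrow> nat \<Rightarrow> nat set set" where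
  "separating_edges T a l b k =
     {e \<in> edges T. linked (edges T - {e}) (att T a) (att T l) \<and>
                   linked (edges T - {e}) (att T b) (att T k) \<and>
                   \<not> linked (edges T - {e}) (att T a) (att T b)}"

text \<open>The unique solution of the linear system for the edge lengths. Neither solvability nor
  positivity is imposed as a condition, so stating that inserted trees lie in \<open>FW\<close> includes both.\<close>

definition readjusted_len ::
    "nat \<Rightarrow> nat \<Rightarrow> (nat \<Rightarrow> nat) \<Rightarrow> (nat \<Rightarrow> nat) \<Rightarrow> (nat \<Rightarrow> nat) \<Rightarrow> (nat \<Rightarrow> nat) \<Rightarrow> nat \<Rightarrow>
     'a tree_scheme \<Rightarrow> nat set \<Rightarrow> real" where
  "readjusted_len n B i j k l s T =
     (THE f. (\<forall>e. e \<notin> edges T \<longrightarrow> f e = 0) \<and>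
        (\<forall>q\<in>{1..s}. (\<Sum>e\<in>separating_edges T (i q) (l q) (j q) (k q). f e)
                      = (real (l q) - real (k q)) * real B ^ (n - 3 - q)))"

definition allowable_insertion ::
    "nat \<Rightarrow> nat \<Rightarrow> (nat \<Rightarrow> nat set) \<Rightarrow> (nat \<Rightarrow> nat) \<Rightarrow> (nat \<Rightarrow> nat) \<Rightarrow> nat \<Rightarrow> mtree \<Rightarrow> mtree \<Rightarrow> bool" where
  "allowable_insertion n B S i j r \<Gamma> \<Gamma>' \<longleftrightarrow>
     (\<exists>v w \<B>1 \<B>2.
        hull_vertex n \<Gamma> (S (r + 1)) (i (r + 1)) v \<and> w \<notin> verts \<Gamma> \<and>
        allowable_partition n \<Gamma> (S (r + 1)) (i (r + 1)) (j (r + 1)) v \<B>1 \<B>2 \<and>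
        (let T = split_vertex \<Gamma> v w \<B>1;
             k = (\<lambda>q. if q \<le> r then fst (min_pair n B S i j \<Gamma> q)
                      else k_new n \<Gamma> (S (r + 1)) (i (r + 1)) (j (r + 1)) v);
             l = (\<lambda>q. if q \<le> r then snd (min_pair n B S i j \<Gamma> q)
                      else l_new n \<Gamma> (S (r + 1)) (i (r + 1)) v \<B>1)
         in isometric n
              \<lparr> verts = verts T, edges = edges T, att = att T,
                len = readjusted_len n B i j k l (r + 1) T \<rparr> \<Gamma>'))"

end

theory Submission
  imports Defs
begin

text \<open>
  The space \<open>FW\<close> is first described purely combinatorially. Each edge of a tree splits the set of legs in
  two, and distances, branches and projections are all expressed by these splits. On a point of the
  hypersurface with index \<open>q\<close>, the summand with index \<open>\<alpha>\<close> has valuation \<open>proj_dist + \<alpha> B^(n-3-q)\<close> up to a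
  constant, so the minimum of these numbers is attained at two indices \<open>k < l\<close>. This says that the edges
  between the projections of the legs \<open>k\<close> and \<open>l\<close> to the path from \<open>i q\<close> to \<open>j q\<close> have total length
  \<open>(l - k) B^(n-3-q)\<close>. Since \<open>B \<ge> 2 n + 1\<close>, the edges accounted for by later equations are together too short
  to satisfy an earlier one (\<open>one_edge_per_scale\<close>). Hence \<open>r\<close> equations require \<open>r\<close> edges, and if there are no
  more, then there is exactly one of each order of magnitude and the equations are unitriangular in the
  lengths.

  The separation of scales also decides which indices are minimizing. If an edge of larger order of magnitude
  than \<open>B^(n-3-q)\<close> lies between the projections of two legs, then it decides which of them gives the smaller
  value; if only edges of smaller orders do, then the smaller index does. So the tropical conditions
  amount to the system of linear equations together with a condition on the splits \<open>1, \<dots>, q\<close> alone, for each \<open>q\<close> (\<open>admissible\<close>); this is \<open>trop_data\<close>. Each tree satisfying it is the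
  tropicalization of an actual point (\<open>FW_iff\<close>). Its lengths are integers, hence it suffices to look for
  points over \<open>k((t))\<close> itself. In suitable coordinates, with one unknown unit for each edge, the equations
  become a unitriangular monomial system with right-hand sides that involve the unknowns only modulo an
  additional factor \<open>t\<close>, and this is solved by successive approximation.

  The theorem is then a statement about \<open>trop_data\<close>. The equation with the last index involves the last edge
  only, so this edge may be contracted, the other conditions on the splits being unaffected, and solving
  the smaller triangular system changes the lengths by a bounded multiple of the length of the last edge.
  The new tree is unique because the splits alone determine the numbering of the edges and the minimizing
  indices (\<open>admissible_numbering_unique\<close>). Conversely, the condition on the splits with the last index says
  exactly that the new edge comes from an allowable partition of the branches at the hull vertex, with the
  prescribed \<open>k\<close> and \<open>l\<close> (\<open>allowable_imp_admissible\<close>, \<open>admissible_imp_allowable\<close>).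
\<close>

section \<open>Connectivity and edge cuts of trees\<close>

abbreviation separates :: "nat set set \<Rightarrow> nat set \<Rightarrow> nat \<Rightarrow> nat \<Rightarrow> bool" where
  "separates E e x y \<equiv> \<not> linked (E - {e}) x y"

lemma linked_refl [simp]: "linked E x x"
  by (simp add: linked_def)

lemma linked_trans: "linked E x y \<Longrightarrow> linked E y z \<Longrightarrow> linked E x z"
  by (auto simp: linked_def)

lemma linked_sym: assumes "linked E x y" shows "linked E y x"
proof -
  have "sym ({(x, y). {x, y} \<in> E}\<^sup>*)"
    by (intro sym_rtrancl symI) (auto simp: insert_commute)
  then show ?thesis using assms by (auto simp: linked_def dest: symD)
qed

lemma linked_edge: "{x, y} \<in> E \<Longrightarrow> linked E x y"
  by (auto simp: linked_def)

lemma linked_invariant: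
  assumes "linked E x y" "\<And>a b. {a, b} \<in> E \<Longrightarrow> \<chi> a = \<chi> b"
  shows "\<chi> x = \<chi> y"
  using assms(1) unfolding linked_def
  by (induction rule: rtrancl_induct) (use assms(2) in auto)

lemma linked_lift:
  assumes "linked E x y" "\<And>a b. {a, b} \<in> E \<Longrightarrow> linked F (g a) (g b)"
  shows "linked F (g x) (g y)"
  using assms(1) unfolding linked_def
proof (induction rule: rtrancl_induct)
  case (step y z)
  then have "linked F (g x) (g y)" "linked F (g y) (g z)"
    using assms(2) by (auto simp: linked_def)
  then show ?case unfolding linked_def by auto
qed auto

lemma is_path_Nil [simp]: "\<not> is_path E u [] w"
  by (simp add: is_path_def)

lemma is_path_Cons_iff:
  "is_path E u (x # p) w \<longleftrightarrow>
     x = u \<and> (if p = [] then w = u else {u, hd p} \<in> E \<and> u \<notin> set p \<and> is_path E (hd p) p w)"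
  by (cases p) (auto simp: is_path_def)

lemma is_path_linked: "is_path E u p w \<Longrightarrow> linked E u w"
proof (induction p arbitrary: u)
  case (Cons x p)
  then show ?case by (auto simp: is_path_Cons_iff split: if_splits intro: linked_trans linked_edge)
qed (auto simp: is_path_def)

lemma is_path_append:
  "is_path E u (xs @ x # ys) w \<longleftrightarrow>
     is_path E u (xs @ [x]) x \<and> is_path E x (x # ys) w \<and> set xs \<inter> set ys = {}"
  by (induction xs arbitrary: u) (auto simp: is_path_Cons_iff hd_append)

lemma linked_imp_path: assumes "linked E u w" shows "\<exists>p. is_path E u p w"
  using assms unfolding linked_def
proof (induction rule: rtrancl_induct)
  case base
  have "is_path E u [u] u" by (simp add: is_path_def)
  then show ?case by blast
next
  case (step y z)
  then obtain p where p: "is_path E u p y" by auto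
  show ?case
  proof (cases "z \<in> set p")
    case True
    then obtain xs ys where "p = xs @ z # ys" by (meson split_list)
    then show ?thesis using p is_path_append by blast
  next
    case False
    then have "is_path E u (p @ [z]) z" using p step(2)
      by (auto simp: is_path_def successively_append_iff)
    then show ?thesis by blast
  qed
qed

fun path_edges :: "nat list \<Rightarrow> nat set set" where
  "path_edges (x # y # p) = insert {x, y} (path_edges (y # p))"
| "path_edges _ = {}"

lemma path_edges_subset: "e \<in> path_edges p \<Longrightarrow> e \<subseteq> set p"
  by (induction p rule: path_edges.induct) auto

lemma is_path_edges: "is_path E u p w \<Longrightarrow> path_edges p \<subseteq> E"
  by (induction p arbitrary: u rule: path_edges.induct)
     (auto simp: is_path_Cons_iff)

lemma is_path_avoiding: "is_path E u p w \<Longrightarrow> path_edges p \<subseteq> F \<Longrightarrow> is_path F u p w"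
  by (induction p arbitrary: u rule: path_edges.induct) (auto simp: is_path_Cons_iff)

lemma path_edges_split:
  "e \<in> path_edges p \<Longrightarrow> \<exists>xs x y ys. p = xs @ x # y # ys \<and> e = {x, y}"
proof (induction p rule: path_edges.induct)
  case (1 x y p)
  show ?case
  proof (cases "e = {x, y}")
    case True
    then show ?thesis by (metis append_Nil)
  next
    case False
    then obtain xs a b ys where "y # p = xs @ a # b # ys" "e = {a, b}" using 1 by auto
    then have "x # y # p = (x # xs) @ a # b # ys" by simp
    then show ?thesis using \<open>e = {a, b}\<close> by blast
  qed
qed auto

text \<open>Where two paths with the same ends part, the remainders of both avoid the first edge of one of them; its
  ends thus stay connected without it, and it is not a bridge.\<close>

lemma path_unique:
  assumes bridges: "\<And>x y. {x, y} \<in> E \<Longrightarrow> separates E {x, y} x y"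
  shows "is_path E u p w \<Longrightarrow> is_path E u q w \<Longrightarrow> p = q"
proof (induction p arbitrary: u q)
  case (Cons x p)
  obtain y q' where q: "q = y # q'" using Cons.prems by (cases q) (auto simp: is_path_def)
  have xy: "x = u" "y = u" using Cons.prems q by (auto simp: is_path_Cons_iff)
  show ?case
  proof (cases "p = [] \<or> q' = []")
    case True
    have "u = w" using True Cons.prems q by (auto simp: is_path_Cons_iff)
    have "p = [] \<and> q' = []"
      using Cons.prems q xy \<open>u = w\<close>
      by (cases p; cases q') (auto simp: is_path_def split: if_splits)
    then show ?thesis using q xy by simp
  next
    case False
    then have p: "{u, hd p} \<in> E" "u \<notin> set p" "is_path E (hd p) p w"
      and q': "{u, hd q'} \<in> E" "u \<notin> set q'" "is_path E (hd q') q' w"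
      using Cons.prems q by (auto simp: is_path_Cons_iff)
    have "hd p = hd q'"
    proof (rule ccontr)
      assume ne: "hd p \<noteq> hd q'"
      let ?E = "E - {{u, hd p}}"
      have "path_edges p \<subseteq> ?E" "path_edges q' \<subseteq> ?E"
        using is_path_edges[OF p(3)] is_path_edges[OF q'(3)] path_edges_subset p(2) q'(2)
        by blast+
      then have "linked ?E (hd p) w" "linked ?E (hd q') w"
        using is_path_avoiding p(3) q'(3) is_path_linked by blast+
      moreover have "linked ?E u (hd q')"
        using q'(1) ne by (intro linked_edge) (auto simp: doubleton_eq_iff)
      ultimately have "linked ?E u (hd p)" by (meson linked_sym linked_trans)
      then show False using bridges[OF p(1)] by simp
    qed
    then show ?thesis using Cons.IH[OF p(3)] q'(3) q xy by simp
  qed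
qed (auto simp: is_path_def)

text \<open>For trees built from others, bridges are easier to verify than the uniqueness of paths.\<close>

lemma is_treeI:
  assumes "finite V" "V \<noteq> {}" "\<And>e. e \<in> E \<Longrightarrow> e \<subseteq> V \<and> card e = 2"
    "\<And>u w. u \<in> V \<Longrightarrow> w \<in> V \<Longrightarrow> linked E u w"
    "\<And>x y. {x, y} \<in> E \<Longrightarrow> separates E {x, y} x y"
  shows "is_tree V E"
proof -
  have "\<exists>!p. is_path E u p w" if "u \<in> V" "w \<in> V" for u w
    using linked_imp_path[OF assms(4)[OF that]] path_unique[of E] assms(5) by metis
  then show ?thesis unfolding is_tree_def using assms(1-3) by auto
qed

context
  fixes V E assumes tree: "is_tree V E"
begin

lemma tree_finite: "finite V" "finite E"
proof -
  show "finite V" using tree by (simp add: is_tree_def)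
  moreover have "E \<subseteq> Pow V" using tree by (auto simp: is_tree_def)
  ultimately show "finite E" by (meson finite_Pow_iff finite_subset)
qed

lemma tree_edge: "e \<in> E \<Longrightarrow> \<exists>x y. e = {x, y} \<and> x \<noteq> y \<and> x \<in> V \<and> y \<in> V"
proof -
  assume "e \<in> E"
  then have e: "e \<subseteq> V" "card e = 2" using tree by (auto simp: is_tree_def)
  then obtain x y where "e = {x, y}" "x \<noteq> y" by (meson card_2_iff)
  then show ?thesis using e by blast
qed

lemma tree_edgeD: assumes "{x, y} \<in> E" shows "x \<in> V" "y \<in> V" "x \<noteq> y"
  using tree_edge[OF assms] by (auto simp: doubleton_eq_iff)

lemma tree_path_ex1: "u \<in> V \<Longrightarrow> w \<in> V \<Longrightarrow> \<exists>!p. is_path E u p w"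
  using tree unfolding is_tree_def by (elim conjE) (drule (1) bspec, drule (1) bspec)

lemma tree_connected: "u \<in> V \<Longrightarrow> w \<in> V \<Longrightarrow> linked E u w"
  using tree_path_ex1[THEN ex1_implies_ex] by (meson is_path_linked)

lemma tree_path_unique: "u \<in> V \<Longrightarrow> w \<in> V \<Longrightarrow> is_path E u p w \<Longrightarrow> is_path E u q w \<Longrightarrow> p = q"
  using tree_path_ex1 by (metis)

lemma tree_bridge: assumes "{x, y} \<in> E" shows "separates E {x, y} x y"
proof
  assume "linked (E - {{x, y}}) x y"
  then obtain p where p: "is_path (E - {{x, y}}) x p y" using linked_imp_path by blast
  have "is_path E x p y" using is_path_avoiding[OF p] is_path_edges[OF p] by blast
  moreover have "is_path E x [x, y] y" using assms tree_edgeD[OF assms] by (auto simp: is_path_def)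
  ultimately have "p = [x, y]" using tree_path_unique tree_edgeD[OF assms] by blast
  then show False using p by (auto simp: is_path_def)
qed

lemma edge_sides:
  assumes e: "{a, b} \<in> E" and v: "v \<in> V"
  shows "linked (E - {{a, b}}) a v \<or> linked (E - {{a, b}}) b v"
proof -
  have "linked E a v" using tree_connected tree_edgeD[OF e] v by blast
  then show ?thesis unfolding linked_def
  proof (induction rule: rtrancl_induct)
    case (step y z)
    show ?case
    proof (cases "{y, z} = {a, b}")
      case True
      then show ?thesis by (auto simp: doubleton_eq_iff)
    next
      case False
      then have "(y, z) \<in> {(x, y). {x, y} \<in> E - {{a, b}}}" using step(2) by auto
      then show ?thesis using step(3) by (meson rtrancl.rtrancl_into_rtrancl)
    qed
  qed auto
qed

text \<open>Removing an edge leaves two components, and any function that is constant along the other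
  edges but changes along this one tells them apart.\<close>

lemma cut_function:
  assumes e: "e \<in> E" and const: "\<And>x y. {x, y} \<in> E \<Longrightarrow> {x, y} \<noteq> e \<Longrightarrow> \<chi> x = \<chi> y"
    and "\<And>x y. {x, y} = e \<Longrightarrow> \<chi> x \<noteq> \<chi> y" and xy: "x \<in> V" "y \<in> V"
  shows "separates E e x y \<longleftrightarrow> (\<chi> x :: bool) \<noteq> \<chi> y"
proof -
  obtain a b where ab: "e = {a, b}" using tree_edge[OF e] by blast
  have inv: "linked (E - {e}) p q \<Longrightarrow> \<chi> p = \<chi> q" for p q
    by (erule linked_invariant) (use const in auto)
  have "\<chi> a \<noteq> \<chi> b" using assms(3) ab by blast
  have "linked (E - {e}) a x \<or> linked (E - {e}) b x" "linked (E - {e}) a y \<or> linked (E - {e}) b y"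
    using edge_sides[of a b] e ab xy by auto
  moreover note inv \<open>\<chi> a \<noteq> \<chi> b\<close>
  ultimately show ?thesis by (meson linked_sym linked_trans)
qed

lemma separates_xor:
  assumes e: "e \<in> E" and "x \<in> V" "y \<in> V" "z \<in> V"
  shows "separates E e x y \<longleftrightarrow> separates E e z x \<noteq> separates E e z y"
proof -
  obtain a b where ab: "e = {a, b}" using tree_edge[OF e] by blast
  have s: "linked (E - {e}) a v \<or> linked (E - {e}) b v" if "v \<in> V" for v
    using edge_sides[of a b] e ab that by auto
  show ?thesis using s[OF assms(2)] s[OF assms(3)] s[OF assms(4)]
    by (meson linked_sym linked_trans)
qed

lemma separates_other_edge: "{x, y} \<in> E \<Longrightarrow> {x, y} \<noteq> e \<Longrightarrow> linked (E - {e}) x y"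
  by (intro linked_edge) auto

text \<open>This turns sums along paths into sums over the edges that separate two vertices.\<close>

lemma separates_iff_path_edge:
  assumes e: "e \<in> E" and p: "is_path E u p w"
  shows "separates E e u w \<longleftrightarrow> e \<in> path_edges p"
proof
  assume "separates E e u w"
  then show "e \<in> path_edges p"
    using is_path_avoiding[OF p, of "E - {e}"] is_path_edges[OF p] is_path_linked by blast
next
  assume "e \<in> path_edges p"
  then obtain xs x y ys where p': "p = xs @ x # y # ys" "e = {x, y}"
    using path_edges_split by blast
  have 1: "is_path E u (xs @ [x]) x" "is_path E x (x # y # ys) w"
    using p p' is_path_append by blast+
  then have 2: "is_path E y (y # ys) w" by (auto simp: is_path_Cons_iff)
  have "distinct p" using p by (simp add: is_path_def)
  then have "y \<notin> set (xs @ [x])" "x \<notin> set (y # ys)" using p' by auto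
  then have "path_edges (xs @ [x]) \<subseteq> E - {e}" "path_edges (y # ys) \<subseteq> E - {e}"
    using is_path_edges[OF 1(1)] is_path_edges[OF 2] path_edges_subset p'(2) by blast+
  then have "linked (E - {e}) u x" "linked (E - {e}) y w"
    using 1 2 is_path_avoiding is_path_linked by blast+
  then show "separates E e u w" using tree_bridge[of x y] e p'(2)
    by (metis linked_sym linked_trans)
qed

text \<open>Any two splits are compatible. If a side of \<open>e\<close> contains two vertices that \<open>f\<close> separates, then the path
  between them stays on that side and uses \<open>f\<close>, so that \<open>f\<close> lies on that side, and this happens for one side only.\<close>

lemma quadrant_empty:
  assumes e: "e \<in> E" and f: "f \<in> E" and "e \<noteq> f"
    and V: "p \<in> V" "q \<in> V" "s \<in> V" "t \<in> V"
    and "\<not> separates E e p q" "separates E f p q" "\<not> separates E e s t" "separates E f s t"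
  shows "\<not> separates E e p s"
proof
  obtain a b where ab: "f = {a, b}" "a \<in> V" using tree_edge[OF f] by blast
  have *: "linked (E - {e}) x a" if nxy: "\<not> separates E e x y" and "separates E f x y" for x y
  proof -
    obtain r where r: "is_path (E - {e}) x r y" using nxy linked_imp_path by blast
    then have "is_path E x r y" using is_path_avoiding[OF r] is_path_edges[OF r] by blast
    then have "f \<in> path_edges r" using separates_iff_path_edge[OF f] that by blast
    then have "a \<in> set r" using path_edges_subset ab by blast
    then obtain xs ys where "r = xs @ a # ys" by (meson split_list)
    then show ?thesis using r is_path_append is_path_linked by blast
  qed
  assume "separates E e p s"
  then show False using *[of p q] *[of s t] assms by (meson linked_sym linked_trans)
qed

lemma on_path_not_separated:
  assumes e: "e \<in> E" and p: "is_path E a p b" and u: "u \<in> set p"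
  shows "\<not> (separates E e u a \<and> separates E e u b)"
proof
  assume s: "separates E e u a \<and> separates E e u b"
  obtain xs ys where p': "p = xs @ u # ys" using u by (meson split_list)
  then have 1: "is_path E a (xs @ [u]) u" "is_path E u (u # ys) b" "set xs \<inter> set ys = {}"
    using p is_path_append by blast+
  have "e \<in> path_edges (xs @ [u])" "e \<in> path_edges (u # ys)"
    using s separates_iff_path_edge[OF e] 1 linked_sym by blast+
  then have "e \<subseteq> set (xs @ [u]) \<inter> set (u # ys)" using path_edges_subset by blast
  also have "\<dots> \<subseteq> {u}" using 1(3) by auto
  finally show False using tree_edge[OF e] by auto
qed

lemma path_verts: assumes "is_path E a p b" "a \<in> V" shows "set p \<subseteq> V"
proof
  fix y assume y: "y \<in> set p"
  then obtain xs ys where "p = xs @ y # ys" by (meson split_list)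
  then have l: "linked E a y" using assms is_path_append is_path_linked by blast
  have "(a \<in> V) = (y \<in> V)" by (rule linked_invariant[OF l]) (use tree_edgeD in blast)
  then show "y \<in> V" using assms by simp
qed

text \<open>Along a path, the vertex closest to \<open>z\<close> lies on the same side as \<open>z\<close> of every edge of the path:
  otherwise crossing that edge would bring it closer.\<close>

lemma closest_on_path:
  assumes pos: "\<And>e. e \<in> E \<Longrightarrow> (L e :: real) > 0" and p: "is_path E a p b" and z: "z \<in> V"
    and ab: "a \<in> V" "b \<in> V" and u: "u \<in> set p"
    and min: "\<And>y. y \<in> set p \<Longrightarrow>
       (\<Sum>e | e \<in> E \<and> separates E e u z. L e) \<le> (\<Sum>e | e \<in> E \<and> separates E e y z. L e)"
    and e: "e \<in> E" "separates E e a b"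
  shows "\<not> separates E e u z"
proof
  assume uz: "separates E e u z"
  have pV: "set p \<subseteq> V" using path_verts[OF p ab(1)] .
  have "e \<in> path_edges p" using separates_iff_path_edge[OF e(1) p] e(2) by blast
  then obtain c d where cd: "e = {c, d}" "c \<in> set p" "d \<in> set p"
    using path_edges_split[of e p] by auto
  have "linked (E - {e}) c u \<or> linked (E - {e}) d u"
    using edge_sides[of c d u] cd e(1) pV u by blast
  then obtain x y where xy: "e = {x, y}" "x \<in> set p" "y \<in> set p" "\<not> separates E e u x"
    using cd linked_sym by (metis insert_commute)
  have sxy: "separates E e x y" using tree_bridge e xy by blast
  have V: "u \<in> V" "x \<in> V" "y \<in> V" using xy pV u by auto
  have zy: "\<not> separates E e z y"
    using uz xy(4) sxy separates_xor[OF e(1) V(2,3) V(1)] separates_xor[OF e(1) z V(3) V(1)] by blast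
  let ?S = "\<lambda>v. {f \<in> E. separates E f v z}"
  have "?S y \<subseteq> ?S u - {e}"
  proof safe
    fix f assume f: "f \<in> E" "separates E f y z" and "linked (E - {f}) u z"
    then have "f \<noteq> e" using zy linked_sym by blast
    have "\<not> separates E f x y" using separates_other_edge xy(1) e(1) \<open>f \<noteq> e\<close> by blast
    then have "separates E f u x" 
      using f \<open>linked (E - {f}) u z\<close> by (meson linked_sym linked_trans)
    moreover have "separates E f z y" using f(2) linked_sym by blast
    ultimately have "\<not> separates E e u z"
      using quadrant_empty[of e f u x z y] e(1) f(1) \<open>f \<noteq> e\<close> V z xy(4) zy by blast
    then show False using uz by blast
  next
    show "\<And>f. separates E e y z \<Longrightarrow> False" using zy linked_sym by blast
  qed
  moreover have "e \<in> ?S u" using e uz by blast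
  ultimately have "sum L (?S y) < sum L (?S u)"
    using pos tree_finite(2) by (intro sum_strict_mono2[of _ _ e]) (auto intro: less_imp_le)
  then show False using min[OF xy(3)] by simp
qed

text \<open>The median of three vertices is the vertex of the path between two of them closest to the third.\<close>

lemma median_exists:
  assumes V: "a \<in> V" "b \<in> V" "z \<in> V"
  shows "\<exists>m\<in>V. \<forall>e\<in>E. if separates E e a b then \<not> separates E e m z else \<not> separates E e m a"
proof -
  obtain p where p: "is_path E a p b" using tree_connected linked_imp_path V by blast
  have ne: "set p \<noteq> {}" using p by (auto simp: is_path_def)
  let ?d = "\<lambda>u. (\<Sum>e | e \<in> E \<and> separates E e u z. 1 :: real)"
  define m where "m = arg_min_on ?d (set p)"
  have m: "m \<in> set p" "\<And>y. y \<in> set p \<Longrightarrow> ?d m \<le> ?d y"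
    unfolding m_def using arg_min_if_finite[OF _ ne, of ?d] by (auto simp: not_less)
  have mV: "m \<in> V" using path_verts[OF p V(1)] m by blast
  have "if separates E e a b then \<not> separates E e m z else \<not> separates E e m a" if e: "e \<in> E" for e
  proof (cases "separates E e a b")
    case True
    then show ?thesis using closest_on_path[OF _ p V(3) V(1,2) m(1) m(2) e] by auto
  next
    case False
    then show ?thesis using on_path_not_separated[OF e p m(1)] 
      by (metis linked_sym linked_trans)
  qed
  then show ?thesis using mV by blast
qed

end

section \<open>Distances, branches and convex hulls in terms of edge cuts\<close>

lemma finite_path_edges [simp]: "finite (path_edges p)"
  by (induction p rule: path_edges.induct) auto

lemma sum_along_path:
  "distinct p \<Longrightarrow> (\<Sum>m<length p - 1. (L {p ! m, p ! Suc m} :: real)) = sum L (path_edges p)"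
proof (induction p rule: path_edges.induct)
  case (1 x y p)
  have "{x, y} \<notin> path_edges (y # p)" using path_edges_subset 1(2) by fastforce
  moreover have "(\<Sum>m<length (x # y # p) - 1. L {(x # y # p) ! m, (x # y # p) ! Suc m})
     = L {x, y} + (\<Sum>m<length (y # p) - 1. L {(y # p) ! m, (y # p) ! Suc m})"
    by (simp add: sum.lessThan_Suc_shift del: sum.lessThan_Suc)
  ultimately show ?case using 1 by simp
qed auto

lemma tree_dist_eq:
  assumes tree: "is_tree (verts \<Gamma>) (edges \<Gamma>)" and V: "u \<in> verts \<Gamma>" "w \<in> verts \<Gamma>"
  shows "is_path (edges \<Gamma>) u (tree_path \<Gamma> u w) w"
    and "tree_dist \<Gamma> u w = (\<Sum>e | e \<in> edges \<Gamma> \<and> separates (edges \<Gamma>) e u w. len \<Gamma> e)"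
proof -
  show p: "is_path (edges \<Gamma>) u (tree_path \<Gamma> u w) w"
    unfolding tree_path_def using tree_path_ex1[OF tree V] by (rule theI')
  have "path_edges (tree_path \<Gamma> u w) = {e. e \<in> edges \<Gamma> \<and> separates (edges \<Gamma>) e u w}"
    using separates_iff_path_edge[OF tree _ p] is_path_edges[OF p] by blast
  moreover have "distinct (tree_path \<Gamma> u w)" using p by (simp add: is_path_def)
  ultimately show "tree_dist \<Gamma> u w = (\<Sum>e | e \<in> edges \<Gamma> \<and> separates (edges \<Gamma>) e u w. len \<Gamma> e)"
    by (simp only: tree_dist_def Let_def sum_along_path)
qed

text \<open>The projection of \<open>l\<close> lies on the same side as \<open>l\<close> of all edges of the path from \<open>a\<close> to \<open>b\<close>, so only those
  edges of the path that separate \<open>a\<close> from \<open>l\<close> contribute.\<close>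

lemma proj_dist_eq:
  assumes \<Gamma>: "\<Gamma> \<in> M0n_trop n" and legs: "a \<in> {1..n}" "b \<in> {1..n}" "l \<in> {1..n}"
  shows "proj_dist \<Gamma> a b l = (\<Sum>e | e \<in> edges \<Gamma> \<and> separates (edges \<Gamma>) e (att \<Gamma> a) (att \<Gamma> b) \<and>
           separates (edges \<Gamma>) e (att \<Gamma> a) (att \<Gamma> l). len \<Gamma> e)"
proof -
  have tree: "is_tree (verts \<Gamma>) (edges \<Gamma>)" and V: "\<And>x. x \<in> {1..n} \<Longrightarrow> att \<Gamma> x \<in> verts \<Gamma>"
    and pos: "\<And>e. e \<in> edges \<Gamma> \<Longrightarrow> len \<Gamma> e > 0"
    using \<Gamma> by (auto simp: M0n_trop_def stable_tree_def)
  let ?a = "att \<Gamma> a" and ?b = "att \<Gamma> b" and ?l = "att \<Gamma> l"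
  let ?p = "tree_path \<Gamma> ?a ?b" and ?sep = "separates (edges \<Gamma>)"
  have p: "is_path (edges \<Gamma>) ?a ?p ?b" using tree_dist_eq(1)[OF tree] V legs by blast
  have pV: "set ?p \<subseteq> verts \<Gamma>" using path_verts[OF tree p] V legs by blast
  have ne: "set ?p \<noteq> {}" using p by (auto simp: is_path_def)
  define u where "u = arg_min_on (\<lambda>u. tree_dist \<Gamma> u ?l) (set ?p)"
  have u: "u \<in> set ?p" "\<And>y. y \<in> set ?p \<Longrightarrow> tree_dist \<Gamma> u ?l \<le> tree_dist \<Gamma> y ?l"
    unfolding u_def using arg_min_if_finite[OF _ ne, of "\<lambda>u. tree_dist \<Gamma> u ?l"] by (auto simp: not_less)
  have uV: "u \<in> verts \<Gamma>" using u pV by blast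
  have closest: "\<not> ?sep e u ?l" if "e \<in> edges \<Gamma>" "?sep e ?a ?b" for e
  proof (rule closest_on_path[OF tree pos p _ _ _ u(1) _ that])
    fix y assume y: "y \<in> set ?p"
    then have yV: "y \<in> verts \<Gamma>" using pV by blast
    show "(\<Sum>e | e \<in> edges \<Gamma> \<and> ?sep e u ?l. len \<Gamma> e) \<le> (\<Sum>e | e \<in> edges \<Gamma> \<and> ?sep e y ?l. len \<Gamma> e)"
      using u(2)[OF y] tree_dist_eq(2)[OF tree] uV yV V[OF legs(3)] by simp
  qed (use V legs in auto)
  have "?sep e ?a u \<longleftrightarrow> ?sep e ?a ?b \<and> ?sep e ?a ?l" if e: "e \<in> edges \<Gamma>" for e
    using on_path_not_separated[OF tree e p u(1)] closest[OF e]
    by (meson linked_sym linked_trans)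
  then have "{e. e \<in> edges \<Gamma> \<and> ?sep e ?a u} = {e. e \<in> edges \<Gamma> \<and> ?sep e ?a ?b \<and> ?sep e ?a ?l}"
    by blast
  then show ?thesis
    unfolding proj_dist_def u_def[symmetric] using tree_dist_eq(2)[OF tree V[OF legs(1)] uV] by simp
qed

fun pos :: "'a tree_scheme \<Rightarrow> site \<Rightarrow> nat" where
  "pos T (Vertex u) = u"
| "pos T (Leg l) = att T l"

lemma exit_edge:
  assumes tree: "is_tree V E" and V: "v \<in> V" "u \<in> V" and "v \<noteq> u"
  shows "\<exists>e\<in>E. v \<in> e \<and> separates E e v u"
proof -
  obtain p where p: "is_path E v p u" using tree_connected[OF tree V] linked_imp_path by blast
  then obtain y q where "p = v # y # q"
    using \<open>v \<noteq> u\<close> by (cases p; cases "tl p") (auto simp: is_path_def)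
  then have "{v, y} \<in> path_edges p" by simp
  then show ?thesis using separates_iff_path_edge[OF tree _ p] is_path_edges[OF p] by blast
qed

lemma branch_subset: "x \<in> sites n T - {Vertex v} \<Longrightarrow> branch n T v x \<subseteq> sites n T - {Vertex v}"
  unfolding branch_def by (auto elim: rtranclE)

lemma incident_sym: "(x, y) \<in> incident n T \<Longrightarrow> (y, x) \<in> incident n T"
  by (auto simp: incident_def insert_commute)

lemma branch_refl [simp]: "x \<in> branch n T v x"
  by (simp add: branch_def)

lemma branch_eq_iff_mem: "branch n T v x = branch n T v y \<longleftrightarrow> y \<in> branch n T v x"
proof -
  let ?R = "incident n T \<inter> (sites n T - {Vertex v}) \<times> (sites n T - {Vertex v})"
  have "sym (?R\<^sup>*)" by (intro sym_rtrancl symI) (auto intro: incident_sym)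
  then show ?thesis unfolding branch_def
    by (auto dest: symD intro: rtrancl_trans)
qed

text \<open>Two sites lie in the same branch at \<open>v\<close> as soon as some edge, not necessarily one at \<open>v\<close>,
  separates both from \<open>v\<close>: this turns every question about branches into one about cuts.\<close>

lemma branch_eq_iff:
  assumes st: "stable_tree n T" and v: "v \<in> verts T"
    and x: "x \<in> sites n T - {Vertex v}" and y: "y \<in> sites n T - {Vertex v}"
  shows "branch n T v x = branch n T v y \<longleftrightarrow>
    x = y \<or> (\<exists>e\<in>edges T. separates (edges T) e v (pos T x) \<and> separates (edges T) e v (pos T y))"
proof -
  have tree: "is_tree (verts T) (edges T)" and V: "\<And>l. l \<in> {1..n} \<Longrightarrow> att T l \<in> verts T"
    using st by (auto simp: stable_tree_def)
  let ?sep = "separates (edges T)" and ?N = "sites n T - {Vertex v}"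
  let ?R = "incident n T \<inter> ?N \<times> ?N"
  have posV: "pos T z \<in> verts T" if "z \<in> ?N" for z using that V by (auto simp: sites_def)
  have step: "?sep e v (pos T z)" if yz: "(y, z) \<in> ?R" and e: "v \<in> e" "?sep e v (pos T y)" for y z e
  proof -
    have "pos T y = pos T z \<or> {pos T y, pos T z} \<in> edges T \<and> v \<notin> {pos T y, pos T z}"
      using yz by (auto simp: incident_def)
    then have "linked (edges T - {e}) (pos T z) (pos T y)"
    proof
      assume "{pos T y, pos T z} \<in> edges T \<and> v \<notin> {pos T y, pos T z}"
      then have "{pos T z, pos T y} \<in> edges T - {e}" using e(1) by (auto simp: insert_commute)
      then show ?thesis by (rule linked_edge)
    qed simp
    then show ?thesis using e(2) linked_trans by blast
  qed
  have "x = y \<or> (\<exists>e\<in>edges T. v \<in> e \<and> ?sep e v (pos T x) \<and> ?sep e v (pos T y))"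
    if "(x, y) \<in> ?R\<^sup>*"
    using that
  proof (induction rule: rtrancl_induct)
    case (step y z)
    show ?case
    proof (cases "x = y")
      case True
      then have xz: "(x, z) \<in> ?R" using step(2) by simp
      then have "pos T x \<noteq> v" by (auto simp: incident_def sites_def)
      moreover have "pos T x \<in> verts T" using posV xz by blast
      ultimately obtain e where "e \<in> edges T" "v \<in> e" "?sep e v (pos T x)"
        using exit_edge[OF tree v] by metis
      then show ?thesis using \<open>\<And>y z e. (y, z) \<in> ?R \<Longrightarrow> v \<in> e \<Longrightarrow> ?sep e v (pos T y) \<Longrightarrow> ?sep e v (pos T z)\<close> xz by blast
    next
      case False
      then show ?thesis using step \<open>\<And>y z e. (y, z) \<in> ?R \<Longrightarrow> v \<in> e \<Longrightarrow> ?sep e v (pos T y) \<Longrightarrow> ?sep e v (pos T z)\<close> by blast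
    qed
  qed auto
  moreover have "(x, y) \<in> ?R\<^sup>*"
    if e: "e \<in> edges T" "?sep e v (pos T x)" "?sep e v (pos T y)" for e
  proof -
    let ?p = "pos T x" and ?q = "pos T y"
    have pq: "linked (edges T - {e}) ?p ?q"
      using separates_xor[OF tree e(1), of ?p ?q v] e posV x y v by blast
    have "(Vertex ?p, Vertex z) \<in> ?R\<^sup>*" if "linked (edges T - {e}) ?p z" for z
      using that unfolding linked_def
    proof (induction rule: rtrancl_induct)
      case (step z z')
      have "linked (edges T - {e}) ?p z" using step(1) by (simp add: linked_def)
      moreover have "linked (edges T - {e}) z z'" using step(2) by (auto intro: linked_edge)
      ultimately have "z \<noteq> v" "z' \<noteq> v" using e(2) linked_sym linked_trans by blast+
      then have "(Vertex z, Vertex z') \<in> ?R"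
        using step(2) tree_edgeD[OF tree, of z z'] by (auto simp: incident_def sites_def)
      then show ?case using step(3) by (meson rtrancl.rtrancl_into_rtrancl)
    qed auto
    then have 1: "(Vertex ?p, Vertex ?q) \<in> ?R\<^sup>*" using pq by blast
    have "?p \<noteq> v" "?q \<noteq> v" using e by auto
    then have "(x, Vertex ?p) \<in> ?R\<^sup>*" "(Vertex ?q, y) \<in> ?R\<^sup>*"
    proof -
      show "(x, Vertex ?p) \<in> ?R\<^sup>*" if "?p \<noteq> v"
        using that x posV[OF x] by (cases x) (auto simp: incident_def sites_def)
      show "(Vertex ?q, y) \<in> ?R\<^sup>*" if "?q \<noteq> v"
        using that y posV[OF y] by (cases y) (auto simp: incident_def sites_def)
    qed
    then show ?thesis using 1 by (meson rtrancl_trans)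
  qed
  moreover have "branch n T v x = branch n T v y \<longleftrightarrow> (x, y) \<in> ?R\<^sup>*"
    unfolding branch_eq_iff_mem by (simp add: branch_def)
  ultimately show ?thesis by (cases "x = y") blast+
qed

lemma leg_branch_eq_iff:
  assumes "stable_tree n T" "v \<in> verts T" "s \<in> {1..n}" "s' \<in> {1..n}"
  shows "branch n T v (Leg s) = branch n T v (Leg s') \<longleftrightarrow> s = s' \<or>
    (\<exists>e\<in>edges T. separates (edges T) e v (att T s) \<and> separates (edges T) e v (att T s'))"
  using branch_eq_iff[OF assms(1,2), of "Leg s" "Leg s'"] assms(3,4) by (auto simp: sites_def)

lemma card_ge_3_iff: "finite Q \<Longrightarrow> 3 \<le> card Q \<longleftrightarrow> (\<exists>a\<in>Q. \<exists>b\<in>Q. \<exists>c\<in>Q. a \<noteq> b \<and> a \<noteq> c \<and> b \<noteq> c)"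
proof
  assume "finite Q" "3 \<le> card Q"
  then obtain Y where "Y \<subseteq> Q" "card Y = 3" by (meson obtain_subset_with_card_n)
  then show "\<exists>a\<in>Q. \<exists>b\<in>Q. \<exists>c\<in>Q. a \<noteq> b \<and> a \<noteq> c \<and> b \<noteq> c" by (auto simp: card_3_iff)
next
  assume Q: "finite Q" and "\<exists>a\<in>Q. \<exists>b\<in>Q. \<exists>c\<in>Q. a \<noteq> b \<and> a \<noteq> c \<and> b \<noteq> c"
  then obtain a b c where "{a, b, c} \<subseteq> Q" "a \<noteq> b" "a \<noteq> c" "b \<noteq> c" by blast
  moreover from this have "card {a, b, c} = 3" by simp
  ultimately show "3 \<le> card Q" using card_mono[OF Q] by metis
qed

lemma branches_meeting:
  assumes "A \<subseteq> {1..n}"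
  shows "{\<beta> \<in> branches n T v. meets \<beta> A} = (\<lambda>s. branch n T v (Leg s)) ` A"
proof safe
  fix \<beta> assume "\<beta> \<in> branches n T v" "meets \<beta> A"
  then obtain x s where "\<beta> = branch n T v x" "s \<in> A" "Leg s \<in> \<beta>"
    by (auto simp: branches_def meets_def)
  then show "\<beta> \<in> (\<lambda>s. branch n T v (Leg s)) ` A" using branch_eq_iff_mem by blast
next
  fix s assume "s \<in> A"
  then show "meets (branch n T v (Leg s)) A" unfolding meets_def using branch_refl by (rule bexI[rotated])
  show "branch n T v (Leg s) \<in> branches n T v"
    unfolding branches_def using \<open>s \<in> A\<close> assms by (intro imageI) (auto simp: sites_def)
qed

text \<open>A vertex that still has another element of \<open>A\<close> on the branch towards \<open>a\<close> is not the closest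
  one: the median of \<open>a\<close>, that element and the vertex itself is closer and again has three branches.
  Conversely, an edge between \<open>a\<close> and \<open>v\<close> has all of \<open>A - {a}\<close> behind it, so a vertex not beyond it sees
  them in a single branch.\<close>

lemma hull_vertex_iff:
  assumes \<Gamma>: "\<Gamma> \<in> M0n_trop n" and A: "A \<subseteq> {1..n}" "a \<in> A"
  shows "hull_vertex n \<Gamma> A a v \<longleftrightarrow> v \<in> verts \<Gamma> \<and>
     (\<forall>s\<in>A - {a}. branch n \<Gamma> v (Leg s) \<noteq> branch n \<Gamma> v (Leg a)) \<and>
     (\<exists>s1\<in>A - {a}. \<exists>s2\<in>A - {a}. branch n \<Gamma> v (Leg s1) \<noteq> branch n \<Gamma> v (Leg s2))"
    (is "_ \<longleftrightarrow> ?R")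
proof -
  have st: "stable_tree n \<Gamma>" and tree: "is_tree (verts \<Gamma>) (edges \<Gamma>)"
    and V: "\<And>x. x \<in> A \<Longrightarrow> att \<Gamma> x \<in> verts \<Gamma>"
    and pos: "\<And>e. e \<in> edges \<Gamma> \<Longrightarrow> len \<Gamma> e > 0"
    using \<Gamma> A by (auto simp: M0n_trop_def stable_tree_def)
  let ?sep = "separates (edges \<Gamma>)" and ?at = "att \<Gamma>"
  let ?br = "\<lambda>v s. branch n \<Gamma> v (Leg s)"
  note dist = tree_dist_eq(2)[OF tree V[OF A(2)]]
  have finE: "finite (edges \<Gamma>)" using tree_finite[OF tree] by blast
  have finA: "finite A" using A finite_subset by blast
  have same: "?br u s = ?br u s' \<longleftrightarrow> s = s' \<or> (\<exists>e\<in>edges \<Gamma>. ?sep e u (?at s) \<and> ?sep e u (?at s'))"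
    if "u \<in> verts \<Gamma>" "s \<in> A" "s' \<in> A" for u s s'
    using leg_branch_eq_iff[OF st that(1)] that A by blast
  have three: "card {\<beta> \<in> branches n \<Gamma> u. meets \<beta> A} \<ge> 3 \<longleftrightarrow>
      (\<exists>s\<in>A. \<exists>s'\<in>A. \<exists>s''\<in>A. ?br u s \<noteq> ?br u s' \<and> ?br u s \<noteq> ?br u s'' \<and> ?br u s' \<noteq> ?br u s'')" for u
    unfolding branches_meeting[OF A(1)] card_ge_3_iff[OF finite_imageI[OF finA]] by blast
  show ?thesis
  proof
    assume h: "hull_vertex n \<Gamma> A a v"
    then have v: "v \<in> verts \<Gamma>" and t: "card {\<beta> \<in> branches n \<Gamma> v. meets \<beta> A} \<ge> 3"
      and min: "\<And>u. u \<in> verts \<Gamma> \<Longrightarrow> card {\<beta> \<in> branches n \<Gamma> u. meets \<beta> A} \<ge> 3 \<Longrightarrow>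
        tree_dist \<Gamma> (?at a) v \<le> tree_dist \<Gamma> (?at a) u"
      unfolding hull_vertex_def is_arg_min_def by (auto simp: not_less)
    have "?br v s \<noteq> ?br v a" if s: "s \<in> A - {a}" for s
    proof
      assume "?br v s = ?br v a"
      then obtain e where e: "e \<in> edges \<Gamma>" "?sep e v (?at s)" "?sep e v (?at a)"
        using same[OF v] s A(2) by blast
      obtain s' where s': "s' \<in> A" "?br v s' \<noteq> ?br v a"
        using t unfolding three by metis
      have sA: "s \<in> A" using s by blast
      obtain m where m: "m \<in> verts \<Gamma>" "\<And>f. f \<in> edges \<Gamma> \<Longrightarrow>
          if ?sep f (?at a) (?at s) then \<not> ?sep f m v else \<not> ?sep f m (?at a)"
        using median_exists[OF tree V[OF A(2)] V[OF sA] v] by blast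
      have "?br m a \<noteq> ?br m s"
      proof
        assume "?br m a = ?br m s"
        then obtain f where f: "f \<in> edges \<Gamma>" "?sep f m (?at a)" "?sep f m (?at s)"
          using same[OF m(1) A(2) sA] s by blast
        then have "\<not> ?sep f (?at a) (?at s)"
          using separates_xor[OF tree f(1) V[OF A(2)] V[OF sA] m(1)] by simp
        then show False using m(2)[OF f(1)] f(2) by presburger
      qed
      moreover have other: "?br m x \<noteq> ?br m s'" if x: "x = a \<or> x = s" for x
      proof
        have xA: "x \<in> A" using x A(2) sA by blast
        have xs': "?br v x \<noteq> ?br v s'" using x s' \<open>?br v s = ?br v a\<close> by metis
        assume "?br m x = ?br m s'"
        then obtain f where f: "f \<in> edges \<Gamma>" "?sep f m (?at x)" "?sep f m (?at s')"
          using same[OF m(1) xA s'(1)] xs' by blast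
        have "?sep f (?at a) (?at s)"
        proof
          assume as: "linked (edges \<Gamma> - {f}) (?at a) (?at s)"
          then have "linked (edges \<Gamma> - {f}) m (?at a)" using m(2)[OF f(1)] by simp
          then show False using as x f(2) linked_trans by blast
        qed
        then have "\<not> ?sep f m v" using m(2)[OF f(1)] by simp
        then have "?sep f v (?at x)" "?sep f v (?at s')" using f(2,3) by (meson linked_sym linked_trans)+
        then show False using same[OF v xA s'(1)] xs' f(1) by blast
      qed
      ultimately have "card {\<beta> \<in> branches n \<Gamma> m. meets \<beta> A} \<ge> 3"
        unfolding three using A(2) sA s'(1) other[of a] other[of s] by metis
      then have "tree_dist \<Gamma> (?at a) v \<le> tree_dist \<Gamma> (?at a) m" using min m(1) by blast
      moreover have "tree_dist \<Gamma> (?at a) m < tree_dist \<Gamma> (?at a) v"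
        unfolding dist[OF m(1)] dist[OF v]
      proof (rule sum_strict_mono2[of _ _ e])
        show "{f \<in> edges \<Gamma>. ?sep f (?at a) m} \<subseteq> {f \<in> edges \<Gamma>. ?sep f (?at a) v}"
          using m(2) by (auto split: if_splits) (meson linked_sym linked_trans)+
        have "\<not> ?sep e (?at a) (?at s)"
          using separates_xor[OF tree e(1), of "?at a" "?at s" v] e V A(2) sA v by blast
        then have "\<not> ?sep e (?at a) m" using m(2)[OF e(1)] linked_sym by auto
        then show "e \<in> {f \<in> edges \<Gamma>. ?sep f (?at a) v} - {f \<in> edges \<Gamma>. ?sep f (?at a) m}"
          using e linked_sym by blast
      qed (use finE pos e in \<open>auto intro: less_imp_le\<close>)
      ultimately show False by simp
    qed
    then show ?R using v t unfolding three by (metis Diff_iff singletonD)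
  next
    assume R: ?R
    then obtain s1 s2 where s12: "s1 \<in> A - {a}" "s2 \<in> A - {a}" "?br v s1 \<noteq> ?br v s2" and v: "v \<in> verts \<Gamma>"
      by blast
    then have t: "card {\<beta> \<in> branches n \<Gamma> v. meets \<beta> A} \<ge> 3"
      unfolding three using R A(2) by (metis Diff_iff)
    have "tree_dist \<Gamma> (?at a) v \<le> tree_dist \<Gamma> (?at a) u"
      if u: "u \<in> verts \<Gamma>" "card {\<beta> \<in> branches n \<Gamma> u. meets \<beta> A} \<ge> 3" for u
      unfolding dist[OF u(1)] dist[OF v]
    proof (rule sum_mono2)
      obtain s s' where s: "s \<in> A - {a}" "s' \<in> A - {a}" "?br u s \<noteq> ?br u s'"
        using u(2) unfolding three by (metis Diff_iff empty_iff insert_iff)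
      have "?sep f (?at a) u" if f: "f \<in> edges \<Gamma>" "?sep f (?at a) v" for f
      proof (rule ccontr)
        assume au: "\<not> ?sep f (?at a) u"
        have "?sep f u (?at x)" if x: "x \<in> A - {a}" for x
        proof -
          have "\<not> ?sep f v (?at x)"
            using R x same[OF v, of x a] f A(2) linked_sym by blast
          then show ?thesis using au f(2) by (meson linked_sym linked_trans)
        qed
        then have "?br u s = ?br u s'" using same[OF u(1)] s f(1) by blast
        then show False using s by simp
      qed
      then show "{f \<in> edges \<Gamma>. ?sep f (?at a) v} \<subseteq> {f \<in> edges \<Gamma>. ?sep f (?at a) u}" by blast
    qed (use finE pos in \<open>auto intro: less_imp_le\<close>)
    then show "hull_vertex n \<Gamma> A a v"
      unfolding hull_vertex_def is_arg_min_def using v t by (auto simp: not_less)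
  qed
qed

section \<open>Collapsing edges and isometries\<close>

text \<open>Contractions (\<open>F\<close> a single edge) and isomorphisms (\<open>F\<close> empty) are treated together.\<close>

definition collapses ::
    "(nat \<Rightarrow> nat) \<Rightarrow> nat set \<Rightarrow> nat set set \<Rightarrow> nat set set \<Rightarrow> nat set \<Rightarrow> nat set set \<Rightarrow> bool" where
  "collapses \<pi> V' E' F V E \<longleftrightarrow> F \<subseteq> E' \<and> V = \<pi> ` V' \<and>
     (\<forall>u\<in>V'. \<forall>w\<in>V'. \<pi> u = \<pi> w \<longleftrightarrow> u = w \<or> {u, w} \<in> F) \<and> E = (\<lambda>f. \<pi> ` f) ` (E' - F)"

context
  fixes \<pi> V' E' F V E
  assumes tree: "is_tree V' E'" and col: "collapses \<pi> V' E' F V E"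
begin

lemma collapse_fibre: "u \<in> V' \<Longrightarrow> w \<in> V' \<Longrightarrow> \<pi> u = \<pi> w \<longleftrightarrow> u = w \<or> {u, w} \<in> F"
  and collapse_verts: "V = \<pi> ` V'" and collapse_edges: "E = (\<lambda>f. \<pi> ` f) ` (E' - F)"
  and collapse_subset: "F \<subseteq> E'"
  using col unfolding collapses_def by blast+

lemma collapse_fibre_not_separated:
  assumes "f \<in> E' - F" "u \<in> V'" "w \<in> V'" "\<pi> u = \<pi> w"
  shows "\<not> separates E' f u w"
proof -
  consider "u = w" | "{u, w} \<in> F" using collapse_fibre assms by blast
  then show ?thesis
  proof cases
    case 2
    then have "{u, w} \<in> E' - {f}" using assms(1) collapse_subset by blast
    then show ?thesis using linked_edge[of u w "E' - {f}"] by simp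
  qed simp
qed

text \<open>Two edges with the same image would have their ends joined by collapsed edges, which provides a detour
  around a bridge.\<close>

lemma collapse_inj: "inj_on (\<lambda>f. \<pi> ` f) (E' - F)"
proof (rule inj_onI, rule ccontr)
  fix f g assume fg: "f \<in> E' - F" "g \<in> E' - F" "\<pi> ` f = \<pi> ` g" "f \<noteq> g"
  obtain a b where f: "f = {a, b}" "a \<in> V'" "b \<in> V'" using tree_edge[OF tree, of f] fg by blast
  have "\<pi> a \<in> \<pi> ` g" "\<pi> b \<in> \<pi> ` g" using fg(3) f(1) by auto
  then obtain c d where g: "c \<in> g" "d \<in> g" "\<pi> a = \<pi> c" "\<pi> b = \<pi> d" by auto
  obtain p q where pq: "g = {p, q}" "p \<in> V'" "q \<in> V'" using tree_edge[OF tree, of g] fg by blast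
  have cd: "c \<in> V'" "d \<in> V'" using pq g by blast+
  have "linked (E' - {f}) p q" using pq fg by (intro linked_edge) auto
  then have "linked (E' - {f}) c d" using g(1,2) pq(1) linked_sym by auto
  moreover have "\<not> separates E' f a c" "\<not> separates E' f b d"
    using collapse_fibre_not_separated[OF fg(1)] f cd g by blast+
  ultimately have "linked (E' - {f}) a b" by (meson linked_sym linked_trans)
  then show False using tree_bridge[OF tree, of a b] fg(1) f by auto
qed

text \<open>Collapsed edges do not cross the split defined by another edge \<open>f\<close>, so the function that tells the sides
  of \<open>f\<close> apart descends to the quotient. The side is measured from an arbitrary base vertex.\<close>

definition lifted_cut :: "nat set \<Rightarrow> nat \<Rightarrow> bool" where
  "lifted_cut f x \<longleftrightarrow> separates E' f (SOME r. r \<in> V') (inv_into V' \<pi> x)"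

lemma lifted_cut:
  assumes f: "f \<in> E' - F" and V: "u \<in> V'" "w \<in> V'"
  shows "lifted_cut f (\<pi> u) \<noteq> lifted_cut f (\<pi> w) \<longleftrightarrow> separates E' f u w"
proof -
  let ?i = "inv_into V' \<pi>" and ?r = "SOME r. r \<in> V'"
  have f': "f \<in> E'" using f by blast
  have i: "?i (\<pi> u) \<in> V'" "\<pi> (?i (\<pi> u)) = \<pi> u" "?i (\<pi> w) \<in> V'" "\<pi> (?i (\<pi> w)) = \<pi> w"
    using V by (auto intro: inv_into_into f_inv_into_f)
  have "?r \<in> V'" using V(1) by (rule someI)
  then have "lifted_cut f (\<pi> u) \<noteq> lifted_cut f (\<pi> w) \<longleftrightarrow> separates E' f (?i (\<pi> u)) (?i (\<pi> w))"
    unfolding lifted_cut_def using separates_xor[OF tree f' i(1,3)] by blast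
  moreover have "linked (E' - {f}) (?i (\<pi> u)) u" "linked (E' - {f}) (?i (\<pi> w)) w"
    using collapse_fibre_not_separated[OF f] i V by blast+
  ultimately show ?thesis by (meson linked_sym linked_trans)
qed

lemma lifted_cut_edges:
  assumes f: "f \<in> E' - F" and xy: "{x, y} \<in> E"
  shows "lifted_cut f x \<noteq> lifted_cut f y \<longleftrightarrow> {x, y} = \<pi> ` f"
proof -
  obtain g where g: "g \<in> E' - F" "{x, y} = \<pi> ` g" using xy collapse_edges by auto
  obtain a b where ab: "g = {a, b}" "a \<in> V'" "b \<in> V'" using tree_edge[OF tree, of g] g(1) by blast
  have "separates E' f a b \<longleftrightarrow> g = f"
  proof
    show "separates E' f a b \<Longrightarrow> g = f" using ab g separates_other_edge[OF tree, of a b f] by auto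
    show "g = f \<Longrightarrow> separates E' f a b" using ab g tree_bridge[OF tree, of a b] by auto
  qed
  moreover have "g = f \<longleftrightarrow> \<pi> ` g = \<pi> ` f" using collapse_inj f g(1) by (auto dest: inj_onD)
  moreover have "{x, y} = {\<pi> a, \<pi> b}" using g(2) ab(1) by simp
  then have "lifted_cut f x \<noteq> lifted_cut f y \<longleftrightarrow> lifted_cut f (\<pi> a) \<noteq> lifted_cut f (\<pi> b)"
    by (auto simp: doubleton_eq_iff)
  ultimately show ?thesis using lifted_cut[OF f ab(2,3)] g(2) by simp
qed

lemma collapse_tree: "is_tree V E"
proof (rule is_treeI)
  show "finite V" "V \<noteq> {}"
    using tree unfolding collapse_verts by (auto simp: is_tree_def)
  show "e \<subseteq> V \<and> card e = 2" if e: "e \<in> E" for e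
  proof -
    obtain g where g: "g \<in> E' - F" "e = \<pi> ` g" using e collapse_edges by auto
    obtain a b where ab: "g = {a, b}" "a \<in> V'" "b \<in> V'" "a \<noteq> b"
      using tree_edge[OF tree, of g] g(1) by blast
    then have "\<pi> a \<noteq> \<pi> b" using collapse_fibre[of a b] g(1) by blast
    then show ?thesis using ab g(2) collapse_verts by auto
  qed
  show "linked E u w" if uw: "u \<in> V" "w \<in> V" for u w
  proof -
    obtain x y where xy: "x \<in> V'" "y \<in> V'" "u = \<pi> x" "w = \<pi> y" using uw collapse_verts by auto
    have "linked E (\<pi> a) (\<pi> b)" if ab: "{a, b} \<in> E'" for a b
    proof (cases "{a, b} \<in> F")
      case True
      then have "\<pi> a = \<pi> b" using collapse_fibre[of a b] tree_edgeD[OF tree ab] by blast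
      then show ?thesis by simp
    next
      case False
      then have "\<pi> ` {a, b} \<in> E" using ab collapse_edges by blast
      then show ?thesis by (auto intro: linked_edge)
    qed
    then show ?thesis using linked_lift tree_connected[OF tree xy(1,2)] xy(3,4) by blast
  qed
  show "separates E {x, y} x y" if xy: "{x, y} \<in> E" for x y
  proof
    obtain f where f: "f \<in> E' - F" "{x, y} = \<pi> ` f" using xy collapse_edges by auto
    assume "linked (E - {{x, y}}) x y"
    then have "lifted_cut f x = lifted_cut f y"
      by (rule linked_invariant) (use lifted_cut_edges[OF f(1)] f(2) in blast)
    then show False using lifted_cut_edges[OF f(1) xy] f(2) by blast
  qed
qed

lemma collapse_separates:
  assumes f: "f \<in> E' - F" and V: "u \<in> V'" "w \<in> V'"
  shows "separates E (\<pi> ` f) (\<pi> u) (\<pi> w) \<longleftrightarrow> separates E' f u w"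
proof -
  have "\<pi> ` f \<in> E" "\<pi> u \<in> V" "\<pi> w \<in> V" using f V collapse_edges collapse_verts by auto
  then have "separates E (\<pi> ` f) (\<pi> u) (\<pi> w) \<longleftrightarrow> lifted_cut f (\<pi> u) \<noteq> lifted_cut f (\<pi> w)"
    by (intro cut_function[OF collapse_tree]) (use lifted_cut_edges[OF f] in \<open>metis\<close>)+
  then show ?thesis using lifted_cut[OF f V] by blast
qed

end

text \<open>Merging the two ends of an edge adds their valences and loses two, and \<open>3 + 3 - 2 \<ge> 3\<close>.\<close>

lemma collapse_stable:
  assumes st: "stable_tree n T'" and col: "collapses \<pi> (verts T') (edges T') F (verts T) (edges T)"
    and F: "F = {} \<or> F = {e}" and att: "\<And>l. l \<in> {1..n} \<Longrightarrow> att T l = \<pi> (att T' l)"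
  shows "stable_tree n T"
proof -
  have tree: "is_tree (verts T') (edges T')" and attV: "\<And>l. l \<in> {1..n} \<Longrightarrow> att T' l \<in> verts T'"
    and val: "\<And>v. v \<in> verts T' \<Longrightarrow> card {e \<in> edges T'. v \<in> e} + card {l \<in> {1..n}. att T' l = v} \<ge> 3"
    using st by (auto simp: stable_tree_def)
  note fib = collapse_fibre[OF tree col] and cv = collapse_verts[OF tree col]
    and ce = collapse_edges[OF tree col]
  have fin: "finite (edges T')" using tree_finite[OF tree] by blast
  have "card {e \<in> edges T. v \<in> e} + card {l \<in> {1..n}. att T l = v} \<ge> 3" if v: "v \<in> verts T" for v
  proof -
    obtain u where u: "u \<in> verts T'" "v = \<pi> u" using v cv by auto
    let ?S = "{f \<in> edges T' - F. \<exists>x\<in>f. \<pi> x = v}"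
    have "{e \<in> edges T. v \<in> e} = (\<lambda>f. \<pi> ` f) ` ?S" unfolding ce by blast
    moreover have "inj_on (\<lambda>f. \<pi> ` f) ?S"
      using collapse_inj[OF tree col] by (rule inj_on_subset) blast
    ultimately have 1: "card {e \<in> edges T. v \<in> e} = card ?S" by (simp add: card_image)
    have edgeV: "x \<in> verts T'" if "x \<in> f" "f \<in> edges T'" for x f
      using tree_edge[OF tree that(2)] that(1) by blast
    show ?thesis
    proof (cases "\<exists>x\<in>verts T'. {u, x} \<in> F")
      case False
      then have only: "\<pi> x = v \<longleftrightarrow> x = u" if "x \<in> verts T'" for x
        using fib[OF u(1) that] u(2) False that by metis
      have "?S = {f \<in> edges T'. u \<in> f}"
      proof (intro equalityI subsetI)
        fix f assume f: "f \<in> {f \<in> edges T'. u \<in> f}"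
        then have "f \<notin> F"
          using False tree_edge[OF tree, of f] by (auto simp: insert_commute)
        then show "f \<in> ?S" using f u by blast
      qed (use only edgeV in auto)
      moreover have "{l \<in> {1..n}. att T l = v} = {l \<in> {1..n}. att T' l = u}"
        by (intro Collect_cong conj_cong refl) (use att attV only in metis)
      ultimately show ?thesis using 1 val[OF u(1)] by simp
    next
      case True
      then obtain x where x: "x \<in> verts T'" "{u, x} \<in> F" by blast
      then have Fe: "F = {{u, x}}" using F by auto
      have eE: "{u, x} \<in> edges T'" using x(2) collapse_subset[OF tree col] by blast
      then have ux: "u \<noteq> x" using tree_edgeD[OF tree] by blast
      have both: "\<pi> y = v \<longleftrightarrow> y = u \<or> y = x" if "y \<in> verts T'" for y
        using fib[OF u(1) that] u(2) Fe by (metis doubleton_eq_iff insert_iff singletonD)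
      let ?A = "\<lambda>z. {f \<in> edges T'. z \<in> f} - {{u, x}}"
      have S: "?S = ?A u \<union> ?A x" using both edgeV Fe u by auto
      have dis: "?A u \<inter> ?A x = {}"
      proof (rule ccontr)
        assume "?A u \<inter> ?A x \<noteq> {}"
        then obtain f where f: "f \<in> edges T'" "u \<in> f" "x \<in> f" "f \<noteq> {u, x}" by blast
        then show False using tree_edge[OF tree f(1)] ux by auto
      qed
      have "card (?A z) = card {f \<in> edges T'. z \<in> f} - 1" if "z \<in> {u, x}" for z
        using that eE fin by (subst card_Diff_singleton) auto
      then have c1: "card ?S = (card {f \<in> edges T'. u \<in> f} - 1) + (card {f \<in> edges T'. x \<in> f} - 1)"
        unfolding S using dis fin by (subst card_Un_disjoint) auto
      have "att T l = v \<longleftrightarrow> att T' l = u \<or> att T' l = x" if "l \<in> {1..n}" for l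
        using att[OF that] both[OF attV[OF that]] by metis
      then have "{l \<in> {1..n}. att T l = v} = {l \<in> {1..n}. att T' l = u} \<union> {l \<in> {1..n}. att T' l = x}"
        by blast
      then have c2: "card {l \<in> {1..n}. att T l = v}
          = card {l \<in> {1..n}. att T' l = u} + card {l \<in> {1..n}. att T' l = x}"
        using ux by (subst card_Un_disjoint[symmetric]) auto
      have "card {f \<in> edges T'. z \<in> f} > 0" if "z \<in> {u, x}" for z
        using that eE fin by (auto simp: card_gt_0_iff)
      then show ?thesis using 1 c1 c2 val[OF u(1)] val[OF x(1)] by force
    qed
  qed
  then show ?thesis
    unfolding stable_tree_def using collapse_tree[OF tree col] att attV cv by auto
qed

lemma contraction_collapses:
  "contraction n \<pi> T' e T \<Longrightarrow> collapses \<pi> (verts T') (edges T') {e} (verts T) (edges T)"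
  by (auto simp: contraction_def collapses_def)

lemma isometric_collapses:
  assumes "isometric n \<Gamma> \<Gamma>'"
  obtains f where "collapses f (verts \<Gamma>) (edges \<Gamma>) {} (verts \<Gamma>') (edges \<Gamma>')"
    "bij_betw f (verts \<Gamma>) (verts \<Gamma>')"
    "\<And>l. l \<in> {1..n} \<Longrightarrow> att \<Gamma>' l = f (att \<Gamma> l)" "\<And>e. e \<in> edges \<Gamma> \<Longrightarrow> len \<Gamma>' (f ` e) = len \<Gamma> e"
proof -
  obtain f where f: "bij_betw f (verts \<Gamma>) (verts \<Gamma>')" "edges \<Gamma>' = (\<lambda>e. f ` e) ` edges \<Gamma>"
    "\<forall>l\<in>{1..n}. att \<Gamma>' l = f (att \<Gamma> l)" "\<forall>e\<in>edges \<Gamma>. len \<Gamma>' (f ` e) = len \<Gamma> e"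
    using assms by (auto simp: isometric_def)
  then have "collapses f (verts \<Gamma>) (edges \<Gamma>) {} (verts \<Gamma>') (edges \<Gamma>')"
    by (auto simp: collapses_def bij_betw_def inj_on_eq_iff)
  then show thesis using that f by blast
qed

text \<open>Splits of the legs are recorded relative to leg \<open>1\<close>; the complementary description of the same split is
  thereby excluded.\<close>

definition cut :: "'a tree_scheme \<Rightarrow> nat set \<Rightarrow> nat \<Rightarrow> bool" where
  "cut T e a \<longleftrightarrow> separates (edges T) e (att T 1) (att T a)"

lemma cut_neq_iff:
  assumes "stable_tree n T" "e \<in> edges T" "a \<in> {1..n}" "b \<in> {1..n}" "n \<ge> 1"
  shows "cut T e a \<noteq> cut T e b \<longleftrightarrow> separates (edges T) e (att T a) (att T b)"
  unfolding cut_def using assms separates_xor[of "verts T" "edges T" e "att T a" "att T b" "att T 1"]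
  by (auto simp: stable_tree_def)

lemma cut_compatible:
  assumes "stable_tree n T" "e \<in> edges T" "f \<in> edges T" "e \<noteq> f" "n \<ge> 1"
    and legs: "a \<in> {1..n}" "b \<in> {1..n}" "c \<in> {1..n}" "d \<in> {1..n}"
    and "cut T e a = cut T e b" "cut T e c = cut T e d" "cut T f a \<noteq> cut T f b" "cut T f c \<noteq> cut T f d"
  shows "cut T e a = cut T e c"
proof -
  have "is_tree (verts T) (edges T)" using assms by (simp add: stable_tree_def)
  moreover have "\<forall>l\<in>{1..n}. att T l \<in> verts T" using assms by (simp add: stable_tree_def)
  ultimately show ?thesis
    using quadrant_empty[of "verts T" "edges T" e f "att T a" "att T b" "att T c" "att T d"] assms
      cut_neq_iff[OF assms(1,2) _ _ assms(5)] cut_neq_iff[OF assms(1,3) _ _ assms(5)]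
    by blast
qed

lemma collapse_cut:
  assumes st: "stable_tree n T'" "n \<ge> 1"
    and col: "collapses \<pi> (verts T') (edges T') F (verts T) (edges T)"
    and att: "\<And>l. l \<in> {1..n} \<Longrightarrow> att T l = \<pi> (att T' l)"
    and f: "f \<in> edges T' - F" and a: "a \<in> {1..n}"
  shows "cut T (\<pi> ` f) a \<longleftrightarrow> cut T' f a"
  unfolding cut_def att[OF a] using att[of 1] st(2)
  using collapse_separates[OF _ col f] st a by (auto simp: stable_tree_def)

section \<open>Triangular systems with widely separated right-hand sides\<close>

definition triangular :: "(nat \<Rightarrow> nat set) \<Rightarrow> nat \<Rightarrow> bool" where
  "triangular P r \<longleftrightarrow> (\<forall>q\<in>{1..r}. q \<in> P q \<and> P q \<subseteq> {q..r})"

text \<open>Unitriangular systems are solved from the last equation upwards.\<close>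

lemma downward_induct [consumes 1, case_names step]:
  assumes "q \<in> {1..r :: nat}"
    and "\<And>q. q \<in> {1..r} \<Longrightarrow> (\<And>s. s \<in> {1..r} \<Longrightarrow> q < s \<Longrightarrow> Q s) \<Longrightarrow> Q q"
  shows "Q q"
  using assms(1) by (induction "r - q" arbitrary: q rule: less_induct) (use assms(2) in force)

lemma triangular_sum:
  assumes "triangular P r" "q \<in> {1..r}"
  shows "sum L (P q) = (L q :: 'a :: comm_monoid_add) + sum L (P q - {q})" "P q - {q} \<subseteq> {q<..r}"
    "finite (P q)"
proof -
  have "q \<in> P q" "P q \<subseteq> {q..r}" using assms by (auto simp: triangular_def)
  moreover from this show "finite (P q)" by (meson finite_atLeastAtMost finite_subset)
  ultimately show "sum L (P q) = L q + sum L (P q - {q})" "P q - {q} \<subseteq> {q<..r}"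
    by (auto simp: sum.remove)
qed

lemma triangular_unique:
  fixes L L' :: "nat \<Rightarrow> real"
  assumes tri: "triangular P r" and "\<And>q. q \<in> {1..r} \<Longrightarrow> sum L (P q) = sum L' (P q)" and "q \<in> {1..r}"
  shows "L q = L' q"
  using assms(3)
proof (induction rule: downward_induct)
  case (step q)
  have "sum L (P q - {q}) = sum L' (P q - {q})"
    using triangular_sum(2)[OF tri step(1)] step by (intro sum.cong) auto
  then show ?case using assms(2)[OF step(1)] triangular_sum(1)[OF tri step(1)] by (metis add_right_cancel)
qed

lemma triangular_solvable:
  assumes tri: "triangular P r"
  shows "\<exists>L :: nat \<Rightarrow> real. \<forall>q\<in>{1..r}. sum L (P q) = b q"
proof -
  have "\<exists>L :: nat \<Rightarrow> real. \<forall>q\<in>{1..r}. r < q + p \<longrightarrow> sum L (P q) = b q" for p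
  proof (induction p)
    case (Suc p)
    then obtain L :: "nat \<Rightarrow> real" where L: "\<And>q. q \<in> {1..r} \<Longrightarrow> r < q + p \<Longrightarrow> sum L (P q) = b q" by blast
    show ?case
    proof (cases "p < r")
      case True
      let ?L = "L(r - p := b (r - p) - sum L (P (r - p) - {r - p}))"
      have "sum ?L (P q) = b q" if q: "q \<in> {1..r}" "r < q + Suc p" for q
      proof (cases "q = r - p")
        case True
        then have "sum ?L (P q - {q}) = sum L (P q - {q})" by (intro sum.cong) auto
        then show ?thesis unfolding triangular_sum(1)[OF tri q(1)] using True by simp
      next
        case False
        have "r - p < q" using q(2) False by linarith
        moreover have "P q \<subseteq> {q..r}" using tri q(1) unfolding triangular_def by blast
        ultimately have "r - p \<notin> P q" by auto
        then have "sum ?L (P q) = sum L (P q)" by (intro sum.cong) auto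
        then show ?thesis using L[OF q(1)] q False by auto
      qed
      then show ?thesis by blast
    next
      case False
      then show ?thesis using L by (intro exI[of _ L]) auto
    qed
  qed auto
  from this[of "Suc r"] show ?thesis by auto
qed

lemma triangular_integral:
  assumes tri: "triangular P r" and "\<And>q. q \<in> {1..r} \<Longrightarrow> sum L (P q) \<in> (\<int> :: real set)" and "q \<in> {1..r}"
  shows "L q \<in> \<int>"
  using assms(3)
proof (induction rule: downward_induct)
  case (step q)
  have "sum L (P q - {q}) \<in> \<int>" using triangular_sum(2)[OF tri step(1)] step by (intro Ints_sum) auto
  then show ?case using assms(2)[OF step(1)] triangular_sum(1)[OF tri step(1), of L]
    by (metis Ints_diff add_diff_cancel_right')
qed

text \<open>Dropping the last unknown changes the others by at most a doubling amount per step up.\<close>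

lemma triangular_perturbation:
  fixes L L' :: "nat \<Rightarrow> real"
  assumes tri: "triangular P (r + 1)"
    and eq: "\<And>q. q \<in> {1..r} \<Longrightarrow> sum L (P q) = sum L' (P q - {r + 1})" and "L (r + 1) \<ge> 0" and "q \<in> {1..r}"
  shows "\<bar>L q - L' q\<bar> \<le> 2 ^ (r - q) * L (r + 1)"
  using assms(4)
proof (induction rule: downward_induct)
  case (step q)
  let ?R = "P q - {r + 1} - {q}"
  have q': "q \<in> {1..r + 1}" using step(1) by simp
  have fin: "finite (P q)" and sub: "?R \<subseteq> {q<..r}"
    using triangular_sum(2,3)[OF tri q'] by auto
  have "q \<in> P q - {r + 1}" using tri step(1) by (auto simp: triangular_def)
  then have 1: "sum L' (P q - {r + 1}) = L' q + sum L' ?R" "sum L (P q - {r + 1}) = L q + sum L ?R"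
    using fin by (simp_all add: sum.remove)
  have 2: "sum L (P q) = (if r + 1 \<in> P q then L (r + 1) else 0) + sum L (P q - {r + 1})"
    using fin by (auto simp: sum.remove)
  have geo: "(\<Sum>s\<in>{q<..r}. (2::real) ^ (r - s)) = 2 ^ (r - q) - 1" if "q \<le> r" for q r :: nat
    using that
  proof (induction r)
    case (Suc r)
    show ?case
    proof (cases "q = Suc r")
      case False
      then have "{q<..Suc r} = insert (Suc r) {q<..r}" using Suc.prems by auto
      moreover have "(\<Sum>s\<in>{q<..r}. (2::real) ^ (Suc r - s)) = 2 * (\<Sum>s\<in>{q<..r}. 2 ^ (r - s))"
        by (simp add: sum_distrib_left Suc_diff_le)
      ultimately show ?thesis using Suc False by (simp add: Suc_diff_le)
    qed simp
  qed simp
  have "L q - L' q = sum L' ?R - sum L ?R - (if r + 1 \<in> P q then L (r + 1) else 0)"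
    using eq[OF step(1)] 1 2 by simp
  also have "\<bar>\<dots>\<bar> \<le> (\<Sum>s\<in>?R. \<bar>L s - L' s\<bar>) + L (r + 1)"
  proof -
    have "\<bar>sum L' ?R - sum L ?R\<bar> \<le> (\<Sum>s\<in>?R. \<bar>L s - L' s\<bar>)"
      unfolding sum_subtractf[symmetric] by (rule order.trans[OF sum_abs]) (simp add: abs_minus_commute)
    then show ?thesis using assms(3) by auto
  qed
  also have "(\<Sum>s\<in>?R. \<bar>L s - L' s\<bar>) \<le> (\<Sum>s\<in>{q<..r}. 2 ^ (r - s) * L (r + 1))"
  proof (rule sum_le_included[where i = "\<lambda>x. x"])
    show "\<forall>s\<in>{q<..r}. 0 \<le> 2 ^ (r - s) * L (r + 1)" using assms(3) by simp
    show "\<forall>s\<in>?R. \<exists>y\<in>{q<..r}. y = s \<and> \<bar>L s - L' s\<bar> \<le> 2 ^ (r - y) * L (r + 1)"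
      using sub step by (auto intro!: step(2))
  qed (use fin in auto)
  also have "\<dots> = (2 ^ (r - q) - 1) * L (r + 1)"
    using geo[of q r] step(1) by (simp add: sum_distrib_right[symmetric])
  finally show ?case by (simp add: algebra_simps)
qed

text \<open>The orders of magnitude \<open>c q\<close> decrease by a factor of at least \<open>2 n + 1\<close> at each step. By a geometric
  series, edges of length at most \<open>(n - 1) c s\<close>, one for each \<open>s > q\<close>, are together shorter than \<open>c q / 2\<close>.\<close>

locale scales =
  fixes n B N r :: nat and c :: "nat \<Rightarrow> real"
  assumes n: "n \<ge> 1" and B: "B \<ge> 2 * n + 1" and rN: "r \<le> N" and c_def: "c = (\<lambda>q. real B ^ (N - q))"
begin

lemma c_pos: "c q > 0"
  using B by (simp add: c_def)

lemma c_Suc: "q < r \<Longrightarrow> c q = real B * c (Suc q)"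
proof -
  assume "q < r"
  then have "N - q = Suc (N - Suc q)" using rN by simp
  then show ?thesis by (simp add: c_def)
qed

lemma c_gap: assumes "s < q" "q \<le> r" shows "c s \<ge> real B * c q"
proof -
  have "real B * c q = real B ^ Suc (N - q)" by (simp add: c_def)
  also have "\<dots> \<le> real B ^ (N - s)" using assms rN B by (intro power_increasing) auto
  finally show ?thesis by (simp add: c_def)
qed

lemma c_gap': assumes "s < q" "q \<le> r" shows "c s / 2 > real n * c q"
proof -
  have "(2 * real n + 1) * c q \<le> real B * c q" using B c_pos[of q] by (intro mult_right_mono) auto
  then show ?thesis using c_gap[OF assms] c_pos[of q] by (simp add: algebra_simps)
qed

lemma scale_tail: assumes "q \<le> r" shows "(\<Sum>s\<in>{q<..r}. (real n - 1) * c s) < c q / 2"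
proof -
  have *: "p \<le> r \<Longrightarrow> q \<le> p \<Longrightarrow> (real B - 1) * (\<Sum>s\<in>{q<..p}. c s) \<le> c q - c p" for p
  proof (induction p)
    case (Suc p)
    show ?case
    proof (cases "q = Suc p")
      case False
      then have "{q<..Suc p} = insert (Suc p) {q<..p}" using Suc.prems by auto
      moreover have "c p = real B * c (Suc p)" using c_Suc Suc.prems by simp
      ultimately show ?thesis using Suc False by (simp add: algebra_simps)
    qed simp
  qed simp
  have nn: "(\<Sum>s\<in>{q<..r}. c s) \<ge> 0" using c_pos by (intro sum_nonneg) (auto intro: less_imp_le)
  have "(\<Sum>s\<in>{q<..r}. (real n - 1) * c s) = (real n - 1) * (\<Sum>s\<in>{q<..r}. c s)"
    by (simp add: sum_distrib_left)
  also have "2 * \<dots> \<le> (real B - 1) * (\<Sum>s\<in>{q<..r}. c s)"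
    using B nn by (auto simp flip: mult.assoc intro!: mult_right_mono)
  also have "\<dots> < c q" using *[of r] assms c_pos[of r] by simp
  finally show ?thesis by simp
qed

text \<open>Assign to each edge the last index \<open>q\<close> with \<open>P q\<close> containing it. The edges of \<open>P q\<close> assigned to later
  indices lie in the later sets and are together too short to make up \<open>P q\<close>. So every index is assigned
  to some edge, and as there are at most \<open>r\<close> edges, to exactly one.\<close>

lemma one_edge_per_scale:
  fixes L :: "'e \<Rightarrow> real"
  assumes E: "finite E" "card E \<le> r" and L: "\<And>e. e \<in> E \<Longrightarrow> L e > 0"
    and P: "\<And>q. q \<in> {1..r} \<Longrightarrow> P q \<subseteq> E"
    and bd: "\<And>q. q \<in> {1..r} \<Longrightarrow> c q \<le> sum L (P q) \<and> sum L (P q) \<le> (real n - 1) * c q"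
  shows "\<exists>e. bij_betw e {1..r} E \<and> (\<forall>q\<in>{1..r}. e q \<in> P q \<and> (\<forall>s\<in>{1..r}. e s \<in> P q \<longrightarrow> s \<ge> q))"
proof -
  define good where "good q e' \<longleftrightarrow> e' \<in> P q \<and> (\<forall>s\<in>{q<..r}. e' \<notin> P s)" for q e'
  have ex: "\<exists>e'. good q e'" if q: "q \<in> {1..r}" for q
  proof (rule ccontr)
    assume none: "\<nexists>e'. good q e'"
    have fin: "finite (P s)" if "s \<in> {1..r}" for s using P[OF that] E(1) finite_subset by blast
    have "sum L (P q) \<le> (\<Sum>e'\<in>P q. \<Sum>s\<in>{q<..r}. if e' \<in> P s then L e' else 0)"
    proof (rule sum_mono)
      fix e' assume e': "e' \<in> P q"
      then obtain s where s: "s \<in> {q<..r}" "e' \<in> P s" using none good_def by blast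
      have "L e' > 0" using L P[OF q] e' by blast
      then have "(if e' \<in> P s then L e' else 0) \<le> (\<Sum>s\<in>{q<..r}. if e' \<in> P s then L e' else 0)"
        using s(1) by (intro member_le_sum) auto
      then show "L e' \<le> (\<Sum>s\<in>{q<..r}. if e' \<in> P s then L e' else 0)" using s(2) by simp
    qed
    also have "\<dots> = (\<Sum>s\<in>{q<..r}. \<Sum>e'\<in>P q. if e' \<in> P s then L e' else 0)" by (rule sum.swap)
    also have "\<dots> \<le> (\<Sum>s\<in>{q<..r}. (real n - 1) * c s)"
    proof (rule sum_mono)
      fix s assume "s \<in> {q<..r}"
      then have s: "s \<in> {1..r}" using q by auto
      have "(\<Sum>e'\<in>P q. if e' \<in> P s then L e' else 0) = sum L (P q \<inter> P s)"
        using fin[OF q] by (simp add: sum.If_cases Int_def)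
      also have "\<dots> \<le> sum L (P s)"
        using fin[OF s] L P[OF s] by (intro sum_mono2) (auto intro: less_imp_le)
      finally show "(\<Sum>e'\<in>P q. if e' \<in> P s then L e' else 0) \<le> (real n - 1) * c s"
        using bd[OF s] by linarith
    qed
    also have "\<dots> < c q / 2" using scale_tail q by simp
    finally show False using bd[OF q] c_pos[of q] by linarith
  qed
  then obtain e where e: "\<And>q. q \<in> {1..r} \<Longrightarrow> good q (e q)" by metis
  have uniq: "s = q" if "good s x" "good q x" "s \<in> {1..r}" "q \<in> {1..r}" for s q x
  proof (rule ccontr)
    assume "s \<noteq> q"
    then consider "s < q" | "q < s" by linarith
    then show False using that by cases (auto simp: good_def)
  qed
  have inj: "inj_on e {1..r}" using e uniq by (metis inj_onI)
  have "e ` {1..r} \<subseteq> E" using e P unfolding good_def by blast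
  moreover have "card (e ` {1..r}) = r" using inj by (simp add: card_image)
  ultimately have im: "e ` {1..r} = E" using E by (metis card_seteq)
  have 1: "\<forall>q\<in>{1..r}. e q \<in> P q \<and> (\<forall>s\<in>{1..r}. e s \<in> P q \<longrightarrow> s \<ge> q)"
  proof
    fix q assume q: "q \<in> {1..r}"
    have "s \<ge> q" if s: "s \<in> {1..r}" "e s \<in> P q" for s
    proof (rule ccontr)
      assume "\<not> s \<ge> q"
      then have "e s \<notin> P q" using e[OF s(1)] q unfolding good_def by auto
      then show False using s(2) by simp
    qed
    then show "e q \<in> P q \<and> (\<forall>s\<in>{1..r}. e s \<in> P q \<longrightarrow> s \<ge> q)"
      using e[OF q] unfolding good_def by blast
  qed
  have "bij_betw e {1..r} E" using inj im by (simp add: bij_betw_def)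
  then show ?thesis using 1 by blast
qed

lemma triangular_sizes:
  assumes tri: "triangular P r"
    and bd: "\<And>q. q \<in> {1..r} \<Longrightarrow> c q \<le> sum L (P q) \<and> sum L (P q) \<le> (real n - 1) * c q"
    and "q \<in> {1..r}"
  shows "c q / 2 \<le> L q \<and> L q \<le> (real n - 1) * c q"
  using assms(3)
proof (induction rule: downward_induct)
  case (step q)
  have L: "0 \<le> L s \<and> L s \<le> (real n - 1) * c s" if "s \<in> {q<..r}" for s
  proof -
    have "s \<in> {1..r}" "q < s" using that step(1) by auto
    from step(2)[OF this] c_pos[of s] show ?thesis by linarith
  qed
  have "sum L (P q - {q}) \<le> (\<Sum>s\<in>{q<..r}. (real n - 1) * c s)"
  proof (rule sum_le_included[where i = "\<lambda>x. x"])
    show "\<forall>s\<in>{q<..r}. 0 \<le> (real n - 1) * c s" using n c_pos by (intro ballI mult_nonneg_nonneg less_imp_le[OF c_pos]) simp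
    show "\<forall>s\<in>P q - {q}. \<exists>y\<in>{q<..r}. y = s \<and> L s \<le> (real n - 1) * c y"
      using triangular_sum(2)[OF tri step(1)] L by auto
  qed (use triangular_sum(3)[OF tri step(1)] in auto)
  then have "sum L (P q - {q}) < c q / 2" using scale_tail[of q] step(1) by simp
  moreover have "sum L (P q - {q}) \<ge> 0"
    using triangular_sum(2)[OF tri step(1)] L by (intro sum_nonneg) auto
  ultimately show ?case using bd[OF step(1)] triangular_sum(1)[OF tri step(1), of L] by auto
qed

end

section \<open>Admissible sequences of splits\<close>

definition quartet :: "('s \<Rightarrow> nat \<Rightarrow> bool) \<Rightarrow> 's \<Rightarrow> nat \<Rightarrow> nat \<Rightarrow> nat \<Rightarrow> nat \<Rightarrow> bool" where
  "quartet Y s a b c d \<longleftrightarrow> Y s a = Y s b \<and> Y s c = Y s d \<and> Y s a \<noteq> Y s c"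

definition compatible :: "('s \<Rightarrow> nat \<Rightarrow> bool) \<Rightarrow> 's set \<Rightarrow> nat set \<Rightarrow> bool" where
  "compatible Y I A \<longleftrightarrow> (\<forall>s\<in>I. \<forall>t\<in>I. s \<noteq> t \<longrightarrow> (\<forall>a\<in>A. \<forall>b\<in>A. \<forall>c\<in>A. \<forall>d\<in>A.
     Y s a = Y s b \<longrightarrow> Y s c = Y s d \<longrightarrow> Y t a \<noteq> Y t b \<longrightarrow> Y t c \<noteq> Y t d \<longrightarrow> Y s a = Y s c))"

text \<open>The distance from \<open>i\<close> to the projection of \<open>\<alpha>\<close> to the path from \<open>i\<close> to \<open>j\<close>.\<close>

definition split_dist :: "('s \<Rightarrow> nat \<Rightarrow> bool) \<Rightarrow> ('s \<Rightarrow> real) \<Rightarrow> 's set \<Rightarrow> nat \<Rightarrow> nat \<Rightarrow> nat \<Rightarrow> real" where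
  "split_dist Y L I i j \<alpha> = (\<Sum>s | s \<in> I \<and> Y s i \<noteq> Y s j \<and> Y s i \<noteq> Y s \<alpha>. L s)"

text \<open>The splits with index less than \<open>q\<close> are those by edges much longer than \<open>B^(n-3-q)\<close>. No leg \<open>\<alpha>\<close> may be projected
  to the path from \<open>i\<close> to \<open>j\<close> before \<open>k\<close> by such an edge. Among the legs not projected behind \<open>k\<close> by such an
  edge, \<open>k\<close> is the least one, except for those which the split \<open>q\<close> projects before \<open>k\<close>, and of these \<open>l\<close> is the
  least one. Taking \<open>\<alpha> = l\<close> shows that \<open>q\<close> is the first split between the projections of \<open>k\<close> and \<open>l\<close>.\<close>

definition admissible ::
    "(nat \<Rightarrow> nat \<Rightarrow> bool) \<Rightarrow> nat set \<Rightarrow> nat \<Rightarrow> nat \<Rightarrow> nat \<Rightarrow> nat \<Rightarrow> nat \<Rightarrow> bool" where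
  "admissible Y A i j q k l \<longleftrightarrow> k \<in> A - {i, j} \<and> l \<in> A - {i, j} \<and> k < l \<and> quartet Y q i l j k \<and>
     (\<forall>\<alpha>\<in>A - {i, j}. (\<forall>s\<in>{1..<q}. \<not> quartet Y s i \<alpha> j k) \<and>
        ((\<forall>s\<in>{1..<q}. \<not> quartet Y s i k j \<alpha>) \<longrightarrow>
           (if quartet Y q i \<alpha> j k then l \<le> \<alpha> else k \<le> \<alpha>)))"

lemma compatibleD:
  "\<lbrakk>compatible Y I A; s \<in> I; t \<in> I; s \<noteq> t; a \<in> A; b \<in> A; c \<in> A; d \<in> A; Y s a = Y s b; Y s c = Y s d;
    Y t a \<noteq> Y t b; Y t c \<noteq> Y t d\<rbrakk> \<Longrightarrow> Y s a = Y s c"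
  unfolding compatible_def by blast

lemma quartet_reindex: "quartet (\<lambda>s. Y (e s)) s = quartet Y (e s)"
  by (simp add: quartet_def fun_eq_iff)

lemma admissible_cong:
  assumes Y: "\<And>s a. s \<in> {1..q} \<Longrightarrow> a \<in> A \<Longrightarrow> Y s a = Y' s a" and "q \<ge> 1" "i \<in> A" "j \<in> A"
  shows "admissible Y A i j q k l = admissible Y' A i j q k l"
proof -
  have quart: "quartet Y s a b c d = quartet Y' s a b c d"
    if "s \<in> {1..q}" "{a, b, c, d} \<subseteq> A" for s a b c d
    using that Y unfolding quartet_def by simp
  have 1: "quartet Y s i \<alpha> j k = quartet Y' s i \<alpha> j k" "quartet Y s i k j \<alpha> = quartet Y' s i k j \<alpha>"
    if "s = q \<or> s \<in> {1..<q}" "\<alpha> \<in> A" "k \<in> A" for s \<alpha> k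
    by (intro quart; use that assms(2-4) in auto)+
  show ?thesis
  proof (cases "k \<in> A \<and> l \<in> A")
    case True
    then show ?thesis unfolding admissible_def
      by (intro conj_cong ball_cong imp_cong refl) (use 1 in auto)
  qed (auto simp: admissible_def)
qed

lemma split_dist_diff:
  assumes "finite I"
  shows "split_dist Y L I i j k - split_dist Y L I i j l =
    (\<Sum>s | s \<in> I \<and> quartet Y s i l j k. L s) - (\<Sum>s | s \<in> I \<and> quartet Y s i k j l. L s)"
proof -
  let ?C = "{s \<in> I. Y s i \<noteq> Y s j \<and> Y s i \<noteq> Y s k \<and> Y s i \<noteq> Y s l}"
  have "split_dist Y L I i j a = sum L ?C + (\<Sum>s | s \<in> I \<and> quartet Y s i b j a. L s)"
    if "a = k \<and> b = l \<or> a = l \<and> b = k" for a b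
    unfolding split_dist_def using assms that
    by (subst sum.union_disjoint[symmetric]) (auto simp: quartet_def intro!: sum.cong)
  from this[of k l] this[of l k] show ?thesis by simp
qed

lemma quartet_opposed:
  assumes "compatible Y I A" "{i, j, k, l} \<subseteq> A" "s \<in> I" "t \<in> I" "quartet Y s i l j k"
  shows "\<not> quartet Y t i k j l"
proof
  assume t: "quartet Y t i k j l"
  then have "s \<noteq> t" "Y t i \<noteq> Y t l" "Y t j \<noteq> Y t k" using assms(5) by (auto simp: quartet_def)
  moreover have "Y s i = Y s l" "Y s j = Y s k" "Y s i \<noteq> Y s j" using assms(5) by (auto simp: quartet_def)
  ultimately show False using compatibleD[OF assms(1,3,4), of i l j k] assms(2) by auto
qed

text \<open>Compatibility does not allow the path from \<open>i\<close> to \<open>j\<close> to meet the projections of \<open>k\<close> and \<open>l\<close> in both orders,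
  so one of the two sums in \<open>split_dist_diff\<close> is empty.\<close>

lemma balanced_iff:
  assumes I: "finite I" and cmp: "compatible Y I A" "{i, j, k, l} \<subseteq> A" and ex: "\<exists>s\<in>I. quartet Y s i l j k"
  shows "split_dist Y L I i j k + real k * \<gamma> = split_dist Y L I i j l + real l * \<gamma> \<longleftrightarrow>
         (\<Sum>s | s \<in> I \<and> quartet Y s i l j k. L s) = (real l - real k) * \<gamma>"
proof -
  have none: "{s \<in> I. quartet Y s i k j l} = {}"
    using ex quartet_opposed[OF cmp] by blast
  show ?thesis
    using split_dist_diff[OF I, of Y L i j k l] unfolding none
    by (auto simp: algebra_simps)
qed

lemma balanced_imp_split:
  assumes I: "finite I" and L: "\<And>s. s \<in> I \<Longrightarrow> L s > 0" and "k < l" "\<gamma> > 0"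
    and eq: "split_dist Y L I i j k + real k * \<gamma> = split_dist Y L I i j l + real l * \<gamma>"
  shows "\<exists>s\<in>I. quartet Y s i l j k"
proof (rule ccontr)
  assume "\<not> ?thesis"
  then have none: "{s \<in> I. quartet Y s i l j k} = {}" by blast
  have "(\<Sum>s | s \<in> I \<and> quartet Y s i k j l. L s) \<ge> 0" using L by (intro sum_nonneg) (auto intro: less_imp_le)
  then have "split_dist Y L I i j k \<le> split_dist Y L I i j l"
    using split_dist_diff[OF I, of Y L i j k l] unfolding none by simp
  moreover have "real k * \<gamma> < real l * \<gamma>" using assms(3,4) by simp
  ultimately show False using eq by linarith
qed

lemma sum_filter_bij:
  "bij_betw e I E \<Longrightarrow> (\<Sum>s | s \<in> I \<and> R (e s). (L (e s) :: real)) = (\<Sum>x | x \<in> E \<and> R x. L x)"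
proof -
  assume e: "bij_betw e I E"
  have "bij_betw e {s \<in> I. R (e s)} {x \<in> E. R x}"
    using e by (auto simp: bij_betw_def inj_on_def)
  then show ?thesis by (rule sum.reindex_bij_betw)
qed

context scales
begin

text \<open>One split of an earlier index outweighs any difference of the indices \<open>\<alpha> \<le> n\<close>.\<close>

lemma earlier_split_dominates:
  assumes cmp: "compatible Y {1..r} {1..n}" and ij: "i \<in> {1..n}" "j \<in> {1..n}"
    and ab: "a \<in> {1..n}" "b \<in> {1..n}"
    and L: "\<And>s. s \<in> {1..r} \<Longrightarrow> c s / 2 \<le> L s" and q: "q \<in> {1..r}"
    and s: "s \<in> {1..<q}" "quartet Y s i a j b"
  shows "split_dist Y L {1..r} i j a + real a * c q < split_dist Y L {1..r} i j b + real b * c q"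
proof -
  have sr: "s \<in> {1..r}" using s q by auto
  have none: "{t \<in> {1..r}. quartet Y t i b j a} = {}"
    using quartet_opposed[OF cmp _ sr _ s(2)] ij ab by auto
  have Lp: "L t > 0" if "t \<in> {1..r}" for t using L[OF that] c_pos[of t] by linarith
  have "L s \<le> (\<Sum>t | t \<in> {1..r} \<and> quartet Y t i a j b. L t)"
    using s(2) sr Lp by (intro member_le_sum) (auto intro: less_imp_le)
  moreover have "real n * c q < L s" using c_gap'[of s q] L[OF sr] s(1) q by auto
  ultimately have "split_dist Y L {1..r} i j b - split_dist Y L {1..r} i j a > real n * c q"
    using split_dist_diff[of "{1..r}" Y L i j b a] unfolding none by simp
  moreover have "real a * c q \<le> real n * c q" "0 \<le> real b * c q"
    using ab c_pos[of q] by (auto intro!: mult_right_mono)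
  ultimately show ?thesis by linarith
qed

text \<open>All splits of later indices together are outweighed by a difference of one.\<close>

lemma later_splits_negligible:
  assumes L: "\<And>s. s \<in> {1..r} \<Longrightarrow> 0 \<le> L s \<and> L s \<le> (real n - 1) * c s" and q: "q \<in> {1..r}"
    and late: "\<And>s. s \<in> {1..q} \<Longrightarrow> \<not> quartet Y s i b j a" and ab: "a < b"
  shows "split_dist Y L {1..r} i j a + real a * c q < split_dist Y L {1..r} i j b + real b * c q"
proof -
  have "(\<Sum>s | s \<in> {1..r} \<and> quartet Y s i b j a. L s) \<le> (\<Sum>s\<in>{q<..r}. (real n - 1) * c s)"
  proof (rule sum_le_included[where i = "\<lambda>x. x"])
    show "\<forall>s\<in>{q<..r}. 0 \<le> (real n - 1) * c s" using n c_pos by (intro ballI mult_nonneg_nonneg less_imp_le[OF c_pos]) simp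
    show "\<forall>s\<in>{s. s \<in> {1..r} \<and> quartet Y s i b j a}. \<exists>y\<in>{q<..r}. y = s \<and> L s \<le> (real n - 1) * c y"
    proof
      fix s assume s: "s \<in> {s. s \<in> {1..r} \<and> quartet Y s i b j a}"
      then have "s \<in> {q<..r}" using late[of s] by (force simp: not_le[symmetric])
      then show "\<exists>y\<in>{q<..r}. y = s \<and> L s \<le> (real n - 1) * c y" using L s by blast
    qed
  qed auto
  then have 1: "(\<Sum>s | s \<in> {1..r} \<and> quartet Y s i b j a. L s) < c q / 2" using scale_tail[of q] q by simp
  have 2: "(\<Sum>s | s \<in> {1..r} \<and> quartet Y s i a j b. L s) \<ge> 0" using L by (intro sum_nonneg) auto
  have "1 * c q \<le> (real b - real a) * c q" using ab c_pos[of q] by (intro mult_right_mono) auto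
  then show ?thesis using split_dist_diff[of "{1..r}" Y L i j b a] 1 2 c_pos[of q]
    by (simp add: algebra_simps)
qed

context
  fixes Y :: "nat \<Rightarrow> nat \<Rightarrow> bool" and L :: "nat \<Rightarrow> real" and A :: "nat set" and i j q k l :: nat
  assumes cmp: "compatible Y {1..r} {1..n}" and A: "A \<subseteq> {1..n}" "i \<in> A" "j \<in> A"
    and L: "\<And>s. s \<in> {1..r} \<Longrightarrow> c s / 2 \<le> L s \<and> L s \<le> (real n - 1) * c s" and q: "q \<in> {1..r}"
    and kl: "k \<in> A - {i, j}" "l \<in> A - {i, j}" "k < l" and lk: "quartet Y q i l j k"
    and first: "\<And>s. s \<in> {1..<q} \<Longrightarrow> \<not> quartet Y s i l j k"
    and eq: "split_dist Y L {1..r} i j k + real k * c q = split_dist Y L {1..r} i j l + real l * c q"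
begin

private abbreviation val :: "nat \<Rightarrow> real" where
  "val \<alpha> \<equiv> split_dist Y L {1..r} i j \<alpha> + real \<alpha> * c q"

private lemma early: "a \<in> A \<Longrightarrow> b \<in> A \<Longrightarrow> s \<in> {1..<q} \<Longrightarrow> quartet Y s i a j b \<Longrightarrow> val a < val b"
  using A L q by (intro earlier_split_dominates[OF cmp]) auto

private lemma late: "(\<And>s. s \<in> {1..q} \<Longrightarrow> \<not> quartet Y s i b j a) \<Longrightarrow> a < b \<Longrightarrow> val a < val b"
proof (rule later_splits_negligible[OF _ q])
  fix s assume "s \<in> {1..r}"
  then show "0 \<le> L s \<and> L s \<le> (real n - 1) * c s" using L[of s] c_pos[of s] by linarith
qed

private lemma compat: "\<lbrakk>s \<in> {1..r}; t \<in> {1..r}; s \<noteq> t; a \<in> A; b \<in> A; c' \<in> A; d \<in> A; Y s a = Y s b; Y s c' = Y s d;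
    Y t a \<noteq> Y t b; Y t c' \<noteq> Y t d\<rbrakk> \<Longrightarrow> Y s a = Y s c'"
  using compatibleD[OF cmp] A(1) by blast

text \<open>If \<open>\<alpha>\<close> and \<open>l\<close> both are projected before \<open>k\<close> by the split \<open>q\<close>, then only later splits lie between their
  projections: an earlier one would also lie between \<open>k\<close> and one of them, or be incompatible with \<open>q\<close>.\<close>

private lemma no_later: 
  assumes \<alpha>: "\<alpha> \<in> A - {i, j}" and far: "\<And>s. s \<in> {1..<q} \<Longrightarrow> \<not> quartet Y s i \<alpha> j k"
    and near: "quartet Y q i \<alpha> j k" and s: "s \<in> {1..q}"
  shows "\<not> quartet Y s i \<alpha> j l" "(\<forall>s\<in>{1..<q}. \<not> quartet Y s i k j \<alpha>) \<Longrightarrow> \<not> quartet Y s i l j \<alpha>"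
proof -
  have sr: "s \<in> {1..r}" using s q by auto
  have "s = q \<or> s \<in> {1..<q}" using s by auto
  then show "\<not> quartet Y s i \<alpha> j l"
  proof
    assume s': "s \<in> {1..<q}"
    show ?thesis
    proof
      assume l: "quartet Y s i \<alpha> j l"
      then have "Y s k = Y s i" using far[OF s'] by (auto simp: quartet_def)
      then show False using compat[of s q i k j l] sr q s' l lk A kl by (auto simp: quartet_def)
    qed
  qed (use lk near in \<open>auto simp: quartet_def\<close>)
  assume near': "\<forall>s\<in>{1..<q}. \<not> quartet Y s i k j \<alpha>"
  from \<open>s = q \<or> s \<in> {1..<q}\<close> show "\<not> quartet Y s i l j \<alpha>"
  proof
    assume s': "s \<in> {1..<q}"
    show ?thesis
    proof
      assume "quartet Y s i l j \<alpha>"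
      then show False using first[OF s'] near' s' by (auto simp: quartet_def)
    qed
  qed (use lk near in \<open>auto simp: quartet_def\<close>)
qed

text \<open>If a condition of \<open>admissible\<close> fails at \<open>\<alpha>\<close>, then the value at \<open>\<alpha>\<close> is smaller than that at \<open>k\<close>, or than
  the equal one at \<open>l\<close>: by an earlier split, or because only later splits lie in between and \<open>\<alpha>\<close> is
  the smaller index.\<close>

lemma minimal_imp_admissible:
  assumes min: "\<And>\<alpha>. \<alpha> \<in> A - {i, j} \<Longrightarrow> val k \<le> val \<alpha>"
  shows "admissible Y A i j q k l"
proof -
  have far: "\<not> quartet Y s i \<alpha> j k" if "\<alpha> \<in> A - {i, j}" "s \<in> {1..<q}" for s \<alpha>
    using early[of \<alpha> k s] min[of \<alpha>] that kl by fastforce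
  have "if quartet Y q i \<alpha> j k then l \<le> \<alpha> else k \<le> \<alpha>"
    if \<alpha>: "\<alpha> \<in> A - {i, j}" and near: "\<forall>s\<in>{1..<q}. \<not> quartet Y s i k j \<alpha>" for \<alpha>
  proof (cases "quartet Y q i \<alpha> j k")
    case True
    have "val \<alpha> < val l" if "\<alpha> < l"
      using late[OF no_later(2)[OF \<alpha> far[OF \<alpha>] True _ near]] that by blast
    then show ?thesis using True min[OF \<alpha>] eq by force
  next
    case False
    have "\<not> quartet Y s i k j \<alpha>" if "s \<in> {1..q}" for s
    proof (cases "s = q")
      case True
      then show ?thesis using lk by (auto simp: quartet_def)
    next
      case False
      then show ?thesis using near that by auto
    qed
    then have "val \<alpha> < val k" if "\<alpha> < k" using late that by blast
    then show ?thesis using False min[OF \<alpha>] by force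
  qed
  then show ?thesis unfolding admissible_def using kl lk far by blast
qed

text \<open>The comparison of \<open>\<alpha>\<close> is with \<open>l\<close> if the split \<open>q\<close> projects \<open>\<alpha>\<close> before \<open>k\<close>, and with \<open>k\<close> otherwise, so that no
  edge of length about \<open>c q\<close> is left in between.\<close>

lemma admissible_imp_minimal:
  assumes adm: "admissible Y A i j q k l" and \<alpha>: "\<alpha> \<in> A - {i, j}" "\<alpha> \<noteq> k" "\<alpha> \<noteq> l"
  shows "val k < val \<alpha>"
proof -
  have far: "\<And>s. s \<in> {1..<q} \<Longrightarrow> \<not> quartet Y s i \<alpha> j k"
    and ord: "(\<forall>s\<in>{1..<q}. \<not> quartet Y s i k j \<alpha>) \<Longrightarrow> if quartet Y q i \<alpha> j k then l \<le> \<alpha> else k \<le> \<alpha>"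
    using adm \<alpha>(1) unfolding admissible_def by blast+
  show ?thesis
  proof (cases "\<exists>s\<in>{1..<q}. quartet Y s i k j \<alpha>")
    case True
    then show ?thesis using early[of k \<alpha>] kl \<alpha> by blast
  next
    case near: False
    show ?thesis
    proof (cases "quartet Y q i \<alpha> j k")
      case True
      then have "l < \<alpha>" using ord near \<alpha> by auto
      then show ?thesis using late[OF no_later(1)[OF \<alpha>(1) far True]] eq by simp
    next
      case False
      then have "k < \<alpha>" using ord near \<alpha> by auto
      moreover have "\<not> quartet Y s i \<alpha> j k" if "s \<in> {1..q}" for s
        using far[of s] False that by (cases "s = q") auto
      ultimately show ?thesis using late by blast
    qed
  qed
qed

end

end

lemma compatible_reindex:
  assumes e: "inj_on e I" "e ` I \<subseteq> E" and cmp: "compatible Y E A"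
  shows "compatible (\<lambda>s. Y (e s)) I A"
  unfolding compatible_def
proof (intro ballI impI)
  fix s t a b c d
  assume st: "s \<in> I" "t \<in> I" "s \<noteq> t"
    and *: "a \<in> A" "b \<in> A" "c \<in> A" "d \<in> A" "Y (e s) a = Y (e s) b" "Y (e s) c = Y (e s) d"
      "Y (e t) a \<noteq> Y (e t) b" "Y (e t) c \<noteq> Y (e t) d"
  have "e s \<in> E" "e t \<in> E" using e(2) st by blast+
  moreover have "e s \<noteq> e t" using inj_onD[OF e(1) _ st(1,2)] st(3) by blast
  ultimately show "Y (e s) a = Y (e s) c" by (rule compatibleD[OF cmp]) (use * in blast)+
qed

lemma admissible_pair_unique:
  assumes cmp: "compatible Y {1..r} F" and A: "A \<subseteq> F" "i \<in> A" "j \<in> A" and q: "q \<in> {1..r}"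
    and a: "admissible Y A i j q k l" and a': "admissible Y A i j q k' l'"
  shows "k = k' \<and> l = l'"
proof -
  have ord: "if quartet Y q i \<alpha> j k then l \<le> \<alpha> else k \<le> \<alpha>"
    if "admissible Y A i j q k l" "\<alpha> \<in> A - {i, j}" "\<And>s. s \<in> {1..<q} \<Longrightarrow> \<not> quartet Y s i k j \<alpha>" for k l \<alpha>
    using that unfolding admissible_def by blast
  have le: "k \<le> k'" if k: "admissible Y A i j q k l" and k': "admissible Y A i j q k' l'" for k l k' l'
  proof -
    have kA: "k \<in> A - {i, j}" "k' \<in> A - {i, j}" using k k' unfolding admissible_def by blast+
    then have "\<not> quartet Y s i k j k'" if "s \<in> {1..<q}" for s
      using k' that unfolding admissible_def by blast
    moreover have "quartet Y q i l' j k'" using k' unfolding admissible_def by blast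
    then have "\<not> quartet Y q i k' j k" by (auto simp: quartet_def)
    ultimately show ?thesis using ord[OF k kA(2)] by simp
  qed
  have kk: "k = k'" using le[OF a a'] le[OF a' a] by simp
  have le': "l \<le> l'" if l: "admissible Y A i j q k l" and l': "admissible Y A i j q k l'" for l l'
  proof -
    have lA: "k \<in> A - {i, j}" "l' \<in> A - {i, j}" "quartet Y q i l' j k"
      using l' unfolding admissible_def by blast+
    have "\<not> quartet Y s i k j l'" if "s \<in> {1..<q}" for s
      using quartet_opposed[OF cmp _ q _ lA(3), of s] A lA(1,2) that q by auto
    then show ?thesis using ord[OF l lA(2)] lA(3) by simp
  qed
  show ?thesis using kk le'[of l l'] le'[of l' l] a a' by simp
qed

text \<open>Suppose that two numberings agree above \<open>q\<close>, but choose different splits \<open>g\<close> and \<open>f\<close> as number \<open>q\<close>. Each of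
  them has a smaller number in the other numbering, where it must not separate \<open>i\<close> and some leg from \<open>j\<close> and
  \<open>k\<close>. Hence \<open>f\<close> has the \<open>k\<close> of the first numbering on the side of \<open>i\<close>, and \<open>g\<close> that of the second, so that
  \<open>i\<close>, \<open>j\<close> and the two choices of \<open>k\<close> occupy all four quadrants of \<open>f\<close> and \<open>g\<close>.\<close>

lemma admissible_numbering_unique:
  fixes Y :: "'e \<Rightarrow> nat \<Rightarrow> bool"
  assumes bij: "bij_betw e {1..r} E" "bij_betw e' {1..r} E" and cmp: "compatible Y E F"
    and A: "\<And>q. q \<in> {1..r} \<Longrightarrow> A q \<subseteq> F \<and> i q \<in> A q \<and> j q \<in> A q"
    and adm: "\<And>q. q \<in> {1..r} \<Longrightarrow> admissible (\<lambda>s. Y (e s)) (A q) (i q) (j q) q (k q) (l q)"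
    and adm': "\<And>q. q \<in> {1..r} \<Longrightarrow> admissible (\<lambda>s. Y (e' s)) (A q) (i q) (j q) q (k' q) (l' q)"
  shows "\<forall>q\<in>{1..r}. e q = e' q \<and> k q = k' q \<and> l q = l' q"
proof -
  have ee: "e q = e' q" if "q \<in> {1..r}" for q
    using that
  proof (induction rule: downward_induct)
    case (step q)
    have down: "\<exists>s\<in>{1..<q}. f q = g s"
      if f: "bij_betw f {1..r} E" and g: "bij_betw g {1..r} E" and ne: "f q \<noteq> g q"
        and above: "\<And>s. s \<in> {1..r} \<Longrightarrow> q < s \<Longrightarrow> f s = g s" for f g :: "nat \<Rightarrow> 'e"
    proof -
      have "f q \<in> E" using f step(1) by (auto simp: bij_betw_def)
      then obtain s where s: "s \<in> {1..r}" "f q = g s" using g unfolding bij_betw_def by blast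
      have "\<not> q < s"
      proof
        assume "q < s"
        then have "f q = f s" using s above by simp
        then have "q = s" using f step(1) s(1) by (meson bij_betw_imp_inj_on inj_onD)
        then show False using \<open>q < s\<close> by simp
      qed
      moreover have "s \<noteq> q" using ne s by blast
      ultimately show ?thesis using s by auto
    qed
    show ?case
    proof (rule ccontr)
      assume ne: "e q \<noteq> e' q"
      obtain s where s: "s \<in> {1..<q}" "e' q = e s" using down[OF bij(2,1)] ne step(2) by metis
      obtain s' where s': "s' \<in> {1..<q}" "e q = e' s'" using down[OF bij ne] step(2) by metis
      let ?g = "e q" and ?f = "e' q" and ?i = "i q" and ?j = "j q" and ?k = "k q" and ?k' = "k' q"
      note a = adm[OF step(1), unfolded admissible_def quartet_reindex]
        and a' = adm'[OF step(1), unfolded admissible_def quartet_reindex]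
      have mem: "{?i, ?j, ?k, ?k', l q, l' q} \<subseteq> F" using A[OF step(1)] a a' by blast
      have gf: "?g \<in> E" "?f \<in> E" using bij step(1) by (auto simp: bij_betw_def)
      have "quartet Y ?g ?i (l q) ?j ?k" "quartet Y ?f ?i (l' q) ?j ?k'"
        using a a' by blast+
      moreover have "\<not> quartet Y ?f ?i (l' q) ?j ?k" "\<not> quartet Y ?g ?i (l q) ?j ?k'"
        using a a' s s' by simp_all
      ultimately have "Y ?f ?i = Y ?f ?k" "Y ?f ?j = Y ?f ?k'" "Y ?f ?i \<noteq> Y ?f ?j"
        "Y ?g ?i \<noteq> Y ?g ?k" "Y ?g ?j \<noteq> Y ?g ?k'"
        unfolding quartet_def by blast+
      then show False using compatibleD[OF cmp gf(2,1) ne[symmetric], of ?i ?k ?j ?k'] mem by blast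
    qed
  qed
  have "k q = k' q \<and> l q = l' q" if q: "q \<in> {1..r}" for q
  proof -
    have same: "e' s = e s" if "s \<in> {1..q}" for s using ee[of s] that q by auto
    have "admissible (\<lambda>s. Y (e s)) (A q) (i q) (j q) q (k' q) (l' q)"
      using adm'[OF q] admissible_cong[of q "A q" "\<lambda>s. Y (e' s)" "\<lambda>s. Y (e s)"] same q A[OF q] by simp
    moreover have "compatible (\<lambda>s. Y (e s)) {1..r} F"
      using bij(1) by (intro compatible_reindex[OF _ _ cmp]) (auto simp: bij_betw_def)
    ultimately show ?thesis using admissible_pair_unique[OF _ _ _ _ q adm[OF q]] A[OF q] by blast
  qed
  then show ?thesis using ee by blast
qed

section \<open>Trees satisfying the tropical conditions\<close>

text \<open>By \<open>FW_iff\<close> below, this describes the points of \<open>FW\<close>: \<open>e\<close> numbers the edges by decreasing order of magnitude,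
  and \<open>k q\<close>, \<open>l q\<close> are the minimizing indices.\<close>

definition trop_data ::
    "nat \<Rightarrow> nat \<Rightarrow> (nat \<Rightarrow> nat set) \<Rightarrow> (nat \<Rightarrow> nat) \<Rightarrow> (nat \<Rightarrow> nat) \<Rightarrow> nat \<Rightarrow> mtree \<Rightarrow>
     (nat \<Rightarrow> nat set) \<Rightarrow> (nat \<Rightarrow> nat) \<Rightarrow> (nat \<Rightarrow> nat) \<Rightarrow> bool" where
  "trop_data n B S i j r \<Gamma> e k l \<longleftrightarrow> bij_betw e {1..r} (edges \<Gamma>) \<and>
     (\<forall>q\<in>{1..r}. admissible (\<lambda>s. cut \<Gamma> (e s)) (S q) (i q) (j q) q (k q) (l q) \<and>
        (\<Sum>s | s \<in> {1..r} \<and> quartet (\<lambda>s. cut \<Gamma> (e s)) s (i q) (l q) (j q) (k q). len \<Gamma> (e s))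
          = (real (l q) - real (k q)) * real B ^ (n - 3 - q))"

text \<open>The split \<open>q\<close> is the first one between the projections of \<open>k q\<close> and \<open>l q\<close>.\<close>

lemma admissible_triangular:
  assumes "\<And>q. q \<in> {1..r} \<Longrightarrow> admissible Y (S q) (i q) (j q) q (k q) (l q)"
  shows "triangular (\<lambda>q. {s \<in> {1..r}. quartet Y s (i q) (l q) (j q) (k q)}) r"
  unfolding triangular_def
proof
  fix q assume q: "q \<in> {1..r}"
  note a = assms[OF q, unfolded admissible_def]
  have "s \<ge> q" if "s \<in> {1..r}" "quartet Y s (i q) (l q) (j q) (k q)" for s
  proof (rule ccontr)
    assume "\<not> s \<ge> q"
    then have "s \<in> {1..<q}" using that by auto
    then show False using a that(2) by blast
  qed
  then show "q \<in> {s \<in> {1..r}. quartet Y s (i q) (l q) (j q) (k q)} \<and>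
      {s \<in> {1..r}. quartet Y s (i q) (l q) (j q) (k q)} \<subseteq> {q..r}"
    using a q by auto
qed

lemma cut_family_compatible:
  assumes "stable_tree n T" "n \<ge> 1"
  shows "compatible (cut T) (edges T) {1..n}"
  unfolding compatible_def
proof (intro ballI impI)
  fix s t a b c d
  assume "s \<in> edges T" "t \<in> edges T" "s \<noteq> t" "a \<in> {1..n}" "b \<in> {1..n}" "c \<in> {1..n}" "d \<in> {1..n}"
    "cut T s a = cut T s b" "cut T s c = cut T s d" "cut T t a \<noteq> cut T t b" "cut T t c \<noteq> cut T t d"
  then show "cut T s a = cut T s c" by (rule cut_compatible[OF assms(1) _ _ _ assms(2)])
qed

lemma proj_dist_split:
  assumes \<Gamma>: "\<Gamma> \<in> M0n_trop n" and legs: "a \<in> {1..n}" "b \<in> {1..n}" "l \<in> {1..n}"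
  shows "proj_dist \<Gamma> a b l = split_dist (cut \<Gamma>) (len \<Gamma>) (edges \<Gamma>) a b l"
  unfolding proj_dist_eq[OF assms] split_dist_def
proof (intro sum.cong refl Collect_cong conj_cong)
  fix e assume e: "e \<in> edges \<Gamma>"
  have *: "separates (edges \<Gamma>) e (att \<Gamma> x) (att \<Gamma> y) \<longleftrightarrow> cut \<Gamma> e x \<noteq> cut \<Gamma> e y"
    if "x \<in> {1..n}" "y \<in> {1..n}" for x y
    using cut_neq_iff[of n \<Gamma> e x y] \<Gamma> e that by (auto simp: M0n_trop_def)
  show "separates (edges \<Gamma>) e (att \<Gamma> a) (att \<Gamma> b) \<longleftrightarrow> cut \<Gamma> e a \<noteq> cut \<Gamma> e b"
    "separates (edges \<Gamma>) e (att \<Gamma> a) (att \<Gamma> l) \<longleftrightarrow> cut \<Gamma> e a \<noteq> cut \<Gamma> e l"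
    using * legs by blast+
qed

locale hypersurfaces =
  fixes n B r :: nat and S :: "nat \<Rightarrow> nat set" and i j :: "nat \<Rightarrow> nat"
  assumes n3: "n \<ge> 3" and B_large: "B \<ge> 2 * n + 1" and r_le: "r \<le> n - 3"
    and S: "\<And>q. q \<in> {1..r} \<Longrightarrow>
           S q \<subseteq> {1..n} \<and> card (S q) \<ge> 3 \<and> i q \<in> S q \<and> j q \<in> S q \<and> i q \<noteq> j q"
begin

definition scale :: "nat \<Rightarrow> real" where
  "scale = (\<lambda>q. real B ^ (n - 3 - q))"

sublocale scales n B "n - 3" r scale
  using n3 B_large r_le by unfold_locales (simp_all add: scale_def)

definition trop_val :: "mtree \<Rightarrow> nat \<Rightarrow> nat \<Rightarrow> real" where
  "trop_val \<Gamma> q \<alpha> = proj_dist \<Gamma> (i q) (j q) \<alpha> + real \<alpha> * scale q"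

lemma S_legs: "q \<in> {1..r} \<Longrightarrow> S q \<subseteq> {1..n} \<and> i q \<in> S q \<and> j q \<in> S q"
  using S by blast

lemma trop_val_split:
  assumes "\<Gamma> \<in> M0n_trop n" "q \<in> {1..r}" "\<alpha> \<in> {1..n}"
  shows "trop_val \<Gamma> q \<alpha> = split_dist (cut \<Gamma>) (len \<Gamma>) (edges \<Gamma>) (i q) (j q) \<alpha> + real \<alpha> * scale q"
proof -
  have "i q \<in> {1..n}" "j q \<in> {1..n}" using S_legs[OF assms(2)] by blast+
  then show ?thesis unfolding trop_val_def using proj_dist_split[OF assms(1) _ _ assms(3)] by metis
qed

lemma trop_val_numbered:
  assumes \<Gamma>: "\<Gamma> \<in> M0n_trop n" "q \<in> {1..r}" "\<alpha> \<in> {1..n}" and e: "bij_betw e {1..r} (edges \<Gamma>)"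
  shows "trop_val \<Gamma> q \<alpha> = split_dist (\<lambda>s. cut \<Gamma> (e s)) (\<lambda>s. len \<Gamma> (e s)) {1..r} (i q) (j q) \<alpha> + real \<alpha> * scale q"
proof -
  let ?R = "\<lambda>x. cut \<Gamma> x (i q) \<noteq> cut \<Gamma> x (j q) \<and> cut \<Gamma> x (i q) \<noteq> cut \<Gamma> x \<alpha>"
  show ?thesis
    using trop_val_split[OF \<Gamma>] sum_filter_bij[OF e, where R = ?R and L = "len \<Gamma>"] by (simp only: split_dist_def)
qed

lemma numbered_compatible:
  assumes "\<Gamma> \<in> M0n_trop n" "bij_betw e {1..r} (edges \<Gamma>)"
  shows "compatible (\<lambda>s. cut \<Gamma> (e s)) {1..r} {1..n}"
  using assms n3 by (intro compatible_reindex[OF _ _ cut_family_compatible])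
    (auto simp: M0n_trop_def bij_betw_def)

lemma difference_bounds:
  assumes "k \<in> {1..n}" "l \<in> {1..n}" "k < l"
  shows "scale q \<le> (real l - real k) * scale q \<and> (real l - real k) * scale q \<le> (real n - 1) * scale q"
proof -
  have "1 * scale q \<le> (real l - real k) * scale q" "(real l - real k) * scale q \<le> (real n - 1) * scale q"
    using assms c_pos[of q] by (intro mult_right_mono; auto)+
  then show ?thesis by simp
qed

lemma trop_data_sizes:
  assumes d: "trop_data n B S i j r \<Gamma> e k l" and q: "q \<in> {1..r}"
  shows "scale q / 2 \<le> len \<Gamma> (e q) \<and> len \<Gamma> (e q) \<le> (real n - 1) * scale q"
proof (rule triangular_sizes[OF _ _ q, where L = "\<lambda>s. len \<Gamma> (e s)"])
  show "triangular (\<lambda>q. {s \<in> {1..r}. quartet (\<lambda>s. cut \<Gamma> (e s)) s (i q) (l q) (j q) (k q)}) r"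
    using d by (intro admissible_triangular) (auto simp: trop_data_def)
  fix q assume q: "q \<in> {1..r}"
  then have "k q \<in> {1..n}" "l q \<in> {1..n}" "k q < l q"
    using d S_legs[OF q] unfolding trop_data_def admissible_def by blast+
  then show "scale q \<le> (\<Sum>s | s \<in> {1..r} \<and> quartet (\<lambda>s. cut \<Gamma> (e s)) s (i q) (l q) (j q) (k q). len \<Gamma> (e s)) \<and>
      (\<Sum>s | s \<in> {1..r} \<and> quartet (\<lambda>s. cut \<Gamma> (e s)) s (i q) (l q) (j q) (k q). len \<Gamma> (e s)) \<le> (real n - 1) * scale q"
    using difference_bounds[of "k q" "l q" q] d q unfolding trop_data_def scale_def by auto
qed

lemma trop_data_minima:
  assumes \<Gamma>: "\<Gamma> \<in> M0n_trop n" and d: "trop_data n B S i j r \<Gamma> e k l" and q: "q \<in> {1..r}"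
  shows "trop_val \<Gamma> q (k q) = trop_val \<Gamma> q (l q)"
    and "\<alpha> \<in> S q - {i q, j q} \<Longrightarrow> \<alpha> \<noteq> k q \<Longrightarrow> \<alpha> \<noteq> l q \<Longrightarrow> trop_val \<Gamma> q (k q) < trop_val \<Gamma> q \<alpha>"
proof -
  let ?Y = "\<lambda>s. cut \<Gamma> (e s)" and ?L = "\<lambda>s. len \<Gamma> (e s)"
  have e: "bij_betw e {1..r} (edges \<Gamma>)" and adm: "admissible ?Y (S q) (i q) (j q) q (k q) (l q)"
    and bal: "(\<Sum>s | s \<in> {1..r} \<and> quartet ?Y s (i q) (l q) (j q) (k q). ?L s) = (real (l q) - real (k q)) * scale q"
    using d q by (auto simp: trop_data_def scale_def)
  note a = adm[unfolded admissible_def]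
  note cmp = numbered_compatible[OF \<Gamma> e]
  have lk: "quartet ?Y q (i q) (l q) (j q) (k q)" using a by blast
  note val = trop_val_numbered[OF \<Gamma> q _ e]
  have kl: "k q \<in> {1..n}" "l q \<in> {1..n}" using a S_legs[OF q] by blast+
  have ex: "\<exists>s\<in>{1..r}. quartet ?Y s (i q) (l q) (j q) (k q)" using lk q by blast
  have eq: "split_dist ?Y ?L {1..r} (i q) (j q) (k q) + real (k q) * scale q
      = split_dist ?Y ?L {1..r} (i q) (j q) (l q) + real (l q) * scale q"
  proof (subst balanced_iff[OF _ cmp _ ex])
    show "{i q, j q, k q, l q} \<subseteq> {1..n}" using kl S_legs[OF q] by blast
  qed (use bal in simp_all)
  show "trop_val \<Gamma> q (k q) = trop_val \<Gamma> q (l q)" using eq val kl by simp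
  assume \<alpha>: "\<alpha> \<in> S q - {i q, j q}" "\<alpha> \<noteq> k q" "\<alpha> \<noteq> l q"
  then have "\<alpha> \<in> {1..n}" using S_legs[OF q] by blast
  moreover have "split_dist ?Y ?L {1..r} (i q) (j q) (k q) + real (k q) * scale q
      < split_dist ?Y ?L {1..r} (i q) (j q) \<alpha> + real \<alpha> * scale q"
    by (rule admissible_imp_minimal[OF cmp _ _ _ trop_data_sizes[OF d] q _ _ _ lk _ eq adm \<alpha>])
      (use a S_legs[OF q] in blast)+
  ultimately show "trop_val \<Gamma> q (k q) < trop_val \<Gamma> q \<alpha>" using val kl by simp
qed

lemma trop_data_min_pair:
  assumes \<Gamma>: "\<Gamma> \<in> M0n_trop n" and d: "trop_data n B S i j r \<Gamma> e k l" and q: "q \<in> {1..r}"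
  shows "min_pair n B S i j \<Gamma> q = (k q, l q)"
proof -
  have kl: "k q \<in> S q - {i q, j q}" "l q \<in> S q - {i q, j q}" "k q < l q"
    using d q unfolding trop_data_def admissible_def by blast+
  note m = trop_data_minima[OF \<Gamma> d q]
  have "minimizers n B S i j \<Gamma> q = {\<alpha>. is_arg_min (trop_val \<Gamma> q) (\<lambda>\<beta>. \<beta> \<in> S q - {i q, j q}) \<alpha>}"
    unfolding minimizers_def trop_val_def scale_def by simp
  also have "\<dots> = {k q, l q}"
  proof (intro equalityI subsetI)
    fix x assume "x \<in> {\<alpha>. is_arg_min (trop_val \<Gamma> q) (\<lambda>\<beta>. \<beta> \<in> S q - {i q, j q}) \<alpha>}"
    then have "x \<in> S q - {i q, j q}" "\<not> trop_val \<Gamma> q (k q) < trop_val \<Gamma> q x"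
      using kl(1) unfolding is_arg_min_def by blast+
    then show "x \<in> {k q, l q}" using m(2) by blast
  next
    fix x assume x: "x \<in> {k q, l q}"
    have "\<not> trop_val \<Gamma> q \<beta> < trop_val \<Gamma> q x" if "\<beta> \<in> S q - {i q, j q}" for \<beta>
      using m(1) m(2)[OF that] x by fastforce
    then show "x \<in> {\<alpha>. is_arg_min (trop_val \<Gamma> q) (\<lambda>\<beta>. \<beta> \<in> S q - {i q, j q}) \<alpha>}"
      unfolding is_arg_min_def using x kl(1,2) by auto
  qed
  finally have "minimizers n B S i j \<Gamma> q = {k q, l q}" .
  then have *: "min_pair n B S i j \<Gamma> q = (THE p. fst p < snd p \<and> {k q, l q} = {fst p, snd p})"
    unfolding min_pair_def by simp
  show ?thesis unfolding *
  proof (rule the_equality)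
    fix p assume "fst p < snd p \<and> {k q, l q} = {fst p, snd p}"
    then show "p = (k q, l q)" using kl(3) by (cases p) (simp add: doubleton_eq_iff, linarith)
  qed (use kl(3) in simp)
qed

text \<open>Two minimizing indices for every hypersurface leave no room for edges other than the
  \<open>r\<close> required ones, one of each order of magnitude.\<close>

lemma double_minima_imp_trop_data:
  assumes \<Gamma>: "\<Gamma> \<in> M0n_trop n" and card: "card (edges \<Gamma>) \<le> r"
    and min: "\<And>q. q \<in> {1..r} \<Longrightarrow> \<exists>k l. k \<in> S q - {i q, j q} \<and> l \<in> S q - {i q, j q} \<and> k < l \<and>
      trop_val \<Gamma> q k = trop_val \<Gamma> q l \<and> (\<forall>\<alpha>\<in>S q - {i q, j q}. trop_val \<Gamma> q k \<le> trop_val \<Gamma> q \<alpha>)"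
  shows "\<exists>e k l. trop_data n B S i j r \<Gamma> e k l"
proof -
  obtain k l where kl: "\<And>q. q \<in> {1..r} \<Longrightarrow> k q \<in> S q - {i q, j q} \<and> l q \<in> S q - {i q, j q} \<and> k q < l q \<and>
      trop_val \<Gamma> q (k q) = trop_val \<Gamma> q (l q) \<and> (\<forall>\<alpha>\<in>S q - {i q, j q}. trop_val \<Gamma> q (k q) \<le> trop_val \<Gamma> q \<alpha>)"
    using min by metis
  have st: "stable_tree n \<Gamma>" and pos: "\<And>e. e \<in> edges \<Gamma> \<Longrightarrow> len \<Gamma> e > 0" using \<Gamma> by (auto simp: M0n_trop_def)
  have finE: "finite (edges \<Gamma>)" using st tree_finite by (auto simp: stable_tree_def)
  note cmp = cut_family_compatible[OF st, OF order.trans[OF _ n3]]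
  define P where "P q = {x \<in> edges \<Gamma>. quartet (cut \<Gamma>) x (i q) (l q) (j q) (k q)}" for q
  have kln: "k q \<in> {1..n}" "l q \<in> {1..n}" if "q \<in> {1..r}" for q using kl[OF that] S_legs[OF that] by blast+
  have sumP: "sum (len \<Gamma>) (P q) = (real (l q) - real (k q)) * scale q" if q: "q \<in> {1..r}" for q
  proof -
    have eq: "split_dist (cut \<Gamma>) (len \<Gamma>) (edges \<Gamma>) (i q) (j q) (k q) + real (k q) * scale q
       = split_dist (cut \<Gamma>) (len \<Gamma>) (edges \<Gamma>) (i q) (j q) (l q) + real (l q) * scale q"
      using kl[OF q] trop_val_split[OF \<Gamma> q] kln[OF q] by metis
    have "\<exists>s\<in>edges \<Gamma>. quartet (cut \<Gamma>) s (i q) (l q) (j q) (k q)"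
      using balanced_imp_split[OF finE pos _ c_pos eq] kl[OF q] by blast
    moreover have "{i q, j q, k q, l q} \<subseteq> {1..n}" using kln[OF q] S_legs[OF q] by blast
    ultimately show ?thesis using balanced_iff[OF finE cmp] eq unfolding P_def by simp
  qed
  obtain e where e: "bij_betw e {1..r} (edges \<Gamma>)"
    and eP: "\<And>q. q \<in> {1..r} \<Longrightarrow> e q \<in> P q" "\<And>q s. q \<in> {1..r} \<Longrightarrow> s \<in> {1..r} \<Longrightarrow> e s \<in> P q \<Longrightarrow> s \<ge> q"
  proof -
    have "\<exists>e. bij_betw e {1..r} (edges \<Gamma>) \<and> (\<forall>q\<in>{1..r}. e q \<in> P q \<and> (\<forall>s\<in>{1..r}. e s \<in> P q \<longrightarrow> s \<ge> q))"
    proof (rule one_edge_per_scale[OF finE card pos])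
      fix q assume q: "q \<in> {1..r}"
      show "P q \<subseteq> edges \<Gamma>" by (auto simp: P_def)
      show "scale q \<le> sum (len \<Gamma>) (P q) \<and> sum (len \<Gamma>) (P q) \<le> (real n - 1) * scale q"
        unfolding sumP[OF q] using difference_bounds kln[OF q] kl[OF q] by blast
    qed
    then show thesis using that by blast
  qed
  let ?Y = "\<lambda>s. cut \<Gamma> (e s)" and ?L = "\<lambda>s. len \<Gamma> (e s)"
  let ?P = "\<lambda>q. {s \<in> {1..r}. quartet ?Y s (i q) (l q) (j q) (k q)}"
  have sumP': "sum ?L (?P q) = (real (l q) - real (k q)) * scale q" if q: "q \<in> {1..r}" for q
    using sum_filter_bij[OF e, where R = "\<lambda>x. quartet (cut \<Gamma>) x (i q) (l q) (j q) (k q)" and L = "len \<Gamma>"] sumP[OF q]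
    by (simp only: P_def quartet_reindex)
  have tri: "triangular ?P r"
  proof -
    have "q \<in> ?P q \<and> ?P q \<subseteq> {q..r}" if q: "q \<in> {1..r}" for q
      using eP(1)[OF q] eP(2)[OF q] q by (auto simp: P_def quartet_reindex bij_betwE[OF e])
    then show ?thesis by (auto simp: triangular_def)
  qed
  have bd: "scale q \<le> sum ?L (?P q) \<and> sum ?L (?P q) \<le> (real n - 1) * scale q" if q: "q \<in> {1..r}" for q
    unfolding sumP'[OF q] using difference_bounds kln[OF q] kl[OF q] by blast
  note sizes = triangular_sizes[OF tri bd]
  have "admissible ?Y (S q) (i q) (j q) q (k q) (l q)" if q: "q \<in> {1..r}" for q
  proof (rule minimal_imp_admissible[OF numbered_compatible[OF \<Gamma> e] _ _ _ sizes q])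
    show "quartet ?Y q (i q) (l q) (j q) (k q)" using tri q by (auto simp: triangular_def)
    show "\<not> quartet ?Y s (i q) (l q) (j q) (k q)" if s: "s \<in> {1..<q}" for s
    proof
      assume "quartet ?Y s (i q) (l q) (j q) (k q)"
      then have "s \<in> ?P q" using s q by auto
      then show False using tri q s by (fastforce simp: triangular_def)
    qed
    show "split_dist ?Y ?L {1..r} (i q) (j q) (k q) + real (k q) * scale q
       = split_dist ?Y ?L {1..r} (i q) (j q) (l q) + real (l q) * scale q"
      using kl[OF q] trop_val_numbered[OF \<Gamma> q _ e] kln[OF q] by metis
    fix \<alpha> assume \<alpha>: "\<alpha> \<in> S q - {i q, j q}"
    then have "\<alpha> \<in> {1..n}" using S_legs[OF q] by blast
    then show "split_dist ?Y ?L {1..r} (i q) (j q) (k q) + real (k q) * scale q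
       \<le> split_dist ?Y ?L {1..r} (i q) (j q) \<alpha> + real \<alpha> * scale q"
      using kl[OF q] trop_val_numbered[OF \<Gamma> q _ e] kln[OF q] \<alpha> by metis
  qed (use kl[OF q] S_legs[OF q] in blast)+
  then have "trop_data n B S i j r \<Gamma> e k l"
    unfolding trop_data_def using e sumP' by (simp add: scale_def)
  then show ?thesis by blast
qed

end

section \<open>Valuations of the points of the hypersurfaces\<close>

locale valued_field = field L for L (structure) +
  fixes val :: "'a \<Rightarrow> real"
  assumes val_mult: "\<And>x y. x \<in> carrier L - {\<zero>} \<Longrightarrow> y \<in> carrier L - {\<zero>} \<Longrightarrow> val (x \<otimes> y) = val x + val y"
    and val_add: "\<And>x y. x \<in> carrier L - {\<zero>} \<Longrightarrow> y \<in> carrier L - {\<zero>} \<Longrightarrow> x \<oplus> y \<noteq> \<zero> \<Longrightarrow>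
      min (val x) (val y) \<le> val (x \<oplus> y)"
begin

lemma val_one: "val \<one> = 0"
  using val_mult[of \<one> \<one>] by simp

lemma val_minus: assumes "x \<in> carrier L - {\<zero>}" shows "val (\<ominus> x) = val x"
proof -
  have m1: "\<ominus> \<one> \<in> carrier L - {\<zero>}" using add.inv_eq_1_iff by auto
  have "(\<ominus> \<one>) \<otimes> (\<ominus> \<one>) = \<one>" by algebra
  then have "val (\<ominus> \<one>) = 0" using val_mult[OF m1 m1] val_one by simp
  moreover have "\<ominus> x = (\<ominus> \<one>) \<otimes> x" using assms by (simp add: l_minus)
  ultimately show ?thesis using val_mult[OF m1 assms] by simp
qed

lemma val_inv: assumes "x \<in> carrier L - {\<zero>}" shows "inv x \<in> carrier L - {\<zero>}" "val (inv x) = - val x"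
proof -
  have u: "x \<in> Units L" using assms field_Units by blast
  then show i: "inv x \<in> carrier L - {\<zero>}" using field_Units Units_inv_Units by blast
  show "val (inv x) = - val x" using val_mult[OF assms i] val_one u by simp
qed

lemma val_finsum:
  assumes "finite A" "\<And>a. a \<in> A \<Longrightarrow> f a \<in> carrier L - {\<zero>}" "\<And>a. a \<in> A \<Longrightarrow> \<gamma> < val (f a)"
    "(\<Oplus>a\<in>A. f a) \<noteq> \<zero>"
  shows "\<gamma> < val (\<Oplus>a\<in>A. f a)"
  using assms
proof (induction A rule: finite_induct)
  case (insert x A)
  have f: "f \<in> A \<rightarrow> carrier L" "f x \<in> carrier L - {\<zero>}" using insert.prems by auto
  then have s: "(\<Oplus>a\<in>insert x A. f a) = f x \<oplus> (\<Oplus>a\<in>A. f a)"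
    using insert.hyps by (intro finsum_insert) auto
  show ?case
  proof (cases "(\<Oplus>a\<in>A. f a) = \<zero>")
    case True
    then show ?thesis using s f insert.prems by simp
  next
    case False
    then have "\<gamma> < val (\<Oplus>a\<in>A. f a)" using insert by simp
    moreover have "\<gamma> < val (f x)" using insert.prems by simp
    moreover have "(\<Oplus>a\<in>A. f a) \<in> carrier L - {\<zero>}" using False f by simp
    ultimately show ?thesis using val_add[OF f(2), of "\<Oplus>a\<in>A. f a"] s insert.prems(3) by auto
  qed
qed simp

text \<open>A unique summand of least valuation cannot be cancelled by the others.\<close>

lemma vanishing_sum_minimum_twice:
  assumes A: "finite A" "A \<noteq> {}" and f: "\<And>a. a \<in> A \<Longrightarrow> f a \<in> carrier L - {\<zero>}" and z: "(\<Oplus>a\<in>A. f a) = \<zero>"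
  shows "\<exists>a\<in>A. \<exists>b\<in>A. a \<noteq> b \<and> val (f a) = val (f b) \<and> (\<forall>c\<in>A. val (f a) \<le> val (f c))"
proof -
  obtain a where a: "a \<in> A" "\<And>c. c \<in> A \<Longrightarrow> val (f a) \<le> val (f c)"
    using arg_min_if_finite[OF A, of "\<lambda>a. val (f a)"] by (metis not_less)
  have "\<exists>b\<in>A. b \<noteq> a \<and> val (f b) = val (f a)"
  proof (rule ccontr)
    assume none: "\<not> ?thesis"
    have fA: "f \<in> A - {a} \<rightarrow> carrier L" "f a \<in> carrier L" "f a \<noteq> \<zero>" using f a by auto
    have "A = insert a (A - {a})" using a by blast
    then have "(\<Oplus>a\<in>A. f a) = f a \<oplus> (\<Oplus>b\<in>A - {a}. f b)"
      using finsum_insert[of "A - {a}" a f] fA A(1) by simp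
    then have s: "f a \<oplus> (\<Oplus>b\<in>A - {a}. f b) = \<zero>" using z by simp
    have eq: "(\<Oplus>b\<in>A - {a}. f b) = \<ominus> (f a)"
      using s fA by (metis add.inv_equality finsum_closed a_comm)
    then have "(\<Oplus>b\<in>A - {a}. f b) \<noteq> \<zero>" using fA by auto
    then have "val (f a) < val (\<Oplus>b\<in>A - {a}. f b)"
    proof (rule val_finsum[rotated 3])
      fix b assume b: "b \<in> A - {a}"
      then show "val (f a) < val (f b)" using a(2)[of b] none by fastforce
    qed (use A f in auto)
    then show False using val_minus[of "f a"] eq fA by simp
  qed
  then show ?thesis using a by metis
qed

text \<open>A linear form in two variables is determined by its zero on the projective line up to a factor.\<close>

lemma linear_form_minor:
  assumes cl: "c \<in> carrier L" "d \<in> carrier L" "x0 \<in> carrier L" "y0 \<in> carrier L"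
    and nz: "c \<noteq> \<zero> \<or> d \<noteq> \<zero>" "x0 \<noteq> \<zero> \<or> y0 \<noteq> \<zero>" and van: "c \<otimes> x0 \<oplus> d \<otimes> y0 = \<zero>"
  shows "\<exists>\<kappa>. \<forall>x\<in>carrier L. \<forall>y\<in>carrier L. x \<otimes> y0 \<ominus> x0 \<otimes> y \<noteq> \<zero> \<longrightarrow>
     c \<otimes> x \<oplus> d \<otimes> y \<noteq> \<zero> \<and> val (c \<otimes> x \<oplus> d \<otimes> y) = \<kappa> + val (x \<otimes> y0 \<ominus> x0 \<otimes> y)"
proof -
  have cx: "c \<otimes> x0 = \<ominus> (d \<otimes> y0)" using van cl by (metis add.inv_equality m_closed)
  have 1: "x0 \<otimes> (c \<otimes> x \<oplus> d \<otimes> y) = (\<ominus> d) \<otimes> (x \<otimes> y0 \<ominus> x0 \<otimes> y)" if "x \<in> carrier L" "y \<in> carrier L" for x y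
  proof -
    have "x0 \<otimes> (c \<otimes> x \<oplus> d \<otimes> y) = (c \<otimes> x0) \<otimes> x \<oplus> d \<otimes> x0 \<otimes> y" using cl that by algebra
    also have "\<dots> = (\<ominus> d) \<otimes> (x \<otimes> y0 \<ominus> x0 \<otimes> y)" unfolding cx using cl that by algebra
    finally show ?thesis .
  qed
  have 2: "y0 \<otimes> (c \<otimes> x \<oplus> d \<otimes> y) = c \<otimes> (x \<otimes> y0 \<ominus> x0 \<otimes> y)" if "x \<in> carrier L" "y \<in> carrier L" for x y
  proof -
    have "c \<otimes> (x \<otimes> y0 \<ominus> x0 \<otimes> y) = c \<otimes> x \<otimes> y0 \<ominus> (c \<otimes> x0) \<otimes> y" using cl that by algebra
    also have "\<dots> = y0 \<otimes> (c \<otimes> x \<oplus> d \<otimes> y)" unfolding cx using cl that by algebra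
    finally show ?thesis by simp
  qed
  have *: "\<exists>\<kappa>. \<forall>x\<in>carrier L. \<forall>y\<in>carrier L. x \<otimes> y0 \<ominus> x0 \<otimes> y \<noteq> \<zero> \<longrightarrow>
     c \<otimes> x \<oplus> d \<otimes> y \<noteq> \<zero> \<and> val (c \<otimes> x \<oplus> d \<otimes> y) = \<kappa> + val (x \<otimes> y0 \<ominus> x0 \<otimes> y)"
    if u: "u \<in> carrier L - {\<zero>}" and w: "w \<in> carrier L - {\<zero>}"
      and uw: "\<And>x y. x \<in> carrier L \<Longrightarrow> y \<in> carrier L \<Longrightarrow> u \<otimes> (c \<otimes> x \<oplus> d \<otimes> y) = w \<otimes> (x \<otimes> y0 \<ominus> x0 \<otimes> y)" for u w
  proof (intro exI[of _ "val w - val u"] ballI impI)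
    fix x y assume xy: "x \<in> carrier L" "y \<in> carrier L" and m: "x \<otimes> y0 \<ominus> x0 \<otimes> y \<noteq> \<zero>"
    have mc: "x \<otimes> y0 \<ominus> x0 \<otimes> y \<in> carrier L - {\<zero>}" using m xy cl by simp
    have "w \<otimes> (x \<otimes> y0 \<ominus> x0 \<otimes> y) \<noteq> \<zero>" using w mc integral by blast
    then have nz: "c \<otimes> x \<oplus> d \<otimes> y \<noteq> \<zero>" using uw[OF xy] u by auto
    then have "c \<otimes> x \<oplus> d \<otimes> y \<in> carrier L - {\<zero>}" using xy cl by simp
    then have "val u + val (c \<otimes> x \<oplus> d \<otimes> y) = val w + val (x \<otimes> y0 \<ominus> x0 \<otimes> y)"
      using val_mult[OF u] val_mult[OF w mc] uw[OF xy] by metis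
    then show "c \<otimes> x \<oplus> d \<otimes> y \<noteq> \<zero> \<and> val (c \<otimes> x \<oplus> d \<otimes> y) = val w - val u + val (x \<otimes> y0 \<ominus> x0 \<otimes> y)"
      using nz by simp
  qed
  show ?thesis
  proof (cases "x0 = \<zero>")
    case False
    have "d \<noteq> \<zero>"
    proof
      assume "d = \<zero>"
      then have "c \<otimes> x0 = \<zero>" using van cl by simp
      then show False using False nz \<open>d = \<zero>\<close> cl integral by blast
    qed
    then have "\<ominus> d \<in> carrier L - {\<zero>}" using cl by auto
    then show ?thesis using *[of x0 "\<ominus> d"] 1 False cl by blast
  next
    case True
    then have "d \<otimes> y0 = \<zero>" using van cl by simp
    then have "d = \<zero>" using True nz cl integral by blast
    then show ?thesis using *[of y0 c] 2 True nz cl by blast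
  qed
qed

end

lemma leg_dist_symmetric_difference:
  assumes \<Gamma>: "\<Gamma> \<in> M0n_trop n" and legs: "a \<in> {1..n}" "b \<in> {1..n}" "l \<in> {1..n}"
  shows "leg_dist \<Gamma> l a - leg_dist \<Gamma> l b + leg_dist \<Gamma> a b = 2 * proj_dist \<Gamma> a b l"
proof -
  have st: "stable_tree n \<Gamma>" and n: "n \<ge> 1" using \<Gamma> legs by (auto simp: M0n_trop_def)
  have tree: "is_tree (verts \<Gamma>) (edges \<Gamma>)" and V: "\<And>x. x \<in> {1..n} \<Longrightarrow> att \<Gamma> x \<in> verts \<Gamma>"
    using st by (auto simp: stable_tree_def)
  have fin: "finite (edges \<Gamma>)" using tree_finite[OF tree] by blast
  have d: "leg_dist \<Gamma> x y = (\<Sum>e\<in>edges \<Gamma>. if cut \<Gamma> e x \<noteq> cut \<Gamma> e y then len \<Gamma> e else 0)"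
    if "x \<in> {1..n}" "y \<in> {1..n}" for x y
  proof -
    have "{e \<in> edges \<Gamma>. separates (edges \<Gamma>) e (att \<Gamma> x) (att \<Gamma> y)} = {e \<in> edges \<Gamma>. cut \<Gamma> e x \<noteq> cut \<Gamma> e y}"
      using cut_neq_iff[OF st _ that n] by blast
    then show ?thesis using tree_dist_eq(2)[OF tree V[OF that(1)] V[OF that(2)]] fin
      by (simp add: sum.inter_filter)
  qed
  have p: "proj_dist \<Gamma> a b l = (\<Sum>e\<in>edges \<Gamma>. if cut \<Gamma> e a \<noteq> cut \<Gamma> e b \<and> cut \<Gamma> e a \<noteq> cut \<Gamma> e l then len \<Gamma> e else 0)"
    unfolding proj_dist_split[OF \<Gamma> legs] split_dist_def using fin by (simp add: sum.inter_filter)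
  show ?thesis unfolding d[OF legs(3,1)] d[OF legs(3,2)] d[OF legs(1,2)] p
    unfolding sum_distrib_left sum_subtractf[symmetric] sum.distrib[symmetric]
    by (intro sum.cong) auto
qed

lemma minor_swap:
  assumes "cring L" "p a \<in> carrier L \<times> carrier L" "p b \<in> carrier L \<times> carrier L"
  shows "minor L p b a = \<ominus>\<^bsub>L\<^esub> (minor L p a b)"
proof -
  interpret cring L by fact
  show ?thesis unfolding minor_def using assms(2,3) by (auto simp: mem_Times_iff) algebra
qed

text \<open>The coordinate \<open>x \<alpha>\<close> is a ratio of minors up to a constant, so its valuation is \<open>(d(\<alpha>, i) - d(\<alpha>, j)) / 2\<close> up to a
  constant, which is \<open>proj_dist\<close> up to a constant.\<close>

lemma hypersurface_minimum_twice:
  fixes \<iota> :: "'k::field fls \<Rightarrow> 'u"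
  assumes \<Gamma>: "\<Gamma> \<in> M0n_trop n" and ext: "valued_extension L \<iota> val" and p: "p \<in> M0n_points L n"
    and minors: "\<And>a b. a \<in> {1..n} \<Longrightarrow> b \<in> {1..n} \<Longrightarrow> a < b \<Longrightarrow>
           val (minor L p a b) = lam a + lam b + (- 1/2) * leg_dist \<Gamma> a b"
    and hyp: "hypersurface n B S i j q L \<iota> p"
    and S: "S q \<subseteq> {1..n}" "i q \<in> S q" "j q \<in> S q" "i q \<noteq> j q" "S q - {i q, j q} \<noteq> {}"
  defines "w \<equiv> \<lambda>\<alpha>. proj_dist \<Gamma> (i q) (j q) \<alpha> + real \<alpha> * real B ^ (n - 3 - q)"
  shows "\<exists>a\<in>S q - {i q, j q}. \<exists>b\<in>S q - {i q, j q}. a \<noteq> b \<and> w a = w b \<and> (\<forall>c\<in>S q - {i q, j q}. w a \<le> w c)"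
proof -
  have fld: "field L" and hom: "\<iota> \<in> ring_hom (ring_of_type_algebra :: 'k fls ring) L"
    and val\<iota>: "\<And>f. f \<noteq> 0 \<Longrightarrow> val (\<iota> f) = real_of_int (fls_subdegree f)"
    using ext by (auto simp: valued_extension_def)
  interpret valued_field L val
    using ext unfolding valued_field_def valued_field_axioms_def valued_extension_def by auto
  have pc: "p a \<in> carrier L \<times> carrier L" if "a \<in> {1..n}" for a using p that by (auto simp: M0n_points_def)
  have pm: "minor L p a b \<in> carrier L - {\<zero>\<^bsub>L\<^esub>}" if "a \<in> {1..n}" "b \<in> {1..n}" "a \<noteq> b" for a b
    using p that pc[OF that(1)] pc[OF that(2)] by (auto simp: M0n_points_def minor_def mem_Times_iff)
  have valm: "val (minor L p a b) = lam a + lam b + (- 1/2) * leg_dist \<Gamma> a b"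
    if ab: "a \<in> {1..n}" "b \<in> {1..n}" "a \<noteq> b" for a b
  proof (cases "a < b")
    case True
    then show ?thesis using minors ab by blast
  next
    case False
    have "leg_dist \<Gamma> b a = leg_dist \<Gamma> a b"
    proof -
      have "is_tree (verts \<Gamma>) (edges \<Gamma>)" "att \<Gamma> a \<in> verts \<Gamma>" "att \<Gamma> b \<in> verts \<Gamma>"
        using \<Gamma> ab by (auto simp: M0n_trop_def stable_tree_def)
      then show ?thesis using tree_dist_eq(2) linked_sym by (smt (verit, best) Collect_cong)
    qed
    moreover have "val (minor L p a b) = val (minor L p b a)"
      using minor_swap[OF is_cring pc[OF ab(2)] pc[OF ab(1)]] val_minus pm ab by metis
    ultimately show ?thesis using minors[of b a] ab False by auto
  qed
  let ?A = "S q - {i q, j q}"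
  have ij: "i q \<in> {1..n}" "j q \<in> {1..n}" using S by auto
  obtain a b c d where abcd: "a \<in> carrier L" "b \<in> carrier L" "c \<in> carrier L" "d \<in> carrier L"
    and det: "(a \<otimes>\<^bsub>L\<^esub> d) \<ominus>\<^bsub>L\<^esub> (b \<otimes>\<^bsub>L\<^esub> c) \<noteq> \<zero>\<^bsub>L\<^esub>"
    and den0: "c \<otimes>\<^bsub>L\<^esub> fst (p (i q)) \<oplus>\<^bsub>L\<^esub> d \<otimes>\<^bsub>L\<^esub> snd (p (i q)) = \<zero>\<^bsub>L\<^esub>"
    and num0: "a \<otimes>\<^bsub>L\<^esub> fst (p (j q)) \<oplus>\<^bsub>L\<^esub> b \<otimes>\<^bsub>L\<^esub> snd (p (j q)) = \<zero>\<^bsub>L\<^esub>"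
    and sum0: "(\<Oplus>\<^bsub>L\<^esub>l\<in>?A. \<iota> (fls_X ^ (l * B ^ (n - 3 - q))) \<otimes>\<^bsub>L\<^esub>
        ((a \<otimes>\<^bsub>L\<^esub> fst (p l) \<oplus>\<^bsub>L\<^esub> b \<otimes>\<^bsub>L\<^esub> snd (p l)) \<otimes>\<^bsub>L\<^esub>
          inv\<^bsub>L\<^esub> (c \<otimes>\<^bsub>L\<^esub> fst (p l) \<oplus>\<^bsub>L\<^esub> d \<otimes>\<^bsub>L\<^esub> snd (p l)))) = \<zero>\<^bsub>L\<^esub>"
    using hyp unfolding hypersurface_def Let_def by blast
  have coord: "\<exists>\<kappa>. \<forall>l\<in>{1..n} - {h}. u \<otimes>\<^bsub>L\<^esub> fst (p l) \<oplus>\<^bsub>L\<^esub> v \<otimes>\<^bsub>L\<^esub> snd (p l) \<noteq> \<zero>\<^bsub>L\<^esub> \<and>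
      val (u \<otimes>\<^bsub>L\<^esub> fst (p l) \<oplus>\<^bsub>L\<^esub> v \<otimes>\<^bsub>L\<^esub> snd (p l)) = \<kappa> + val (minor L p l h)"
    if "u \<in> carrier L" "v \<in> carrier L" "u \<noteq> \<zero>\<^bsub>L\<^esub> \<or> v \<noteq> \<zero>\<^bsub>L\<^esub>" "h \<in> {1..n}" "h' \<in> {1..n}" "h' \<noteq> h"
      "u \<otimes>\<^bsub>L\<^esub> fst (p h) \<oplus>\<^bsub>L\<^esub> v \<otimes>\<^bsub>L\<^esub> snd (p h) = \<zero>\<^bsub>L\<^esub>" for u v h h'
  proof -
    have h: "fst (p h) \<in> carrier L" "snd (p h) \<in> carrier L" "fst (p h') \<in> carrier L" "snd (p h') \<in> carrier L"
      using pc[of h] pc[of h'] that by (auto simp: mem_Times_iff)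
    have "fst (p h) \<noteq> \<zero>\<^bsub>L\<^esub> \<or> snd (p h) \<noteq> \<zero>\<^bsub>L\<^esub>"
    proof (rule ccontr)
      assume "\<not> ?thesis"
      then have "minor L p h' h = \<zero>\<^bsub>L\<^esub>" using h by (simp add: minor_def minus_eq)
      then show False using pm[of h' h] that by simp
    qed
    from linear_form_minor[OF that(1,2) h(1,2) that(3) this that(7)]
    obtain \<kappa> where \<kappa>: "\<forall>x\<in>carrier L. \<forall>y\<in>carrier L. x \<otimes>\<^bsub>L\<^esub> snd (p h) \<ominus>\<^bsub>L\<^esub> fst (p h) \<otimes>\<^bsub>L\<^esub> y \<noteq> \<zero>\<^bsub>L\<^esub> \<longrightarrow>
       u \<otimes>\<^bsub>L\<^esub> x \<oplus>\<^bsub>L\<^esub> v \<otimes>\<^bsub>L\<^esub> y \<noteq> \<zero>\<^bsub>L\<^esub> \<and> val (u \<otimes>\<^bsub>L\<^esub> x \<oplus>\<^bsub>L\<^esub> v \<otimes>\<^bsub>L\<^esub> y) =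
         \<kappa> + val (x \<otimes>\<^bsub>L\<^esub> snd (p h) \<ominus>\<^bsub>L\<^esub> fst (p h) \<otimes>\<^bsub>L\<^esub> y)" by blast
    show ?thesis
    proof (intro exI[of _ \<kappa>] ballI)
      fix l assume l: "l \<in> {1..n} - {h}"
      then have "fst (p l) \<in> carrier L" "snd (p l) \<in> carrier L" "minor L p l h \<noteq> \<zero>\<^bsub>L\<^esub>"
        using pc[of l] pm[of l h] that(4) by (auto simp: mem_Times_iff)
      then show "u \<otimes>\<^bsub>L\<^esub> fst (p l) \<oplus>\<^bsub>L\<^esub> v \<otimes>\<^bsub>L\<^esub> snd (p l) \<noteq> \<zero>\<^bsub>L\<^esub> \<and>
         val (u \<otimes>\<^bsub>L\<^esub> fst (p l) \<oplus>\<^bsub>L\<^esub> v \<otimes>\<^bsub>L\<^esub> snd (p l)) = \<kappa> + val (minor L p l h)"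
        using \<kappa> unfolding minor_def by blast
    qed
  qed
  have nz: "a \<noteq> \<zero>\<^bsub>L\<^esub> \<or> b \<noteq> \<zero>\<^bsub>L\<^esub>" "c \<noteq> \<zero>\<^bsub>L\<^esub> \<or> d \<noteq> \<zero>\<^bsub>L\<^esub>"
    using det abcd by (auto simp: minus_eq)
  define num where "num l = a \<otimes>\<^bsub>L\<^esub> fst (p l) \<oplus>\<^bsub>L\<^esub> b \<otimes>\<^bsub>L\<^esub> snd (p l)" for l
  define den where "den l = c \<otimes>\<^bsub>L\<^esub> fst (p l) \<oplus>\<^bsub>L\<^esub> d \<otimes>\<^bsub>L\<^esub> snd (p l)" for l
  obtain \<kappa>n \<kappa>d where num: "\<And>l. l \<in> {1..n} - {j q} \<Longrightarrow> num l \<noteq> \<zero>\<^bsub>L\<^esub> \<and> val (num l) = \<kappa>n + val (minor L p l (j q))"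
    and den: "\<And>l. l \<in> {1..n} - {i q} \<Longrightarrow> den l \<noteq> \<zero>\<^bsub>L\<^esub> \<and> val (den l) = \<kappa>d + val (minor L p l (i q))"
    using coord[OF abcd(1,2) nz(1) ij(2,1) S(4) num0] coord[OF abcd(3,4) nz(2) ij S(4)[symmetric] den0]
    unfolding num_def den_def by blast
  have carr: "num l \<in> carrier L" "den l \<in> carrier L" if "l \<in> {1..n}" for l
    using pc[OF that] abcd unfolding num_def den_def by (auto simp: mem_Times_iff)
  define f where "f l = \<iota> (fls_X ^ (l * B ^ (n - 3 - q))) \<otimes>\<^bsub>L\<^esub> (num l \<otimes>\<^bsub>L\<^esub> inv\<^bsub>L\<^esub> (den l))" for l
  define \<kappa> where "\<kappa> = \<kappa>n - \<kappa>d + lam (j q) - lam (i q) - leg_dist \<Gamma> (i q) (j q) / 2"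
  have f: "f l \<in> carrier L - {\<zero>\<^bsub>L\<^esub>} \<and> val (f l) = w l + \<kappa>" if l: "l \<in> ?A" for l
  proof -
    have ln: "l \<in> {1..n}" "l \<noteq> i q" "l \<noteq> j q" using l S by auto
    have \<iota>c: "\<iota> x \<in> carrier L" for x using hom by (auto simp: ring_hom_def ring_of_type_algebra_def)
    have "\<iota> x \<noteq> \<zero>\<^bsub>L\<^esub>" if "x \<noteq> 0" for x
    proof
      assume "\<iota> x = \<zero>\<^bsub>L\<^esub>"
      moreover have "\<iota> (x * inverse x) = \<iota> x \<otimes>\<^bsub>L\<^esub> \<iota> (inverse x)" "\<iota> 1 = \<one>\<^bsub>L\<^esub>"
        using hom by (auto simp: ring_hom_def ring_of_type_algebra_def)
      ultimately show False using \<iota>c that by simp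
    qed
    then have t: "\<iota> (fls_X ^ (l * B ^ (n - 3 - q))) \<in> carrier L - {\<zero>\<^bsub>L\<^esub>}" using \<iota>c by simp
    have tv: "val (\<iota> (fls_X ^ (l * B ^ (n - 3 - q)))) = real l * real B ^ (n - 3 - q)"
      by (subst val\<iota>) (simp_all add: fls_subdegree_pow)
    have nd: "num l \<in> carrier L - {\<zero>\<^bsub>L\<^esub>}" "den l \<in> carrier L - {\<zero>\<^bsub>L\<^esub>}"
      using num den carr ln by auto
    note inv = val_inv[OF nd(2)]
    have x: "num l \<otimes>\<^bsub>L\<^esub> inv\<^bsub>L\<^esub> (den l) \<in> carrier L - {\<zero>\<^bsub>L\<^esub>}"
      using nd inv integral by auto
    have "f l \<in> carrier L - {\<zero>\<^bsub>L\<^esub>}" unfolding f_def using t x integral by auto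
    moreover have "val (f l) = real l * real B ^ (n - 3 - q) + (val (num l) - val (den l))"
      unfolding f_def using val_mult[OF t x] val_mult[OF nd(1) inv(1)] inv(2) tv by simp
    moreover have "val (num l) = \<kappa>n + (lam l + lam (j q) + (- 1/2) * leg_dist \<Gamma> l (j q))"
      using num[of l] ln valm[OF ln(1) ij(2) ln(3)] by simp
    moreover have "val (den l) = \<kappa>d + (lam l + lam (i q) + (- 1/2) * leg_dist \<Gamma> l (i q))"
      using den[of l] ln valm[OF ln(1) ij(1) ln(2)] by simp
    ultimately show ?thesis
      using leg_dist_symmetric_difference[OF \<Gamma> ij ln(1)] unfolding w_def \<kappa>_def by (intro conjI) simp_all
  qed
  have "finite ?A" using S(1) finite_subset by blast
  moreover have "(\<Oplus>\<^bsub>L\<^esub>l\<in>?A. f l) = \<zero>\<^bsub>L\<^esub>" using sum0 unfolding f_def num_def den_def .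
  ultimately obtain a b where "a \<in> ?A" "b \<in> ?A" "a \<noteq> b" "val (f a) = val (f b)" "\<forall>c\<in>?A. val (f a) \<le> val (f c)"
    using vanishing_sum_minimum_twice[of ?A f] S(5) f by blast
  then show ?thesis using f by (intro bexI[of _ a] bexI[of _ b]) auto
qed

section \<open>Solving triangular monomial systems over power series\<close>

definition fps_cong :: "nat \<Rightarrow> 'k::field fps \<Rightarrow> 'k fps \<Rightarrow> bool" where
  "fps_cong N f g \<longleftrightarrow> fps_X ^ N dvd f - g"

lemma fps_X_power_dvd_iff: "fps_X ^ N dvd (f :: 'k::field fps) \<longleftrightarrow> (\<forall>m<N. f $ m = 0)"
proof
  assume "\<forall>m<N. f $ m = 0"
  then have "f = fps_X ^ N * fps_shift N f" by (intro fps_ext) (simp add: fps_X_power_mult_nth)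
  then show "fps_X ^ N dvd f" by (rule dvdI)
qed (auto simp: dvd_def fps_X_power_mult_nth)

lemma fps_cong_iff: "fps_cong N f g \<longleftrightarrow> (\<forall>m<N. f $ m = g $ m)"
  by (simp add: fps_cong_def fps_X_power_dvd_iff)

lemma fps_cong_refl [simp]: "fps_cong N f f"
  by (simp add: fps_cong_iff)

lemma fps_cong_0 [simp]: "fps_cong 0 f g"
  by (simp add: fps_cong_iff)

lemma fps_cong_sym: "fps_cong N f g \<Longrightarrow> fps_cong N g f"
  by (simp add: fps_cong_iff)

lemma fps_cong_trans: "fps_cong N f g \<Longrightarrow> fps_cong N g h \<Longrightarrow> fps_cong N f h"
  by (simp add: fps_cong_iff)

lemma fps_cong_mono: "fps_cong N f g \<Longrightarrow> M \<le> N \<Longrightarrow> fps_cong M f g"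
  by (simp add: fps_cong_iff)

lemma fps_cong_add: "fps_cong N f g \<Longrightarrow> fps_cong N f' g' \<Longrightarrow> fps_cong N (f + f') (g + g')"
  by (simp add: fps_cong_iff)

lemma fps_cong_minus: "fps_cong N f g \<Longrightarrow> fps_cong N f' g' \<Longrightarrow> fps_cong N (f - f') (g - g')"
  by (simp add: fps_cong_iff)

lemma fps_cong_uminus: "fps_cong N f g \<Longrightarrow> fps_cong N (- f) (- g)"
  by (simp add: fps_cong_iff)

lemma fps_cong_mult: "fps_cong N f g \<Longrightarrow> fps_cong N f' g' \<Longrightarrow> fps_cong N (f * f') (g * g')"
proof -
  assume "fps_cong N f g" "fps_cong N f' g'"
  moreover have "f * f' - g * g' = (f - g) * f' + g * (f' - g')" by (simp add: algebra_simps)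
  ultimately show ?thesis unfolding fps_cong_def by (simp add: dvd_add)
qed

lemma fps_cong_X_mult: "fps_cong N f g \<Longrightarrow> fps_cong (e + N) (fps_X ^ e * f) (fps_X ^ e * g)"
  unfolding fps_cong_def right_diff_distrib[symmetric] power_add by (intro mult_dvd_mono) auto

lemma fps_cong_sum: "(\<And>a. a \<in> A \<Longrightarrow> fps_cong N (f a) (g a)) \<Longrightarrow> fps_cong N (sum f A) (sum g A)"
  by (induction A rule: infinite_finite_induct) (auto intro: fps_cong_add)

lemma fps_cong_prod: "(\<And>a. a \<in> A \<Longrightarrow> fps_cong N (f a) (g a)) \<Longrightarrow> fps_cong N (prod f A) (prod g A)"
  by (induction A rule: infinite_finite_induct) (auto intro: fps_cong_mult)

lemma fps_cong_cancel:
  assumes "fps_cong N (f * h) (g * h')" "fps_cong N h h'" "h $ 0 \<noteq> (0 :: 'k::field)"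
  shows "fps_cong N f g"
proof -
  have "fps_cong N (g * h') (g * h)" using assms(2) by (intro fps_cong_mult fps_cong_sym[OF assms(2)]) simp
  then have "fps_cong N (f * h * inverse h) (g * h * inverse h)"
    by (rule fps_cong_mult[OF fps_cong_trans[OF assms(1)] fps_cong_refl])
  moreover have "h * inverse h = 1" using assms(3) by (rule inverse_mult_eq_1')
  ultimately show ?thesis by (simp only: mult.assoc mult_1_right)
qed

lemma fps_cong_inverse:
  assumes "fps_cong N f g" "f $ 0 \<noteq> (0 :: 'k::field)" "g $ 0 \<noteq> 0"
  shows "fps_cong N (inverse f) (inverse g)"
  by (rule fps_cong_cancel[where h = f and h' = g]) (use assms in \<open>simp_all add: inverse_mult_eq_1\<close>)

lemma fps_prod_nth_0: "prod f A $ 0 = (\<Prod>a\<in>A. f a $ 0 :: 'k::field)"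
  by (induction A rule: infinite_finite_induct) auto

lemma fps_prod_unit: "(\<And>a. a \<in> A \<Longrightarrow> f a $ 0 \<noteq> (0 :: 'k::field)) \<Longrightarrow> prod f A $ 0 \<noteq> 0"
  unfolding fps_prod_nth_0 by (induction A rule: infinite_finite_induct) auto

text \<open>Here and in the next lemma, the arguments for linear triangular systems are repeated in the multiplicative
  group of units.\<close>

lemma triangular_prod_solvable:
  assumes tri: "triangular P r" and b: "\<And>q. q \<in> {1..r} \<Longrightarrow> b q $ 0 \<noteq> (0 :: 'k::field)"
  shows "\<exists>u. (\<forall>s. u s $ 0 \<noteq> 0) \<and> (\<forall>q\<in>{1..r}. prod u (P q) = b q)"
proof -
  have "\<exists>u. (\<forall>s. u s $ 0 \<noteq> 0) \<and> (\<forall>q\<in>{1..r}. r < q + p \<longrightarrow> prod u (P q) = b q)" for p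
  proof (induction p)
    case 0
    show ?case by (intro exI[of _ "\<lambda>_. 1"]) auto
  next
    case (Suc p)
    then obtain u where u: "\<And>s. u s $ 0 \<noteq> 0"
      "\<And>q. q \<in> {1..r} \<Longrightarrow> r < q + p \<Longrightarrow> prod u (P q) = b q" by blast
    show ?case
    proof (cases "p < r")
      case True
      let ?R = "prod u (P (r - p) - {r - p})"
      let ?u = "u(r - p := b (r - p) * inverse ?R)"
      have R: "?R $ 0 \<noteq> 0" using u(1) by (intro fps_prod_unit)
      have "prod ?u (P q) = b q" if q: "q \<in> {1..r}" "r < q + Suc p" for q
      proof (cases "q = r - p")
        case eq: True
        have "q \<in> P q" using tri q(1) by (auto simp: triangular_def)
        then have "prod ?u (P q) = ?u q * prod ?u (P q - {q})"
          by (intro prod.remove triangular_sum(3)[OF tri q(1)])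
        also have "prod ?u (P q - {q}) = ?R" using eq by (intro prod.cong) auto
        finally show ?thesis using eq R by (simp add: mult.assoc inverse_mult_eq_1)
      next
        case False
        have "r - p < q" using q(2) False by linarith
        moreover have "P q \<subseteq> {q..r}" using tri q(1) unfolding triangular_def by blast
        ultimately have "r - p \<notin> P q" by auto
        then have "prod ?u (P q) = prod u (P q)" by (intro prod.cong) auto
        then show ?thesis using u(2)[OF q(1)] q False by auto
      qed
      moreover have "?u s $ 0 \<noteq> 0" for s using u(1) R b[of "r - p"] True by auto
      ultimately show ?thesis by blast
    next
      case False
      then show ?thesis using u by (intro exI[of _ u]) auto
    qed
  qed
  from this[of "Suc r"] show ?thesis by auto
qed

lemma triangular_prod_cong:
  assumes tri: "triangular P r" and unit: "\<And>s. u s $ 0 \<noteq> (0 :: 'k::field)" "\<And>s. u' s $ 0 \<noteq> 0"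
    and eq: "\<And>q. q \<in> {1..r} \<Longrightarrow> fps_cong N (prod u (P q)) (prod u' (P q))" and "q \<in> {1..r}"
  shows "fps_cong N (u q) (u' q)"
  using assms(5)
proof (induction rule: downward_induct)
  case (step q)
  have "q \<in> P q" using tri step(1) by (auto simp: triangular_def)
  then have rem: "prod w (P q) = w q * prod w (P q - {q})" for w :: "nat \<Rightarrow> 'k fps"
    by (intro prod.remove triangular_sum(3)[OF tri step(1)])
  have "fps_cong N (prod u (P q - {q})) (prod u' (P q - {q}))"
    using triangular_sum(2)[OF tri step(1)] step by (intro fps_cong_prod) auto
  moreover have "fps_cong N (u q * prod u (P q - {q})) (u' q * prod u' (P q - {q}))"
    using eq[OF step(1)] by (simp only: rem[of u] rem[of u'])
  moreover have "prod u (P q - {q}) $ 0 \<noteq> 0" using unit(1) by (rule fps_prod_unit)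
  ultimately show ?case using fps_cong_cancel by blast
qed

text \<open>The right-hand sides see the unknowns only up to an additional factor \<open>t\<close>, so that iterating
  improves the solution by one power of \<open>t\<close> at a time.\<close>

lemma triangular_prod_fixed_point:
  fixes G :: "(nat \<Rightarrow> 'k::field fps) \<Rightarrow> nat \<Rightarrow> 'k fps"
  assumes tri: "triangular P r"
    and unit: "\<And>u q. (\<And>s. u s $ 0 \<noteq> 0) \<Longrightarrow> q \<in> {1..r} \<Longrightarrow> G u q $ 0 \<noteq> 0"
    and contr: "\<And>u u' q N. (\<And>s. u s $ 0 \<noteq> 0) \<Longrightarrow> (\<And>s. u' s $ 0 \<noteq> 0) \<Longrightarrow>
      (\<And>s. s \<in> {1..r} \<Longrightarrow> fps_cong N (u s) (u' s)) \<Longrightarrow> q \<in> {1..r} \<Longrightarrow> fps_cong (Suc N) (G u q) (G u' q)"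
  shows "\<exists>u. (\<forall>s. u s $ 0 \<noteq> 0) \<and> (\<forall>q\<in>{1..r}. prod u (P q) = G u q)"
proof -
  have "\<exists>u'. (\<forall>s. u' s $ 0 \<noteq> 0) \<and> (\<forall>q\<in>{1..r}. prod u' (P q) = G u q)" if "\<forall>s. u s $ 0 \<noteq> 0" for u
    using triangular_prod_solvable[OF tri, of "G u"] unit that by blast
  then obtain sol where sol: "\<And>u. \<forall>s. u s $ 0 \<noteq> 0 \<Longrightarrow> \<forall>s. sol u s $ 0 \<noteq> 0"
    "\<And>u q. \<forall>s. u s $ 0 \<noteq> 0 \<Longrightarrow> q \<in> {1..r} \<Longrightarrow> prod (sol u) (P q) = G u q" by metis
  define it where "it N = (sol ^^ N) (\<lambda>_. 1)" for N
  have it0: "it 0 = (\<lambda>_. 1)" and itS: "it (Suc N) = sol (it N)" for N by (simp_all add: it_def)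
  have itu: "\<forall>s. it N s $ 0 \<noteq> 0" for N
    by (induction N) (simp_all add: it0 itS sol(1))
  have step: "\<forall>s\<in>{1..r}. fps_cong N (it (Suc N) s) (it N s)" for N
  proof (induction N)
    case (Suc N)
    show ?case
    proof
      fix s assume s: "s \<in> {1..r}"
      have "fps_cong (Suc N) (G (it (Suc N)) q) (G (it N) q)" if "q \<in> {1..r}" for q
        using contr[of "it (Suc N)" "it N" N q] itu Suc that by blast
      then have "fps_cong (Suc N) (prod (sol (it (Suc N))) (P q)) (prod (sol (it N)) (P q))" if "q \<in> {1..r}" for q
        using that sol(2) itu by simp
      then have "fps_cong (Suc N) (sol (it (Suc N)) s) (sol (it N) s)"
        by (rule triangular_prod_cong[OF tri spec[OF sol(1)[OF itu]] spec[OF sol(1)[OF itu]] _ s])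
      then show "fps_cong (Suc N) (it (Suc (Suc N)) s) (it (Suc N) s)"
        using itS[of "Suc N"] itS[of N] by simp
    qed
  qed simp
  have later: "fps_cong N (it (N + d) s) (it N s)" if "s \<in> {1..r}" for N d s
  proof (induction d)
    case (Suc d)
    then show ?case using step[of "N + d"] that fps_cong_trans fps_cong_mono[of "N + d"]
      by (metis add_Suc_right le_add1)
  qed simp
  define u where "u s = (if s \<in> {1..r} then Abs_fps (\<lambda>m. it (Suc m) s $ m) else 1)" for s
  have u: "fps_cong N (u s) (it N s)" if s: "s \<in> {1..r}" for N s
    unfolding fps_cong_iff
  proof (intro allI impI)
    fix m assume "m < N"
    then have "it (Suc m + (N - Suc m)) s $ m = it (Suc m) s $ m"
      using later[OF s, of "Suc m" "N - Suc m"] unfolding fps_cong_iff by blast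
    then show "u s $ m = it N s $ m" using s \<open>m < N\<close> by (simp add: u_def)
  qed
  have uu: "u s $ 0 \<noteq> 0" for s using itu[of "Suc 0"] by (simp add: u_def)
  have "prod u (P q) = G u q" if q: "q \<in> {1..r}" for q
  proof -
    have sub: "P q \<subseteq> {1..r}" using tri q unfolding triangular_def by fastforce
    have "fps_cong (Suc N) (prod u (P q)) (G u q)" for N
    proof -
      have "fps_cong (Suc N) (prod u (P q)) (prod (it (Suc N)) (P q))"
        using u sub by (intro fps_cong_prod) blast
      moreover have "prod (it (Suc N)) (P q) = G (it N) q" using sol(2) itu q by (simp add: itS)
      moreover have "fps_cong (Suc N) (G (it N) q) (G u q)"
        using contr[of "it N" u N q] itu uu u fps_cong_sym q by blast
      ultimately show ?thesis using fps_cong_trans by metis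
    qed
    then have "prod u (P q) $ m = G u q $ m" for m unfolding fps_cong_iff by blast
    then show ?thesis by (rule fps_ext)
  qed
  then show ?thesis using uu by blast
qed

section \<open>A universal family of marked lines\<close>

text \<open>The sets \<open>D s\<close> are the parts of a rooted tree below its edges, and \<open>h a\<close> is the vertex of leg \<open>a\<close>. Every vertex
  carries a coordinate, in which the edges and legs leaving it downwards are attached at the points
  \<open>edge_pt\<close> and \<open>leg_pt\<close>; passing down an edge \<open>s\<close> rescales the coordinate by its smoothing parameter
  \<open>tau u s\<close>, of valuation \<open>len s\<close>.\<close>

locale marked_tree_family =
  fixes I :: "nat set" and D :: "nat \<Rightarrow> nat set" and h :: "nat \<Rightarrow> nat" and len :: "nat \<Rightarrow> nat"
  assumes fin: "finite I" "\<And>s. s \<in> I \<Longrightarrow> finite (D s)" and inj: "inj_on D I"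
    and laminar: "\<And>s t. s \<in> I \<Longrightarrow> t \<in> I \<Longrightarrow> D s \<inter> D t = {} \<or> D s \<subseteq> D t \<or> D t \<subseteq> D s"
    and len: "\<And>s. s \<in> I \<Longrightarrow> len s \<ge> 1"
begin

abbreviation below :: "nat \<Rightarrow> nat \<Rightarrow> bool" where
  "below s a \<equiv> h a \<in> D s"

definition sep_from :: "nat \<Rightarrow> nat \<Rightarrow> nat set" where
  "sep_from a b = {s \<in> I. below s a \<and> \<not> below s b}"

definition tau :: "(nat \<Rightarrow> 'k fps) \<Rightarrow> nat \<Rightarrow> 'k::field fps" where
  "tau u s = u s * fps_X ^ len s"

text \<open>Even and odd numbers keep the points of legs and edges apart, as the characteristic is zero.\<close>

definition leg_pt :: "nat \<Rightarrow> 'k::field fps" where "leg_pt a = of_nat (2 * a)"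
definition edge_pt :: "nat \<Rightarrow> 'k::field fps" where "edge_pt s = of_nat (2 * s + 1)"

definition position :: "(nat \<Rightarrow> 'k fps) \<Rightarrow> nat \<Rightarrow> 'k::field fps" where
  "position u a = leg_pt a * (\<Prod>t | t \<in> I \<and> below t a. tau u t) +
     (\<Sum>s | s \<in> I \<and> below s a. edge_pt s * (\<Prod>t | t \<in> I \<and> D s \<subset> D t. tau u t))"

definition common :: "(nat \<Rightarrow> 'k fps) \<Rightarrow> nat \<Rightarrow> nat \<Rightarrow> 'k::field fps" where
  "common u a b = (\<Prod>t | t \<in> I \<and> below t a \<and> below t b. tau u t)"

definition local_pos :: "(nat \<Rightarrow> 'k fps) \<Rightarrow> nat \<Rightarrow> nat \<Rightarrow> 'k::field fps" where
  "local_pos u a b = leg_pt a * (\<Prod>t\<in>sep_from a b. tau u t) +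
     (\<Sum>s\<in>sep_from a b. edge_pt s * (\<Prod>t | t \<in> sep_from a b \<and> D s \<subset> D t. tau u t))"

definition local_diff :: "(nat \<Rightarrow> 'k fps) \<Rightarrow> nat \<Rightarrow> nat \<Rightarrow> 'k::field fps" where
  "local_diff u a b = local_pos u a b - local_pos u b a"

lemma fin_sep [simp]: "finite (sep_from a b)"
  using fin by (simp add: sep_from_def)

text \<open>Below the vertex where \<open>a\<close> and \<open>b\<close> part, all terms carry the factor \<open>common u a b\<close>.\<close>

lemma position_split:
  "position u a = (\<Sum>s | s \<in> I \<and> below s a \<and> below s b. edge_pt s * (\<Prod>t | t \<in> I \<and> D s \<subset> D t. tau u t))
     + common u a b * local_pos u a b"
proof -
  have 1: "(\<Prod>t | t \<in> I \<and> below t a. tau u t) = common u a b * (\<Prod>t\<in>sep_from a b. tau u t)"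
    unfolding common_def sep_from_def using fin
    by (subst prod.union_disjoint[symmetric]) (auto intro!: prod.cong)
  have 2: "(\<Prod>t | t \<in> I \<and> D s \<subset> D t. tau u t) =
      common u a b * (\<Prod>t | t \<in> sep_from a b \<and> D s \<subset> D t. tau u t)" if s: "s \<in> sep_from a b" for s
  proof -
    have s': "s \<in> I" "below s a" "\<not> below s b" using s by (auto simp: sep_from_def)
    have "{t. t \<in> I \<and> D s \<subset> D t} = {t. t \<in> I \<and> below t a \<and> below t b} \<union> {t. t \<in> sep_from a b \<and> D s \<subset> D t}"
      using s' laminar[OF s'(1)] by (fastforce simp: sep_from_def)
    then show ?thesis unfolding common_def using fin
      by (simp, subst prod.union_disjoint) (auto simp: sep_from_def)
  qed
  have "{s. s \<in> I \<and> below s a} = {s. s \<in> I \<and> below s a \<and> below s b} \<union> sep_from a b"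
    by (auto simp: sep_from_def)
  then have "(\<Sum>s | s \<in> I \<and> below s a. edge_pt s * (\<Prod>t | t \<in> I \<and> D s \<subset> D t. tau u t)) =
      (\<Sum>s | s \<in> I \<and> below s a \<and> below s b. edge_pt s * (\<Prod>t | t \<in> I \<and> D s \<subset> D t. tau u t)) +
      (\<Sum>s\<in>sep_from a b. edge_pt s * (\<Prod>t | t \<in> I \<and> D s \<subset> D t. tau u t))"
    using fin by (simp, subst sum.union_disjoint) (auto simp: sep_from_def)
  also have "(\<Sum>s\<in>sep_from a b. edge_pt s * (\<Prod>t | t \<in> I \<and> D s \<subset> D t. tau u t)) =
      common u a b * (\<Sum>s\<in>sep_from a b. edge_pt s * (\<Prod>t | t \<in> sep_from a b \<and> D s \<subset> D t. tau u t))"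
    unfolding sum_distrib_left using 2 by (intro sum.cong) (simp_all add: mult_ac)
  finally show ?thesis unfolding position_def local_pos_def 1 by (simp add: algebra_simps)
qed

lemma common_sym: "common u a b = common u b a"
  unfolding common_def by (intro prod.cong) auto

lemma position_diff: "position u a - position u b = common u a b * local_diff u a b"
proof -
  have "(\<Sum>s | s \<in> I \<and> below s b \<and> below s a. edge_pt s * (\<Prod>t | t \<in> I \<and> D s \<subset> D t. tau u t)) =
     (\<Sum>s | s \<in> I \<and> below s a \<and> below s b. edge_pt s * (\<Prod>t | t \<in> I \<and> D s \<subset> D t. tau u t))"
    by (intro sum.cong) auto
  then show ?thesis
    using position_split[of u a b] position_split[of u b a] common_sym[of u b a]
    by (simp add: local_diff_def algebra_simps)
qed

text \<open>At \<open>t = 0\<close>, the local coordinate is the attaching point of the first edge or leg on the way to \<open>a\<close>.\<close>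

lemma local_pos_nth_0:
  "local_pos u a b $ 0 = leg_pt a $ 0 \<or> (\<exists>s\<in>sep_from a b. local_pos u a b $ 0 = edge_pt s $ 0)"
proof -
  let ?F = "sep_from a b"
  have t0: "tau u t $ 0 = 0" if "t \<in> ?F" for t
    using that len[of t] by (simp add: tau_def sep_from_def)
  have prod0: "(\<Prod>t\<in>T. tau u t) $ 0 = (if T = {} then 1 else 0)" if "T \<subseteq> ?F" for T
  proof (cases "T = {}")
    case False
    then have "(\<Prod>t\<in>T. tau u t $ 0) = 0"
      using that t0 finite_subset[OF that] by (intro prod_zero) auto
    then show ?thesis using False by (simp add: fps_prod_nth_0)
  qed simp
  have eq: "local_pos u a b $ 0 = leg_pt a $ 0 * (if ?F = {} then 1 else 0) +
      (\<Sum>s\<in>?F. edge_pt s $ 0 * (if {t. t \<in> ?F \<and> D s \<subset> D t} = {} then 1 else 0))"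
    unfolding local_pos_def by (subst prod0[symmetric], simp)+ (simp add: fps_sum_nth)
  show ?thesis
  proof (cases "?F = {}")
    case True
    then show ?thesis using eq by simp
  next
    case False
    have finD: "finite (D ` ?F)" "D ` ?F \<noteq> {}" using False by auto
    obtain M where M: "M \<in> D ` ?F" "\<forall>b\<in>D ` ?F. M \<subseteq> b \<longrightarrow> M = b"
      using finite_has_maximal[OF finD] by blast
    then obtain s where s1: "s \<in> ?F" "M = D s" by blast
    have s2: "\<not> D s \<subset> D t" if "t \<in> ?F" for t
      using M(2) that unfolding s1(2) by (metis imageI psubset_eq)
    note s = s1(1) s2
    have max: "{t. t \<in> ?F \<and> D s' \<subset> D t} = {} \<longleftrightarrow> s' = s" if s': "s' \<in> ?F" for s'
    proof
      assume m: "{t. t \<in> ?F \<and> D s' \<subset> D t} = {}"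
      have "h a \<in> D s \<inter> D s'" "s \<in> I" "s' \<in> I" using s s' by (auto simp: sep_from_def)
      then have "D s = D s'" using laminar[of s s'] m s s' by blast
      then show "s' = s" using inj \<open>s \<in> I\<close> \<open>s' \<in> I\<close> by (auto dest: inj_onD)
    qed (use s in blast)
    have "(\<Sum>s'\<in>?F. edge_pt s' $ 0 * (if {t. t \<in> ?F \<and> D s' \<subset> D t} = {} then 1 else 0)) =
        (\<Sum>s'\<in>?F. if s' = s then edge_pt s $ 0 else (0 :: 'a))"
      using max by (intro sum.cong) auto
    also have "\<dots> = edge_pt s $ 0" using s(1) by simp
    finally show ?thesis using eq False s(1) by auto
  qed
qed

lemma local_diff_unit:
  fixes u :: "nat \<Rightarrow> 'k::field_char_0 fps"
  assumes "a \<noteq> b"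
  shows "local_diff u a b $ 0 \<noteq> 0"
proof
  have l: "leg_pt a $ 0 = (of_nat (2 * a) :: 'k)" "edge_pt s $ 0 = (of_nat (2 * s + 1) :: 'k)" for a s
    unfolding leg_pt_def edge_pt_def fps_of_nat[symmetric] by simp_all
  have disj: "sep_from a b \<inter> sep_from b a = {}" by (auto simp: sep_from_def)
  define codes where "codes a b = {2 * a} \<union> {2 * s + 1 | s. s \<in> sep_from a b}" for a b
  have ex: "\<exists>x\<in>codes a b. local_pos u a b $ 0 = of_nat x" for a b
    using local_pos_nth_0[of u a b] unfolding l codes_def by blast
  assume "local_diff u a b $ 0 = 0"
  then have "local_pos u a b $ 0 = local_pos u b a $ 0" by (simp add: local_diff_def)
  then obtain x where "x \<in> codes a b" "x \<in> codes b a"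
    using ex[of a b] ex[of b a] by (metis of_nat_eq_iff)
  then show False using assms disj unfolding codes_def by auto presburger+
qed

lemma local_diff_cong:
  assumes u: "\<And>s. s \<in> I \<Longrightarrow> fps_cong N (u s) (u' s)"
  shows "fps_cong (Suc N) (local_diff u a b) (local_diff u' a b)"
proof -
  have t: "fps_cong (Suc N) (tau u s) (tau u' s)" if "s \<in> I" for s
    using fps_cong_mono[OF fps_cong_X_mult[OF u[OF that], of "len s"], of "Suc N"] len[OF that]
    by (simp add: tau_def mult.commute)
  have "fps_cong (Suc N) (local_pos u a b) (local_pos u' a b)" for a b
    unfolding local_pos_def
    by (intro fps_cong_add fps_cong_mult fps_cong_sum fps_cong_prod fps_cong_refl t) (auto simp: sep_from_def)
  then show ?thesis unfolding local_diff_def by (intro fps_cong_minus)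
qed

end

context marked_tree_family
begin

definition quartets :: "nat \<Rightarrow> nat \<Rightarrow> nat \<Rightarrow> nat \<Rightarrow> nat set" where
  "quartets i a j b = {s \<in> I. quartet below s i a j b}"

lemma fin_quartets [simp]: "finite (quartets i a j b)"
  using fin by (simp add: quartets_def)

lemma prod_tau: "(\<Prod>t\<in>T. tau u t) = prod u T * fps_X ^ (\<Sum>t\<in>T. len t)"
  by (simp add: tau_def prod.distrib power_sum)

text \<open>Both sides are products over all edges, and an edge contributes to them according to its side of the four
  legs: this is the cross ratio of the four points, to leading order.\<close>

lemma common_cross:
  "common u \<alpha> j * common u l i * (\<Prod>t\<in>quartets i \<alpha> j l. tau u t) =
   common u \<alpha> i * common u l j * (\<Prod>t\<in>quartets i l j \<alpha>. tau u t)"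
proof -
  have ind: "(\<Prod>t | t \<in> I \<and> R t. tau u t) = (\<Prod>t\<in>I. if R t then tau u t else 1)" for R
    using fin by (simp add: prod.inter_filter)
  show ?thesis unfolding common_def quartets_def ind prod.distrib[symmetric]
  proof (intro prod.cong refl)
    fix s
    show "(if below s \<alpha> \<and> below s j then tau u s else 1) * (if below s l \<and> below s i then tau u s else 1) *
          (if quartet below s i \<alpha> j l then tau u s else 1) =
        (if below s \<alpha> \<and> below s i then tau u s else 1) * (if below s l \<and> below s j then tau u s else 1) *
          (if quartet below s i l j \<alpha> then tau u s else 1)"
      by (cases "below s \<alpha>"; cases "below s l"; cases "below s i"; cases "below s j"; simp add: quartet_def)
  qed
qed

lemma position_diff_subdegree:
  fixes u :: "nat \<Rightarrow> 'k::field_char_0 fps"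
  assumes u: "\<And>s. u s $ 0 \<noteq> 0" and "a \<noteq> b"
  shows "position u a - position u b \<noteq> 0"
    "subdegree (position u a - position u b) = (\<Sum>t | t \<in> I \<and> below t a \<and> below t b. len t)"
proof -
  let ?T = "{t. t \<in> I \<and> below t a \<and> below t b}"
  have p0: "prod u ?T $ 0 \<noteq> 0" using u by (rule fps_prod_unit)
  then have p: "prod u ?T \<noteq> 0" by auto
  have w0: "local_diff u a b $ 0 \<noteq> 0" using local_diff_unit[OF assms(2)] .
  then have w: "local_diff u a b \<noteq> 0" by auto
  have eq: "position u a - position u b = prod u ?T * fps_X ^ (\<Sum>t\<in>?T. len t) * local_diff u a b"
    unfolding position_diff common_def prod_tau ..
  show "position u a - position u b \<noteq> 0" unfolding eq using p w by simp
  show "subdegree (position u a - position u b) = (\<Sum>t\<in>?T. len t)"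
    unfolding eq using p w p0 w0 by (simp add: subdegree_eq_0)
qed

text \<open>All summands of an equation are multiples of the leading part of the summand \<open>l\<close>. The factor is a unit times
  \<open>t^d\<close>, where \<open>d\<close> is the excess of the valuation of the summand.\<close>

lemma weighted_coordinate:
  fixes u :: "nat \<Rightarrow> 'k::field_char_0 fps"
  assumes u: "\<And>s. u s $ 0 \<noteq> 0" and ne: "\<alpha> \<noteq> i" "\<alpha> \<noteq> j" "l \<noteq> i" "l \<noteq> j"
    and ex: "\<alpha> * C + (\<Sum>t\<in>quartets i l j \<alpha>. len t) = l * C + d + (\<Sum>t\<in>quartets i \<alpha> j l. len t)"
  shows "fls_X ^ (\<alpha> * C) * ((fps_to_fls (position u \<alpha>) - fps_to_fls (position u j)) /
          (fps_to_fls (position u \<alpha>) - fps_to_fls (position u i))) =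
     fls_X ^ (l * C) * (fps_to_fls (common u l j) / fps_to_fls (common u l i)) *
       fps_to_fls (fps_X ^ d * (prod u (quartets i l j \<alpha>) * inverse (prod u (quartets i \<alpha> j l))) *
         (local_diff u \<alpha> j * inverse (local_diff u \<alpha> i)))"
proof -
  let ?F = "fps_to_fls :: 'k fps \<Rightarrow> 'k fls"
  let ?U1 = "prod u (quartets i l j \<alpha>)" and ?U2 = "prod u (quartets i \<alpha> j l)"
  let ?n1 = "\<Sum>t\<in>quartets i l j \<alpha>. len t" and ?n2 = "\<Sum>t\<in>quartets i \<alpha> j l. len t"
  have U2: "?U2 $ 0 \<noteq> 0" using u by (rule fps_prod_unit)
  have W: "local_diff u \<alpha> i $ 0 \<noteq> 0" using local_diff_unit[OF ne(1)] .
  have cne: "common u a b \<noteq> 0" if "a \<noteq> b" for a b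
    using position_diff_subdegree(1)[OF u that] unfolding position_diff by auto
  have "fps_X ^ ?n2 * (fps_X ^ (\<alpha> * C) * (common u \<alpha> j * common u l i * ?U2)) =
      fps_X ^ (\<alpha> * C) * (common u \<alpha> j * common u l i * (?U2 * fps_X ^ ?n2))" by (simp add: mult_ac)
  also have "common u \<alpha> j * common u l i * (?U2 * fps_X ^ ?n2) = common u \<alpha> i * common u l j * (?U1 * fps_X ^ ?n1)"
    using common_cross[of u \<alpha> j l i] unfolding prod_tau .
  also have "fps_X ^ (\<alpha> * C) * (common u \<alpha> i * common u l j * (?U1 * fps_X ^ ?n1)) =
     fps_X ^ (\<alpha> * C + ?n1) * (common u \<alpha> i * common u l j * ?U1)" by (simp add: mult_ac power_add)
  also have "\<dots> = fps_X ^ ?n2 * (fps_X ^ (l * C) * fps_X ^ d * (common u \<alpha> i * common u l j * ?U1))"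
    unfolding ex by (simp add: mult_ac power_add)
  finally have "fps_X ^ (\<alpha> * C) * (common u \<alpha> j * common u l i * ?U2) =
      fps_X ^ (l * C) * fps_X ^ d * (common u \<alpha> i * common u l j * ?U1)" by simp
  from arg_cong[OF this, of fps_to_fls] have key: "fls_X ^ (\<alpha> * C) * (?F (common u \<alpha> j) * ?F (common u l i) * ?F ?U2) =
      fls_X ^ (l * C) * fls_X ^ d * (?F (common u \<alpha> i) * ?F (common u l j) * ?F ?U1)"
    by (simp only: fps_to_fls_power fps_X_to_fls fls_times_fps_to_fls)
  have nz: "?F (common u \<alpha> i) \<noteq> 0" "?F (common u l i) \<noteq> 0" "?F ?U2 \<noteq> 0" "?F (local_diff u \<alpha> i) \<noteq> 0"
  proof -
    have "?U2 \<noteq> 0" "local_diff u \<alpha> i \<noteq> 0" using U2 W by (metis fps_zero_nth)+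
    then show "?F (common u \<alpha> i) \<noteq> 0" "?F (common u l i) \<noteq> 0" "?F ?U2 \<noteq> 0" "?F (local_diff u \<alpha> i) \<noteq> 0"
      unfolding fps_to_fls_eq_0_iff using cne ne by blast+
  qed
  have inv: "?F (inverse ?U2) = inverse (?F ?U2)" "?F (inverse (local_diff u \<alpha> i)) = inverse (?F (local_diff u \<alpha> i))"
    using fls_inverse_fps_to_fls[OF subdegree_eq_0, OF U2] fls_inverse_fps_to_fls[OF subdegree_eq_0, OF W] by simp_all
  have lhs: "(?F (position u \<alpha>) - ?F (position u j)) / (?F (position u \<alpha>) - ?F (position u i)) =
      (?F (common u \<alpha> j) * ?F (local_diff u \<alpha> j)) / (?F (common u \<alpha> i) * ?F (local_diff u \<alpha> i))"
    by (simp add: position_diff fls_times_fps_to_fls flip: fps_to_fls_minus)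
  have rhs: "?F (fps_X ^ d * (?U1 * inverse ?U2) * (local_diff u \<alpha> j * inverse (local_diff u \<alpha> i))) =
      fls_X ^ d * (?F ?U1 / ?F ?U2) * (?F (local_diff u \<alpha> j) / ?F (local_diff u \<alpha> i))"
    by (simp add: fls_times_fps_to_fls fps_to_fls_power fps_X_to_fls inv divide_inverse)
  have alg: "x * ((a * w) / (b * v)) = y * (c / e) * (z * (p / g) * (w / v))"
    if "x * (a * e * g) = y * z * (b * c * p)" "b \<noteq> 0" "e \<noteq> 0" "g \<noteq> 0" "v \<noteq> 0"
    for x a w b v y c e z p g :: "'k fls"
    using that by (simp add: frac_eq_eq mult_ac)
  show ?thesis unfolding lhs rhs by (rule alg[OF key nz])
qed

text \<open>Dividing equation \<open>q\<close> by its term \<open>l q\<close> leaves two terms of valuation zero, and the quotient of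
  these is the product of the \<open>u s\<close> over the edges between the projections of \<open>k q\<close> and \<open>l q\<close>.\<close>

lemma exists_solution:
  fixes A :: "nat \<Rightarrow> nat set" and i j k l C :: "nat \<Rightarrow> nat" and d :: "nat \<Rightarrow> nat \<Rightarrow> nat"
  assumes I: "I = {1..r}" and tri: "triangular (\<lambda>q. quartets (i q) (l q) (j q) (k q)) r"
    and A: "\<And>q. q \<in> {1..r} \<Longrightarrow> finite (A q) \<and> i q \<notin> A q \<and> j q \<notin> A q \<and> k q \<in> A q \<and> l q \<in> A q \<and> k q \<noteq> l q"
    and none: "\<And>q. q \<in> {1..r} \<Longrightarrow> quartets (i q) (k q) (j q) (l q) = {}"
    and ex: "\<And>q \<alpha>. q \<in> {1..r} \<Longrightarrow> \<alpha> \<in> A q \<Longrightarrow>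
       \<alpha> * C q + (\<Sum>t\<in>quartets (i q) (l q) (j q) \<alpha>. len t) = l q * C q + d q \<alpha> + (\<Sum>t\<in>quartets (i q) \<alpha> (j q) (l q). len t)"
    and d: "\<And>q \<alpha>. q \<in> {1..r} \<Longrightarrow> \<alpha> \<in> A q \<Longrightarrow> d q \<alpha> = 0 \<longleftrightarrow> \<alpha> = k q \<or> \<alpha> = l q"
  shows "\<exists>u :: nat \<Rightarrow> 'k::field_char_0 fps. (\<forall>s. u s $ 0 \<noteq> 0) \<and>
     (\<forall>q\<in>{1..r}. (\<Sum>\<alpha>\<in>A q. fls_X ^ (\<alpha> * C q) * ((fps_to_fls (position u \<alpha>) - fps_to_fls (position u (j q))) /
          (fps_to_fls (position u \<alpha>) - fps_to_fls (position u (i q))))) = 0)"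
proof -
  define E :: "(nat \<Rightarrow> 'k fps) \<Rightarrow> nat \<Rightarrow> nat \<Rightarrow> 'k fps" where
    "E u q \<alpha> = fps_X ^ d q \<alpha> * (prod u (quartets (i q) (l q) (j q) \<alpha>) * inverse (prod u (quartets (i q) \<alpha> (j q) (l q)))) *
         (local_diff u \<alpha> (j q) * inverse (local_diff u \<alpha> (i q)))" for u q \<alpha>
  define G :: "(nat \<Rightarrow> 'k fps) \<Rightarrow> nat \<Rightarrow> 'k fps" where
    "G u q = - (local_diff u (k q) (i q) * inverse (local_diff u (k q) (j q)) * (\<Sum>\<alpha>\<in>A q - {k q}. E u q \<alpha>))" for u q
  have W: "local_diff u a b $ 0 \<noteq> 0" if "a \<noteq> b" for u :: "nat \<Rightarrow> 'k fps" and a b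
    using local_diff_unit[OF that] .
  have ll: "quartets (i q) (l q) (j q) (l q) = {}" for q by (auto simp: quartets_def quartet_def)
  have "\<exists>u. (\<forall>s. u s $ 0 \<noteq> 0) \<and> (\<forall>q\<in>{1..r}. prod u (quartets (i q) (l q) (j q) (k q)) = G u q)"
  proof (rule triangular_prod_fixed_point[OF tri])
    fix u :: "nat \<Rightarrow> 'k fps" and q assume u: "\<And>s. u s $ 0 \<noteq> 0" and q: "q \<in> {1..r}"
    have ne: "k q \<noteq> i q" "k q \<noteq> j q" "l q \<noteq> i q" "l q \<noteq> j q" and lA: "l q \<in> A q - {k q}" and fA: "finite (A q - {k q})"
      using A[OF q] by auto
    have "E u q \<alpha> $ 0 = 0" if "\<alpha> \<in> A q - {k q} - {l q}" for \<alpha>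
      using d[OF q, of \<alpha>] that by (simp add: E_def)
    then have "(\<Sum>\<alpha>\<in>A q - {k q}. E u q \<alpha>) $ 0 = E u q (l q) $ 0"
      using fA lA by (simp add: fps_sum_nth sum.remove[OF fA lA])
    also have "\<dots> \<noteq> 0" using d[OF q, of "l q"] A[OF q] W ne by (simp add: E_def ll)
    finally show "G u q $ 0 \<noteq> 0" unfolding G_def using W[OF ne(1)] W[OF ne(2)] by simp
  next
    fix u u' :: "nat \<Rightarrow> 'k fps" and q N
    assume u: "\<And>s. u s $ 0 \<noteq> 0" "\<And>s. u' s $ 0 \<noteq> 0"
      and c: "\<And>s. s \<in> {1..r} \<Longrightarrow> fps_cong N (u s) (u' s)" and q: "q \<in> {1..r}"
    have ldc: "fps_cong (Suc N) (local_diff u a b) (local_diff u' a b)" for a b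
      using c I by (intro local_diff_cong) simp
    have ratio: "fps_cong (Suc N) (local_diff u \<alpha> a * inverse (local_diff u \<alpha> b)) (local_diff u' \<alpha> a * inverse (local_diff u' \<alpha> b))"
      if "\<alpha> \<noteq> b" for \<alpha> a b
      using W that by (intro fps_cong_mult ldc fps_cong_inverse)
    have "fps_cong (Suc N) (E u q \<alpha>) (E u' q \<alpha>)" if \<alpha>: "\<alpha> \<in> A q - {k q}" for \<alpha>
    proof (cases "\<alpha> = l q")
      case True
      have "l q \<noteq> i q" using A[OF q] by metis
      then show ?thesis unfolding E_def True ll by (intro fps_cong_mult[OF _ ratio]) simp_all
    next
      case False
      have "\<alpha> \<noteq> i q" using A[OF q] \<alpha> by auto
      moreover have "d q \<alpha> \<ge> 1" using d[OF q] \<alpha> False by (metis Diff_iff One_nat_def Suc_leI gr0I insertI1)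
      moreover have "fps_cong N (prod u T) (prod u' T)" if "T \<subseteq> I" for T
        using c that I by (intro fps_cong_prod) auto
      then have "fps_cong N (prod u (quartets (i q) (l q) (j q) \<alpha>) * inverse (prod u (quartets (i q) \<alpha> (j q) (l q))))
          (prod u' (quartets (i q) (l q) (j q) \<alpha>) * inverse (prod u' (quartets (i q) \<alpha> (j q) (l q))))"
        using u by (intro fps_cong_mult fps_cong_inverse fps_prod_unit) (auto simp: quartets_def)
      then have "fps_cong (d q \<alpha> + N) (fps_X ^ d q \<alpha> * (prod u (quartets (i q) (l q) (j q) \<alpha>) * inverse (prod u (quartets (i q) \<alpha> (j q) (l q)))))
          (fps_X ^ d q \<alpha> * (prod u' (quartets (i q) (l q) (j q) \<alpha>) * inverse (prod u' (quartets (i q) \<alpha> (j q) (l q)))))"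
        by (rule fps_cong_X_mult)
      ultimately show ?thesis unfolding E_def
        by (intro fps_cong_mult[OF _ ratio]) (auto elim: fps_cong_mono)
    qed
    moreover have "k q \<noteq> j q" using A[OF q] by metis
    ultimately show "fps_cong (Suc N) (G u q) (G u' q)" unfolding G_def
      by (intro fps_cong_uminus fps_cong_mult[OF ratio] fps_cong_sum)
  qed
  then obtain u where u: "\<And>s. u s $ 0 \<noteq> 0"
    and sol: "\<And>q. q \<in> {1..r} \<Longrightarrow> prod u (quartets (i q) (l q) (j q) (k q)) = G u q" by blast
  have "(\<Sum>\<alpha>\<in>A q. fls_X ^ (\<alpha> * C q) * ((fps_to_fls (position u \<alpha>) - fps_to_fls (position u (j q))) /
          (fps_to_fls (position u \<alpha>) - fps_to_fls (position u (i q))))) = 0" if q: "q \<in> {1..r}" for q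
  proof -
    have ne: "\<alpha> \<noteq> i q" "\<alpha> \<noteq> j q" if "\<alpha> \<in> A q" for \<alpha> using A[OF q] that by auto
    have kA: "k q \<in> A q" "l q \<in> A q" "finite (A q)" using A[OF q] by auto
    have k0: "d q (k q) = 0" using d[OF q kA(1)] by simp
    have Wk: "local_diff u (k q) (i q) * inverse (local_diff u (k q) (i q)) = 1"
      "local_diff u (k q) (j q) * inverse (local_diff u (k q) (j q)) = 1"
      by (rule inverse_mult_eq_1', rule W, rule ne, rule kA(1))+
    have "E u q (k q) = G u q * (local_diff u (k q) (j q) * inverse (local_diff u (k q) (i q)))"
      unfolding E_def k0 none[OF q] sol[OF q] by simp
    also have "\<dots> = - (\<Sum>\<alpha>\<in>A q - {k q}. E u q \<alpha>) * (local_diff u (k q) (i q) * inverse (local_diff u (k q) (i q)))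
        * (local_diff u (k q) (j q) * inverse (local_diff u (k q) (j q)))"
      unfolding G_def by (simp only: mult_ac mult_minus_left mult_minus_right)
    finally have "E u q (k q) + (\<Sum>\<alpha>\<in>A q - {k q}. E u q \<alpha>) = 0" unfolding Wk by simp
    then have "(\<Sum>\<alpha>\<in>A q. E u q \<alpha>) = 0" using sum.remove[OF kA(3,1)] by metis
    moreover have "(\<Sum>\<alpha>\<in>A q. fls_X ^ (\<alpha> * C q) * ((fps_to_fls (position u \<alpha>) - fps_to_fls (position u (j q))) /
          (fps_to_fls (position u \<alpha>) - fps_to_fls (position u (i q))))) =
        (\<Sum>\<alpha>\<in>A q. fls_X ^ (l q * C q) * (fps_to_fls (common u (l q) (j q)) / fps_to_fls (common u (l q) (i q))) *
          fps_to_fls (E u q \<alpha>))"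
      unfolding E_def by (intro sum.cong refl weighted_coordinate[OF u ne ne[OF kA(2)] ex[OF q]])
    moreover have "(\<Sum>\<alpha>\<in>T. fps_to_fls (f \<alpha>)) = fps_to_fls (\<Sum>\<alpha>\<in>T. f \<alpha> :: 'k fps)" for f and T :: "nat set"
      by (induction T rule: infinite_finite_induct) auto
    ultimately show ?thesis by (simp only: sum_distrib_left[symmetric]) simp
  qed
  then show ?thesis using u by blast
qed

end

section \<open>Lifting tropical points\<close>

text \<open>The extension fields in the definition of \<open>trop\<close> have elements of type \<open>'u\<close>, so the field of Laurent series is
  copied there.\<close>

definition transported_ring :: "('a::ring_1 \<Rightarrow> 'u) \<Rightarrow> 'u ring" where
  "transported_ring h = \<lparr>carrier = range h, monoid.mult = \<lambda>x y. h (inv_into UNIV h x * inv_into UNIV h y), one = h 1,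
     ring.zero = h 0, add = \<lambda>x y. h (inv_into UNIV h x + inv_into UNIV h y)\<rparr>"

context
  fixes h :: "'k::field fls \<Rightarrow> 'u" assumes h: "inj h"
begin

lemma transported_simps [simp]:
  "carrier (transported_ring h) = range h" "\<one>\<^bsub>transported_ring h\<^esub> = h 1" "\<zero>\<^bsub>transported_ring h\<^esub> = h 0"
  "h x \<otimes>\<^bsub>transported_ring h\<^esub> h y = h (x * y)" "h x \<oplus>\<^bsub>transported_ring h\<^esub> h y = h (x + y)"
  using h by (simp_all add: transported_ring_def)

lemma transported_hom: "h \<in> ring_hom ring_of_type_algebra (transported_ring h)"
  by (auto simp: ring_hom_def ring_of_type_algebra_def)

lemma transported_field: "field (transported_ring h)"
proof -
  interpret K: field "ring_of_type_algebra :: 'k fls ring" by (rule field_from_type_algebra)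
  have "h \<in> ring_iso ring_of_type_algebra (transported_ring h)"
    unfolding ring_iso_def using transported_hom h
    by (auto simp: bij_betw_def ring_of_type_algebra_def)
  from K.ring_iso_imp_img_field[OF this] show ?thesis
    by (simp add: ring_of_type_algebra_def transported_ring_def)
qed

interpretation L: field "transported_ring h" by (rule transported_field)

lemma transported_uminus [simp]: "\<ominus>\<^bsub>transported_ring h\<^esub> h x = h (- x)"
  by (rule L.minus_equality) auto

lemma transported_minus [simp]: "h x \<ominus>\<^bsub>transported_ring h\<^esub> h y = h (x - y)"
  by (simp add: a_minus_def)

lemma transported_inverse [simp]: "x \<noteq> 0 \<Longrightarrow> inv\<^bsub>transported_ring h\<^esub> (h x) = h (inverse x)"
  by (rule L.comm_inv_char) auto

lemma transported_finsum: "finite A \<Longrightarrow> (\<Oplus>\<^bsub>transported_ring h\<^esub>a\<in>A. h (f a)) = h (\<Sum>a\<in>A. f a)"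
  by (induction A rule: finite_induct) (auto simp: L.finsum_insert)

lemma transported_extension:
  "valued_extension (transported_ring h) h (\<lambda>y. real_of_int (fls_subdegree (inv_into UNIV h y)))"
  unfolding valued_extension_def
proof (intro conjI ballI allI impI)
  fix x y assume "x \<in> carrier (transported_ring h) - {\<zero>\<^bsub>transported_ring h\<^esub>}"
    "y \<in> carrier (transported_ring h) - {\<zero>\<^bsub>transported_ring h\<^esub>}"
  then obtain a b where ab: "x = h a" "y = h b" "a \<noteq> 0" "b \<noteq> 0" by auto
  show "real_of_int (fls_subdegree (inv_into UNIV h (x \<otimes>\<^bsub>transported_ring h\<^esub> y))) =
     real_of_int (fls_subdegree (inv_into UNIV h x)) + real_of_int (fls_subdegree (inv_into UNIV h y))"
    using ab h by simp
  assume "x \<oplus>\<^bsub>transported_ring h\<^esub> y \<noteq> \<zero>\<^bsub>transported_ring h\<^esub>"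
  then have "a + b \<noteq> 0" using ab by auto
  then have "min (fls_subdegree a) (fls_subdegree b) \<le> fls_subdegree (a + b)" by (rule fls_plus_subdegree)
  then have "real_of_int (min (fls_subdegree a) (fls_subdegree b)) \<le> real_of_int (fls_subdegree (a + b))"
    unfolding of_int_le_iff .
  then show "min (real_of_int (fls_subdegree (inv_into UNIV h x))) (real_of_int (fls_subdegree (inv_into UNIV h y)))
      \<le> real_of_int (fls_subdegree (inv_into UNIV h (x \<oplus>\<^bsub>transported_ring h\<^esub> y)))"
    using ab h by (simp add: of_int_min)
qed (use transported_field transported_hom h in auto)

lemma transported_point:
  assumes inj: "inj_on Z {1..n}"
  shows "(\<lambda>a. (h (Z a), h 1)) \<in> M0n_points (transported_ring h) n"
    and "minor (transported_ring h) (\<lambda>a. (h (Z a), h 1)) a b = h (Z a - Z b)"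
proof -
  show m: "minor (transported_ring h) (\<lambda>a. (h (Z a), h 1)) a b = h (Z a - Z b)" for a b
    by (simp add: minor_def)
  have "Z a - Z b \<noteq> 0" if "a \<in> {1..n}" "b \<in> {1..n}" "a \<noteq> b" for a b
    using inj_onD[OF inj _ that(1,2)] that(3) by auto
  then show "(\<lambda>a. (h (Z a), h 1)) \<in> M0n_points (transported_ring h) n"
    by (auto simp: M0n_points_def m inj_eq[OF h])
qed

lemma transported_hypersurface:
  assumes inj: "inj_on Z {1..n}" and S: "S q \<subseteq> {1..n}" "i q \<in> S q" "j q \<in> S q" "i q \<noteq> j q"
    and sum: "(\<Sum>\<alpha>\<in>S q - {i q, j q}. fls_X ^ (\<alpha> * B ^ (n - 3 - q)) * ((Z \<alpha> - Z (j q)) / (Z \<alpha> - Z (i q)))) = 0"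
  shows "hypersurface n B S i j q (transported_ring h) h (\<lambda>a. (h (Z a), h 1))"
proof -
  let ?L = "transported_ring h"
  have ne: "Z \<alpha> \<noteq> Z \<beta>" if "\<alpha> \<in> S q" "\<beta> \<in> S q" "\<alpha> \<noteq> \<beta>" for \<alpha> \<beta>
    using inj_onD[OF inj, of \<alpha> \<beta>] that S(1) by blast
  have fin: "finite (S q - {i q, j q})" using S(1) finite_subset by blast
  have "(\<Oplus>\<^bsub>?L\<^esub>l\<in>S q - {i q, j q}. h (fls_X ^ (l * B ^ (n - 3 - q))) \<otimes>\<^bsub>?L\<^esub>
      ((h 1 \<otimes>\<^bsub>?L\<^esub> h (Z l) \<oplus>\<^bsub>?L\<^esub> h (- Z (j q)) \<otimes>\<^bsub>?L\<^esub> h 1) \<otimes>\<^bsub>?L\<^esub>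
        inv\<^bsub>?L\<^esub> (h 1 \<otimes>\<^bsub>?L\<^esub> h (Z l) \<oplus>\<^bsub>?L\<^esub> h (- Z (i q)) \<otimes>\<^bsub>?L\<^esub> h 1))) =
     (\<Oplus>\<^bsub>?L\<^esub>l\<in>S q - {i q, j q}. h (fls_X ^ (l * B ^ (n - 3 - q)) * ((Z l - Z (j q)) / (Z l - Z (i q)))))"
  proof (rule L.finsum_cong')
    fix l assume l: "l \<in> S q - {i q, j q}"
    then have "Z l - Z (i q) \<noteq> 0" using ne[of l "i q"] S by auto
    then show "h (fls_X ^ (l * B ^ (n - 3 - q))) \<otimes>\<^bsub>?L\<^esub>
      ((h 1 \<otimes>\<^bsub>?L\<^esub> h (Z l) \<oplus>\<^bsub>?L\<^esub> h (- Z (j q)) \<otimes>\<^bsub>?L\<^esub> h 1) \<otimes>\<^bsub>?L\<^esub>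
        inv\<^bsub>?L\<^esub> (h 1 \<otimes>\<^bsub>?L\<^esub> h (Z l) \<oplus>\<^bsub>?L\<^esub> h (- Z (i q)) \<otimes>\<^bsub>?L\<^esub> h 1)) =
      h (fls_X ^ (l * B ^ (n - 3 - q)) * ((Z l - Z (j q)) / (Z l - Z (i q))))"
      by (simp add: divide_inverse)
  qed auto
  also have "\<dots> = \<zero>\<^bsub>?L\<^esub>" unfolding transported_finsum[OF fin] sum by simp
  finally have s: "(\<Oplus>\<^bsub>?L\<^esub>l\<in>S q - {i q, j q}. h (fls_X ^ (l * B ^ (n - 3 - q))) \<otimes>\<^bsub>?L\<^esub>
      ((h 1 \<otimes>\<^bsub>?L\<^esub> h (Z l) \<oplus>\<^bsub>?L\<^esub> h (- Z (j q)) \<otimes>\<^bsub>?L\<^esub> h 1) \<otimes>\<^bsub>?L\<^esub>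
        inv\<^bsub>?L\<^esub> (h 1 \<otimes>\<^bsub>?L\<^esub> h (Z l) \<oplus>\<^bsub>?L\<^esub> h (- Z (i q)) \<otimes>\<^bsub>?L\<^esub> h 1))) = \<zero>\<^bsub>?L\<^esub>" .
  show ?thesis unfolding hypersurface_def Let_def
    by (intro bexI[of _ "h 1"] bexI[of _ "h (- Z (j q))"] bexI[of _ "h (- Z (i q))"] conjI)
      (use s ne[OF S(2,3,4)] in \<open>auto simp: inj_eq[OF h]\<close>)
qed

end

context hypersurfaces
begin

lemma trop_data_integral:
  assumes d: "trop_data n B S i j r \<Gamma> e k l" and q: "q \<in> {1..r}"
  shows "len \<Gamma> (e q) \<in> \<int>"
proof (rule triangular_integral[OF _ _ q, where L = "\<lambda>s. len \<Gamma> (e s)"])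
  show "triangular (\<lambda>q. {s \<in> {1..r}. quartet (\<lambda>s. cut \<Gamma> (e s)) s (i q) (l q) (j q) (k q)}) r"
    using d by (intro admissible_triangular) (auto simp: trop_data_def)
  fix q assume "q \<in> {1..r}"
  then show "(\<Sum>s | s \<in> {1..r} \<and> quartet (\<lambda>s. cut \<Gamma> (e s)) s (i q) (l q) (j q) (k q). len \<Gamma> (e s)) \<in> \<int>"
    using d unfolding trop_data_def by simp
qed

text \<open>The tree is rooted at leg \<open>1\<close>, and \<open>D s\<close> consists of the vertices below the edge \<open>e s\<close>. The valuation of a
  difference of positions is the depth of the vertex where the two legs part, which is half of the sum
  of their depths minus half of their distance.\<close>

lemma trop_data_lift:
  assumes \<Gamma>: "\<Gamma> \<in> M0n_trop n" and d: "trop_data n B S i j r \<Gamma> e k l"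
  shows "\<exists>Z :: nat \<Rightarrow> 'k::field_char_0 fls. inj_on Z {1..n} \<and>
     (\<exists>lam. \<forall>a\<in>{1..n}. \<forall>b\<in>{1..n}. a \<noteq> b \<longrightarrow>
        real_of_int (fls_subdegree (Z a - Z b)) = lam a + lam b + (- 1/2) * leg_dist \<Gamma> a b) \<and>
     (\<forall>q\<in>{1..r}. (\<Sum>\<alpha>\<in>S q - {i q, j q}. fls_X ^ (\<alpha> * B ^ (n - 3 - q)) * ((Z \<alpha> - Z (j q)) / (Z \<alpha> - Z (i q)))) = 0)"
proof -
  have st: "stable_tree n \<Gamma>" and n: "n \<ge> 1" using \<Gamma> n3 by (auto simp: M0n_trop_def)
  have tree: "is_tree (verts \<Gamma>) (edges \<Gamma>)" and V: "\<And>x. x \<in> {1..n} \<Longrightarrow> att \<Gamma> x \<in> verts \<Gamma>"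
    using st by (auto simp: stable_tree_def)
  have e: "bij_betw e {1..r} (edges \<Gamma>)" using d by (simp add: trop_data_def)
  have eE: "e s \<in> edges \<Gamma>" if "s \<in> {1..r}" for s using bij_betwE[OF e] that by blast
  have inje: "inj_on e {1..r}" using e by (simp add: bij_betw_def)
  let ?\<rho> = "att \<Gamma> 1" and ?sep = "separates (edges \<Gamma>)"
  have \<rho>: "?\<rho> \<in> verts \<Gamma>" using V n by simp
  define D where "D s = {x \<in> verts \<Gamma>. ?sep (e s) ?\<rho> x}" for s
  define ll where "ll s = nat \<lfloor>len \<Gamma> (e s)\<rfloor>" for s
  have ll: "real (ll s) = len \<Gamma> (e s)" "ll s \<ge> 1" if s: "s \<in> {1..r}" for s
  proof -
    have p: "len \<Gamma> (e s) > 0" using \<Gamma> eE[OF s] by (auto simp: M0n_trop_def)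
    obtain z where z: "len \<Gamma> (e s) = of_int z" using trop_data_integral[OF d s] by (auto elim: Ints_cases)
    show "real (ll s) = len \<Gamma> (e s)" "ll s \<ge> 1" using p z by (auto simp: ll_def)
  qed
  have side: "?sep (e s) x y \<longleftrightarrow> (x \<in> D s) \<noteq> (y \<in> D s)" if "s \<in> {1..r}" "x \<in> verts \<Gamma>" "y \<in> verts \<Gamma>" for s x y
    using separates_xor[OF tree eE[OF that(1)] that(2,3) \<rho>] that by (simp add: D_def)
  interpret fam: marked_tree_family "{1..r}" D "att \<Gamma>" ll
  proof
    show "inj_on D {1..r}"
    proof (rule inj_onI, rule ccontr)
      fix s t assume st: "s \<in> {1..r}" "t \<in> {1..r}" "D s = D t" "s \<noteq> t"
      then have ne: "e s \<noteq> e t" using inje by (auto dest: inj_onD)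
      obtain x y where xy: "e s = {x, y}" "x \<in> verts \<Gamma>" "y \<in> verts \<Gamma>" using tree_edge[OF tree eE[OF st(1)]] by blast
      have "?sep (e s) x y" using tree_bridge[OF tree, of x y] xy(1) eE[OF st(1)] by simp
      moreover have "\<not> ?sep (e t) x y" using separates_other_edge[OF tree, of x y "e t"] xy(1) ne eE[OF st(1)] by simp
      ultimately show False using side st(1,2,3) xy(2,3) by metis
    qed
    fix s t assume st: "s \<in> {1..r}" "t \<in> {1..r}"
    show "D s \<inter> D t = {} \<or> D s \<subseteq> D t \<or> D t \<subseteq> D s"
    proof (rule ccontr)
      assume no: "\<not> ?thesis"
      then have "e s \<noteq> e t" using D_def by auto
      moreover obtain x y z where xyz: "x \<in> D s" "x \<in> D t" "y \<in> D s" "y \<notin> D t" "z \<in> D t" "z \<notin> D s" using no by blast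
      moreover from xyz have xV: "x \<in> verts \<Gamma>" "y \<in> verts \<Gamma>" "z \<in> verts \<Gamma>" by (auto simp: D_def)
      moreover have "?\<rho> \<notin> D s" "?\<rho> \<notin> D t" by (simp_all add: D_def)
      ultimately show False
        using quadrant_empty[OF tree eE[OF st(1)] eE[OF st(2)] _ xV(1,2) \<rho> xV(3)] side[OF st(1)] side[OF st(2)] \<rho>
        by blast
    qed
  qed (use ll tree_finite[OF tree] in \<open>auto simp: D_def\<close>)
  let ?Y = "\<lambda>s. cut \<Gamma> (e s)" and ?L = "\<lambda>s. len \<Gamma> (e s)"
  have below: "att \<Gamma> a \<in> D s \<longleftrightarrow> ?Y s a" if "a \<in> {1..n}" for a s using V[OF that] by (simp add: D_def cut_def)
  have quartets: "fam.quartets a b c d = {s \<in> {1..r}. quartet ?Y s a b c d}"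
    if "{a, b, c, d} \<subseteq> {1..n}" for a b c d
    unfolding fam.quartets_def quartet_def using below that by auto
  have Sn: "{i q, j q} \<subseteq> {1..n}" "S q \<subseteq> {1..n}" if "q \<in> {1..r}" for q using S_legs[OF that] by auto
  have kl: "k q \<in> S q - {i q, j q}" "l q \<in> S q - {i q, j q}" "k q < l q" "quartet ?Y q (i q) (l q) (j q) (k q)"
    if "q \<in> {1..r}" for q
    using d that unfolding trop_data_def admissible_def by blast+
  have kln: "{i q, j q, k q, l q} \<subseteq> {1..n}" if "q \<in> {1..r}" for q using kl[OF that] Sn[OF that] by blast
  \<comment> \<open>The subtraction is not truncated, as \<open>l q\<close> is minimizing.\<close>
  define dd where "dd q \<alpha> = (\<alpha> * B ^ (n - 3 - q) + (\<Sum>t\<in>fam.quartets (i q) (l q) (j q) \<alpha>. ll t))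
      - (l q * B ^ (n - 3 - q) + (\<Sum>t\<in>fam.quartets (i q) \<alpha> (j q) (l q). ll t))" for q \<alpha>
  have gap: "trop_val \<Gamma> q \<alpha> - trop_val \<Gamma> q (l q) =
      real (\<alpha> * B ^ (n - 3 - q) + (\<Sum>t\<in>fam.quartets (i q) (l q) (j q) \<alpha>. ll t))
      - real (l q * B ^ (n - 3 - q) + (\<Sum>t\<in>fam.quartets (i q) \<alpha> (j q) (l q). ll t))"
    if q: "q \<in> {1..r}" and \<alpha>: "\<alpha> \<in> S q - {i q, j q}" for q \<alpha>
  proof -
    have \<alpha>n: "\<alpha> \<in> {1..n}" "l q \<in> {1..n}" using \<alpha> Sn[OF q] kln[OF q] by auto
    have r: "real (\<Sum>t\<in>fam.quartets (i q) a (j q) b. ll t) =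
        (\<Sum>s | s \<in> {1..r} \<and> quartet ?Y s (i q) a (j q) b. ?L s)" if "a \<in> {1..n}" "b \<in> {1..n}" for a b
    proof -
      have sub: "{i q, a, j q, b} \<subseteq> {1..n}" using that Sn[OF q] by blast
      show ?thesis unfolding quartets[OF sub] of_nat_sum using ll by (intro sum.cong) auto
    qed
    show ?thesis
      using split_dist_diff[of "{1..r}" ?Y ?L "i q" "j q" \<alpha> "l q"]
      unfolding trop_val_numbered[OF \<Gamma> q \<alpha>n(1) e] trop_val_numbered[OF \<Gamma> q \<alpha>n(2) e]
        of_nat_add of_nat_mult of_nat_power r[OF \<alpha>n] r[OF \<alpha>n(2,1)]
      by (simp add: scale_def)
  qed
  note minima = trop_data_minima[OF \<Gamma> d]
  have gap0: "trop_val \<Gamma> q (l q) \<le> trop_val \<Gamma> q \<alpha>" "trop_val \<Gamma> q (l q) = trop_val \<Gamma> q \<alpha> \<longleftrightarrow> \<alpha> = k q \<or> \<alpha> = l q"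
    if "q \<in> {1..r}" "\<alpha> \<in> S q - {i q, j q}" for q \<alpha>
    using minima(1)[OF that(1)] minima(2)[OF that] by (cases "\<alpha> = k q \<or> \<alpha> = l q"; force)+
  have "\<exists>u :: nat \<Rightarrow> 'k fps. (\<forall>s. u s $ 0 \<noteq> 0) \<and>
     (\<forall>q\<in>{1..r}. (\<Sum>\<alpha>\<in>S q - {i q, j q}. fls_X ^ (\<alpha> * B ^ (n - 3 - q)) *
        ((fps_to_fls (fam.position u \<alpha>) - fps_to_fls (fam.position u (j q))) /
          (fps_to_fls (fam.position u \<alpha>) - fps_to_fls (fam.position u (i q))))) = 0)"
  proof (rule fam.exists_solution[where k = k and l = l and d = dd])
    show "triangular (\<lambda>q. fam.quartets (i q) (l q) (j q) (k q)) r"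
    proof -
      have "triangular (\<lambda>q. {s \<in> {1..r}. quartet ?Y s (i q) (l q) (j q) (k q)}) r"
        using d by (intro admissible_triangular) (auto simp: trop_data_def)
      moreover have "fam.quartets (i q) (l q) (j q) (k q) = {s \<in> {1..r}. quartet ?Y s (i q) (l q) (j q) (k q)}"
        if "q \<in> {1..r}" for q using kln[OF that] by (intro quartets) auto
      ultimately show ?thesis by (simp add: triangular_def)
    qed
    fix q assume q: "q \<in> {1..r}"
    show "finite (S q - {i q, j q}) \<and> i q \<notin> S q - {i q, j q} \<and> j q \<notin> S q - {i q, j q} \<and>
        k q \<in> S q - {i q, j q} \<and> l q \<in> S q - {i q, j q} \<and> k q \<noteq> l q"
      using kl[OF q] Sn[OF q] finite_subset by auto
    have qk: "fam.quartets (i q) (k q) (j q) (l q) = {s \<in> {1..r}. quartet ?Y s (i q) (k q) (j q) (l q)}"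
      using kln[OF q] by (intro quartets) auto
    show "fam.quartets (i q) (k q) (j q) (l q) = {}"
      unfolding qk using quartet_opposed[OF numbered_compatible[OF \<Gamma> e] kln[OF q] q _ kl(4)[OF q]] by blast
    fix \<alpha> assume \<alpha>: "\<alpha> \<in> S q - {i q, j q}"
    show "\<alpha> * B ^ (n - 3 - q) + (\<Sum>t\<in>fam.quartets (i q) (l q) (j q) \<alpha>. ll t) =
       l q * B ^ (n - 3 - q) + dd q \<alpha> + (\<Sum>t\<in>fam.quartets (i q) \<alpha> (j q) (l q). ll t)"
      using gap[OF q \<alpha>] gap0(1)[OF q \<alpha>] unfolding dd_def by linarith
    show "dd q \<alpha> = 0 \<longleftrightarrow> \<alpha> = k q \<or> \<alpha> = l q"
      using gap[OF q \<alpha>] gap0[OF q \<alpha>] unfolding dd_def by linarith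
  qed simp
  then obtain u :: "nat \<Rightarrow> 'k fps" where u: "\<And>s. u s $ 0 \<noteq> 0"
    and eqs: "\<And>q. q \<in> {1..r} \<Longrightarrow> (\<Sum>\<alpha>\<in>S q - {i q, j q}. fls_X ^ (\<alpha> * B ^ (n - 3 - q)) *
        ((fps_to_fls (fam.position u \<alpha>) - fps_to_fls (fam.position u (j q))) /
          (fps_to_fls (fam.position u \<alpha>) - fps_to_fls (fam.position u (i q))))) = 0" by blast
  let ?Z = "\<lambda>a. fps_to_fls (fam.position u a)"
  define lam where "lam a = (\<Sum>s\<in>{1..r}. if ?Y s a then ?L s else 0) / 2" for a
  have vals: "real_of_int (fls_subdegree (?Z a - ?Z b)) = lam a + lam b + (- 1/2) * leg_dist \<Gamma> a b"
    if ab: "a \<in> {1..n}" "b \<in> {1..n}" "a \<noteq> b" for a b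
  proof -
    have "{t. t \<in> {1..r} \<and> fam.below t a \<and> fam.below t b} = {t \<in> {1..r}. ?Y t a \<and> ?Y t b}"
      using below ab by blast
    then have "real (\<Sum>t | t \<in> {1..r} \<and> fam.below t a \<and> fam.below t b. ll t) = (\<Sum>s | s \<in> {1..r} \<and> ?Y s a \<and> ?Y s b. ?L s)"
      unfolding of_nat_sum using ll by (intro sum.cong) auto
    also have "\<dots> = (\<Sum>s\<in>{1..r}. if ?Y s a \<and> ?Y s b then ?L s else 0)" by (intro sum.inter_filter) simp
    finally have 1: "real_of_int (fls_subdegree (?Z a - ?Z b)) = (\<Sum>s\<in>{1..r}. if ?Y s a \<and> ?Y s b then ?L s else 0)"
      using fam.position_diff_subdegree(2)[OF u ab(3)]
      by (simp flip: fps_to_fls_minus add: fls_subdegree_fls_to_fps)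
    have "{e \<in> edges \<Gamma>. ?sep e (att \<Gamma> a) (att \<Gamma> b)} = {x \<in> edges \<Gamma>. cut \<Gamma> x a \<noteq> cut \<Gamma> x b}"
      using cut_neq_iff[OF st _ ab(1,2) n] by blast
    then have "leg_dist \<Gamma> a b = (\<Sum>x | x \<in> edges \<Gamma> \<and> cut \<Gamma> x a \<noteq> cut \<Gamma> x b. len \<Gamma> x)"
      using tree_dist_eq(2)[OF tree V[OF ab(1)] V[OF ab(2)]] by simp
    also have "\<dots> = (\<Sum>s | s \<in> {1..r} \<and> ?Y s a \<noteq> ?Y s b. ?L s)"
      using sum_filter_bij[OF e, where R = "\<lambda>x. cut \<Gamma> x a \<noteq> cut \<Gamma> x b" and L = "len \<Gamma>"] by simp
    also have "\<dots> = (\<Sum>s\<in>{1..r}. if ?Y s a \<noteq> ?Y s b then ?L s else 0)" by (intro sum.inter_filter) simp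
    finally have 2: "leg_dist \<Gamma> a b = \<dots>" .
    have "2 * (\<Sum>s\<in>{1..r}. if ?Y s a \<and> ?Y s b then ?L s else 0) + (\<Sum>s\<in>{1..r}. if ?Y s a \<noteq> ?Y s b then ?L s else 0)
        = (\<Sum>s\<in>{1..r}. if ?Y s a then ?L s else 0) + (\<Sum>s\<in>{1..r}. if ?Y s b then ?L s else 0)"
      unfolding sum_distrib_left sum.distrib[symmetric] by (intro sum.cong) auto
    then show ?thesis unfolding 1 2 lam_def by simp
  qed
  have "inj_on ?Z {1..n}"
  proof (rule inj_onI, rule ccontr)
    fix a b assume "?Z a = ?Z b" "a \<noteq> b"
    then show False using fam.position_diff_subdegree(1)[OF u \<open>a \<noteq> b\<close>] by simp
  qed
  then show ?thesis using vals eqs by (intro exI[of _ ?Z]) blast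
qed

text \<open>The conditions are necessary because the minimum is attained twice on every hypersurface, and sufficient because
  a tree satisfying them lifts to a common point of the hypersurfaces over \<open>k((t))\<close> itself.\<close>

theorem FW_iff:
  fixes h :: "'k::field_char_0 fls \<Rightarrow> 'u"
  assumes h: "inj h"
  shows "\<Gamma> \<in> FW TYPE('k) TYPE('u) n B S i j r \<longleftrightarrow> \<Gamma> \<in> M0n_trop n \<and> (\<exists>e k l. trop_data n B S i j r \<Gamma> e k l)"
proof
  assume "\<Gamma> \<in> M0n_trop n \<and> (\<exists>e k l. trop_data n B S i j r \<Gamma> e k l)"
  then obtain e k l where \<Gamma>: "\<Gamma> \<in> M0n_trop n" and d: "trop_data n B S i j r \<Gamma> e k l" by blast
  have "card (edges \<Gamma>) = r" using d bij_betw_same_card[of e "{1..r}" "edges \<Gamma>"] by (simp add: trop_data_def)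
  moreover obtain Z :: "nat \<Rightarrow> 'k fls" and lam where Z: "inj_on Z {1..n}"
    "\<forall>a\<in>{1..n}. \<forall>b\<in>{1..n}. a \<noteq> b \<longrightarrow> real_of_int (fls_subdegree (Z a - Z b)) = lam a + lam b + (- 1/2) * leg_dist \<Gamma> a b"
    "\<forall>q\<in>{1..r}. (\<Sum>\<alpha>\<in>S q - {i q, j q}. fls_X ^ (\<alpha> * B ^ (n - 3 - q)) * ((Z \<alpha> - Z (j q)) / (Z \<alpha> - Z (i q)))) = 0"
    using trop_data_lift[OF \<Gamma> d] by blast
  have "\<forall>q\<in>{1..r}. hypersurface n B S i j q (transported_ring h) h (\<lambda>a. (h (Z a), h 1))"
  proof
    fix q assume q: "q \<in> {1..r}"
    then show "hypersurface n B S i j q (transported_ring h) h (\<lambda>a. (h (Z a), h 1))"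
      using transported_hypersurface[OF h Z(1), of S q i j B] S[OF q] Z(3) by blast
  qed
  moreover have "\<forall>a\<in>{1..n}. \<forall>b\<in>{1..n}. a < b \<longrightarrow>
      real_of_int (fls_subdegree (inv_into UNIV h (minor (transported_ring h) (\<lambda>a. (h (Z a), h 1)) a b))) =
        lam a + lam b + (- 1/2) * leg_dist \<Gamma> a b"
    using Z(2) unfolding transported_point(2)[OF h Z(1)] inv_f_f[OF h] by simp
  ultimately show "\<Gamma> \<in> FW TYPE('k) TYPE('u) n B S i j r"
    unfolding FW_def skeleton_def trop_def
    using \<Gamma> transported_extension[OF h] transported_point(1)[OF h Z(1)] by blast
next
  assume "\<Gamma> \<in> FW TYPE('k) TYPE('u) n B S i j r"
  then obtain L \<iota> val p lam where \<Gamma>: "\<Gamma> \<in> M0n_trop n" and card: "card (edges \<Gamma>) \<le> r"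
    and ext: "valued_extension L (\<iota> :: 'k fls \<Rightarrow> 'u) val" and p: "p \<in> M0n_points L n"
    and hyp: "\<forall>q\<in>{1..r}. hypersurface n B S i j q L \<iota> p"
    and minors: "\<forall>a\<in>{1..n}. \<forall>b\<in>{1..n}. a < b \<longrightarrow>
           val (minor L p a b) = lam a + lam b + (- 1/2) * leg_dist \<Gamma> a b"
    unfolding FW_def skeleton_def trop_def by blast
  have "\<exists>k l. k \<in> S q - {i q, j q} \<and> l \<in> S q - {i q, j q} \<and> k < l \<and>
      trop_val \<Gamma> q k = trop_val \<Gamma> q l \<and> (\<forall>\<alpha>\<in>S q - {i q, j q}. trop_val \<Gamma> q k \<le> trop_val \<Gamma> q \<alpha>)"
    if q: "q \<in> {1..r}" for q
  proof -
    have "card {i q, j q} < card (S q)" using S[OF q] by auto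
    then have ne: "S q - {i q, j q} \<noteq> {}" using card_mono[of "{i q, j q}" "S q"] by auto
    obtain a b where ab: "a \<in> S q - {i q, j q}" "b \<in> S q - {i q, j q}" "a \<noteq> b" "trop_val \<Gamma> q a = trop_val \<Gamma> q b"
      "\<forall>c\<in>S q - {i q, j q}. trop_val \<Gamma> q a \<le> trop_val \<Gamma> q c"
      using hypersurface_minimum_twice[OF \<Gamma> ext p _ bspec[OF hyp q] _ _ _ _ ne, of lam] minors S[OF q]
      unfolding trop_val_def scale_def by blast
    show ?thesis
    proof (cases "a < b")
      case True
      then show ?thesis using ab by blast
    next
      case False
      then show ?thesis using ab by (intro exI[of _ b] exI[of _ a]) auto
    qed
  qed
  then show "\<Gamma> \<in> M0n_trop n \<and> (\<exists>e k l. trop_data n B S i j r \<Gamma> e k l)"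
    using double_minima_imp_trop_data[OF \<Gamma> card] \<Gamma> by blast
qed

end

section \<open>Inserting an edge at a vertex\<close>

lemma site_mem_Union_iff:
  assumes "\<B> \<subseteq> branches n T v"
  shows "z \<in> \<Union>\<B> \<longleftrightarrow> branch n T v z \<in> \<B>"
proof
  assume "z \<in> \<Union>\<B>"
  then obtain \<beta> where "\<beta> \<in> \<B>" "z \<in> \<beta>" by blast
  moreover from this obtain y where "\<beta> = branch n T v y" using assms by (auto simp: branches_def)
  ultimately show "branch n T v z \<in> \<B>" using branch_eq_iff_mem by metis
next
  assume "branch n T v z \<in> \<B>"
  then show "z \<in> \<Union>\<B>" using branch_refl by (rule UnionI)
qed

context
  fixes n r :: nat and \<Gamma> :: mtree and e :: "nat \<Rightarrow> nat set" and Y :: "nat \<Rightarrow> nat \<Rightarrow> bool"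
    and A :: "nat set" and a b v :: nat and B1 B2 :: "site set set"
  assumes \<Gamma>: "\<Gamma> \<in> M0n_trop n" and e: "bij_betw e {1..r} (edges \<Gamma>)"
    and Y: "\<And>s c. s \<in> {1..r} \<Longrightarrow> c \<in> {1..n} \<Longrightarrow> Y s c = cut \<Gamma> (e s) c"
    and A: "A \<subseteq> {1..n}" "a \<in> A" "b \<in> A" "a \<noteq> b" and v: "v \<in> verts \<Gamma>"
    and part: "B1 \<union> B2 = branches n \<Gamma> v" "B1 \<inter> B2 = {}" "branch n \<Gamma> v (Leg a) \<in> B1"
    and new: "\<And>c d. c \<in> {1..n} \<Longrightarrow> d \<in> {1..n} \<Longrightarrow>
      Y (r + 1) c = Y (r + 1) d \<longleftrightarrow> (branch n \<Gamma> v (Leg c) \<in> B1 \<longleftrightarrow> branch n \<Gamma> v (Leg d) \<in> B1)"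
begin

private abbreviation br :: "nat \<Rightarrow> site set" where "br c \<equiv> branch n \<Gamma> v (Leg c)"
private abbreviation sv :: "nat set \<Rightarrow> nat \<Rightarrow> bool" where "sv f c \<equiv> separates (edges \<Gamma>) f v (att \<Gamma> c)"

private lemma branch_in: "c \<in> A \<Longrightarrow> br c \<in> B1 \<or> br c \<in> B2"
proof -
  assume "c \<in> A"
  then have "br c \<in> branches n \<Gamma> v"
    unfolding branches_def using A(1) by (intro imageI) (auto simp: sites_def)
  then show ?thesis using part(1) by blast
qed

private lemma not_both: "br c \<in> B1 \<Longrightarrow> br c \<notin> B2"
  using part(2) by blast

private lemma same: "c \<in> A \<Longrightarrow> d \<in> A \<Longrightarrow> br c = br d \<longleftrightarrow> c = d \<or> (\<exists>f\<in>edges \<Gamma>. sv f c \<and> sv f d)"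
  using \<Gamma> A(1) v by (intro leg_branch_eq_iff) (auto simp: M0n_trop_def)

private lemma quart:
  assumes "s \<in> {1..r}" "c1 \<in> A" "c2 \<in> A" "c3 \<in> A" "c4 \<in> A"
  shows "quartet Y s c1 c2 c3 c4 \<longleftrightarrow> sv (e s) c1 = sv (e s) c2 \<and> sv (e s) c3 = sv (e s) c4 \<and> sv (e s) c1 \<noteq> sv (e s) c3"
proof -
  have st: "stable_tree n \<Gamma>" using \<Gamma> by (simp add: M0n_trop_def)
  have tree: "is_tree (verts \<Gamma>) (edges \<Gamma>)" and V: "\<And>l. l \<in> {1..n} \<Longrightarrow> att \<Gamma> l \<in> verts \<Gamma>"
    using st by (auto simp: stable_tree_def)
  have E: "e s \<in> edges \<Gamma>" using bij_betwE[OF e] assms(1) by blast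
  have "Y s x \<noteq> Y s y \<longleftrightarrow> sv (e s) x \<noteq> sv (e s) y" if "x \<in> A" "y \<in> A" for x y
  proof -
    have xy: "x \<in> {1..n}" "y \<in> {1..n}" using that A(1) by auto
    show ?thesis unfolding Y[OF assms(1) xy(1)] Y[OF assms(1) xy(2)]
      using cut_neq_iff[OF st E xy] xy separates_xor[OF tree E V[OF xy(1)] V[OF xy(2)] v] by simp
  qed
  then show ?thesis unfolding quartet_def using assms(2-5) by blast
qed

private lemma quart_new:
  assumes "c1 \<in> A" "c2 \<in> A" "c3 \<in> A" "c4 \<in> A"
  shows "quartet Y (r + 1) c1 c2 c3 c4 \<longleftrightarrow> (br c1 \<in> B1 \<longleftrightarrow> br c2 \<in> B1) \<and> (br c3 \<in> B1 \<longleftrightarrow> br c4 \<in> B1) \<and>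
    \<not> (br c1 \<in> B1 \<longleftrightarrow> br c3 \<in> B1)"
  using new assms A(1) unfolding quartet_def by blast

private lemma numbered: "(\<forall>s\<in>{1..<r + 1}. R (e s)) \<longleftrightarrow> (\<forall>f\<in>edges \<Gamma>. R f)"
proof -
  have "edges \<Gamma> = e ` {1..<r + 1}" using e by (auto simp: bij_betw_def atLeastLessThanSuc_atLeastAtMost)
  then show ?thesis by simp
qed

private lemma old_quart:
  assumes "c1 \<in> A" "c2 \<in> A" "c3 \<in> A" "c4 \<in> A"
  shows "(\<forall>s\<in>{1..<r + 1}. \<not> quartet Y s c1 c2 c3 c4) \<longleftrightarrow>
     (\<forall>f\<in>edges \<Gamma>. \<not> (sv f c1 = sv f c2 \<and> sv f c3 = sv f c4 \<and> sv f c1 \<noteq> sv f c3))"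
  using quart assms numbered[of "\<lambda>f. \<not> (sv f c1 = sv f c2 \<and> sv f c3 = sv f c4 \<and> sv f c1 \<noteq> sv f c3)"]
  by auto

private lemma k_set: "{s \<in> A. Leg s \<notin> branch n \<Gamma> v (Leg a) \<union> branch n \<Gamma> v (Leg b)} = {s \<in> A. br s \<noteq> br a \<and> br s \<noteq> br b}"
  unfolding Un_iff branch_eq_iff_mem[symmetric] by auto

private lemma l_set: "{s \<in> A. \<exists>\<beta>\<in>B1 - {branch n \<Gamma> v (Leg a)}. Leg s \<in> \<beta>} = {s \<in> A. br s \<in> B1 \<and> br s \<noteq> br a}"
proof -
  have "(\<exists>\<beta>\<in>B1 - {br a}. Leg s \<in> \<beta>) \<longleftrightarrow> br s \<in> B1 - {br a}" for s
    using site_mem_Union_iff[of "B1 - {br a}" n \<Gamma> v "Leg s"] part(1) by blast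
  then show ?thesis by blast
qed

private lemma finA: "finite A"
  using A(1) finite_subset by blast

text \<open>An edge of \<open>\<Gamma>\<close> that separates two legs from \<open>v\<close> puts them into one branch at \<open>v\<close>. So of two pairs of legs in
  different branches each, no edge of \<open>\<Gamma>\<close> separates one pair from the other. At the hull vertex the leg
  \<open>a\<close> is alone in its branch among the elements of \<open>A\<close>, and an element \<open>\<alpha>\<close> in the branch of \<open>b\<close> is
  projected behind \<open>k\<close> by an edge of \<open>\<Gamma>\<close>.\<close>

lemma allowable_imp_admissible:
  assumes hull: "hull_vertex n \<Gamma> A a v" and all: "allowable_partition n \<Gamma> A a b v B1 B2"
  shows "admissible Y A a b (r + 1) (k_new n \<Gamma> A a b v) (l_new n \<Gamma> A a v B1)"
proof -
  define k where "k = k_new n \<Gamma> A a b v"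
  define l where "l = l_new n \<Gamma> A a v B1"
  have apart: "br s \<noteq> br a" if "s \<in> A - {a}" for s
    using hull that unfolding hull_vertex_iff[OF \<Gamma> A(1,2)] by blast
  have kmin: "k = Min {s \<in> A. br s \<noteq> br a \<and> br s \<noteq> br b}"
    unfolding k_def k_new_def k_set ..
  have lmin: "l = Min {s \<in> A. br s \<in> B1 \<and> br s \<noteq> br a}"
    unfolding l_def l_new_def l_set ..
  have bB: "br b \<in> B2" "br k \<in> B2" and "\<exists>\<beta>\<in>B1 - {br a}. meets \<beta> A"
    using all unfolding allowable_partition_def k_def by blast+
  then have ne: "{s \<in> A. br s \<in> B1 \<and> br s \<noteq> br a} \<noteq> {}" using l_set by (auto simp: meets_def)
  then have l: "l \<in> A" "br l \<in> B1" "br l \<noteq> br a" and lle: "\<And>s. s \<in> A \<Longrightarrow> br s \<in> B1 \<Longrightarrow> br s \<noteq> br a \<Longrightarrow> l \<le> s"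
    using Min_in[OF _ ne] finA unfolding lmin by auto
  have "br l \<noteq> br b" using l(2) bB(1) not_both by metis
  then have ne': "{s \<in> A. br s \<noteq> br a \<and> br s \<noteq> br b} \<noteq> {}" using l by blast
  then have k: "k \<in> A" "br k \<noteq> br a" "br k \<noteq> br b"
    and kle: "\<And>s. s \<in> A \<Longrightarrow> br s \<noteq> br a \<Longrightarrow> br s \<noteq> br b \<Longrightarrow> k \<le> s"
    using Min_in[OF _ ne'] finA unfolding kmin by auto
  have B1: "br a \<in> B1" "br l \<in> B1" "br b \<notin> B1" "br k \<notin> B1" using part(3) l(2) bB not_both by metis+
  have "k \<noteq> l" using B1 by metis
  then have "k < l" using kle[OF l(1,3) \<open>br l \<noteq> br b\<close>] by simp
  moreover have "k \<in> A - {a, b}" "l \<in> A - {a, b}" using k l \<open>br l \<noteq> br b\<close> by auto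
  moreover have "quartet Y (r + 1) a l b k" using quart_new[OF A(2) l(1) A(3) k(1)] B1 by simp
  moreover have "(\<forall>s\<in>{1..<r + 1}. \<not> quartet Y s a \<alpha> b k) \<and>
        ((\<forall>s\<in>{1..<r + 1}. \<not> quartet Y s a k b \<alpha>) \<longrightarrow>
           (if quartet Y (r + 1) a \<alpha> b k then l \<le> \<alpha> else k \<le> \<alpha>))" if \<alpha>: "\<alpha> \<in> A - {a, b}" for \<alpha>
  proof -
    have \<alpha>A: "\<alpha> \<in> A" "br \<alpha> \<noteq> br a" using \<alpha> apart by auto
    have no: "\<not> (sv f x \<and> sv f y)" if "f \<in> edges \<Gamma>" "x \<in> A" "y \<in> A" "br x \<noteq> br y" for f x y
      using same that by blast
    have "\<not> (sv f a = sv f \<alpha> \<and> sv f b = sv f k \<and> sv f a \<noteq> sv f b)" if f: "f \<in> edges \<Gamma>" for f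
      using no[OF f A(2) \<alpha>A(1)] no[OF f A(3) k(1)] \<alpha>A(2) k(3) by metis
    moreover have "if quartet Y (r + 1) a \<alpha> b k then l \<le> \<alpha> else k \<le> \<alpha>"
      if near: "\<forall>f\<in>edges \<Gamma>. \<not> (sv f a = sv f k \<and> sv f b = sv f \<alpha> \<and> sv f a \<noteq> sv f b)"
    proof (cases "br \<alpha> \<in> B1")
      case True
      then show ?thesis using quart_new[OF A(2) \<alpha>A(1) A(3) k(1)] B1 lle[OF \<alpha>A(1) True \<alpha>A(2)] by simp
    next
      case False
      have "br \<alpha> \<noteq> br b"
      proof
        assume "br \<alpha> = br b"
        then obtain f where f: "f \<in> edges \<Gamma>" "sv f \<alpha>" "sv f b" using same[OF \<alpha>A(1) A(3)] \<alpha> by blast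
        have "\<not> sv f a" using no[OF f(1) A(2,3)] f(3) B1(1,3) by metis
        moreover have "\<not> sv f k" using no[OF f(1) k(1) A(3) k(3)] f(3) by blast
        ultimately show False using near f by blast
      qed
      then show ?thesis using quart_new[OF A(2) \<alpha>A(1) A(3) k(1)] B1 False kle[OF \<alpha>A] by simp
    qed
    ultimately show ?thesis
      unfolding old_quart[OF A(2) \<alpha>A(1) A(3) k(1)] old_quart[OF A(2) k(1) A(3) \<alpha>A(1)] by blast
  qed
  ultimately show ?thesis unfolding admissible_def k_def[symmetric] l_def[symmetric] by blast
qed

text \<open>The same dictionary in the other direction: if some \<open>\<alpha>\<close> were in the branch of \<open>a\<close>, then an edge of \<open>\<Gamma>\<close> would
  separate \<open>a\<close> and \<open>\<alpha>\<close> from \<open>v\<close>, and hence from \<open>b\<close> and \<open>k\<close>, as these lie on the other side of the new split.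
  Admissibility forbids this for the edges with earlier indices.\<close>

lemma admissible_imp_allowable:
  assumes adm: "admissible Y A a b (r + 1) k l"
  shows "hull_vertex n \<Gamma> A a v" "allowable_partition n \<Gamma> A a b v B1 B2"
    "k = k_new n \<Gamma> A a b v" "l = l_new n \<Gamma> A a v B1"
proof -
  have kl: "k \<in> A" "l \<in> A" "k \<noteq> a" "k \<noteq> b" "l \<noteq> a" "l \<noteq> b" "k < l" and lk: "quartet Y (r + 1) a l b k"
    using adm unfolding admissible_def by blast+
  have far: "\<not> (sv f a = sv f \<alpha> \<and> sv f b = sv f k \<and> sv f a \<noteq> sv f b)" if "f \<in> edges \<Gamma>" "\<alpha> \<in> A - {a, b}" for f \<alpha>
  proof -
    have "\<alpha> \<in> A" "\<forall>s\<in>{1..<r + 1}. \<not> quartet Y s a \<alpha> b k" using adm that(2) unfolding admissible_def by blast+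
    then show ?thesis using old_quart[OF A(2) _ A(3) kl(1)] that(1) by blast
  qed
  have B1: "br a \<in> B1" "br l \<in> B1" "br b \<notin> B1" "br k \<notin> B1"
    using lk quart_new[OF A(2) kl(2) A(3) kl(1)] part(3) by blast+
  have apart: "br \<alpha> \<noteq> br a" if \<alpha>: "\<alpha> \<in> A - {a}" for \<alpha>
  proof
    assume eq: "br \<alpha> = br a"
    then have "\<alpha> \<noteq> b" using B1 by metis
    have \<alpha>A: "\<alpha> \<in> A" using \<alpha> by blast
    obtain f where f: "f \<in> edges \<Gamma>" "sv f \<alpha>" "sv f a" using eq same[OF \<alpha>A A(2)] \<alpha> by blast
    have "\<not> sv f b" using same[OF A(2,3)] f B1 by metis
    then have "sv f k" using far[OF f(1), of \<alpha>] f \<alpha> \<open>\<alpha> \<noteq> b\<close> by blast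
    then have "br k = br a" using same[OF kl(1) A(2)] f by blast
    then show False using B1 by metis
  qed
  have lb: "br l \<noteq> br b" "br k \<noteq> br l" using B1 by metis+
  have kb: "br k \<noteq> br b"
  proof
    assume "br k = br b"
    then obtain f where f: "f \<in> edges \<Gamma>" "sv f k" "sv f b" using same[OF kl(1) A(3)] kl by blast
    have "\<not> sv f a" using same[OF A(2,3)] f B1 by metis
    moreover have "\<not> sv f l" using same[OF kl(2) A(3)] f lb by blast
    ultimately show False using far[OF f(1), of l] f kl by blast
  qed
  have ka: "br k \<noteq> br a" "br l \<noteq> br a" using apart kl by blast+
  show "hull_vertex n \<Gamma> A a v"
    unfolding hull_vertex_iff[OF \<Gamma> A(1,2)] using v apart kl lb(2) by blast
  have order: "if quartet Y (r + 1) a \<alpha> b k then l \<le> \<alpha> else k \<le> \<alpha>"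
    if \<alpha>: "\<alpha> \<in> A" "br \<alpha> \<noteq> br a" "br \<alpha> \<noteq> br b" for \<alpha>
  proof -
    have \<alpha>': "\<alpha> \<in> A - {a, b}" using \<alpha> by auto
    have "\<not> (sv f a = sv f k \<and> sv f b = sv f \<alpha> \<and> sv f a \<noteq> sv f b)" if f: "f \<in> edges \<Gamma>" for f
      using same[OF A(2) kl(1)] same[OF A(3) \<alpha>(1)] f ka(1) \<alpha>(3) by metis
    then have "\<forall>s\<in>{1..<r + 1}. \<not> quartet Y s a k b \<alpha>" using old_quart[OF A(2) kl(1) A(3) \<alpha>(1)] by blast
    then show ?thesis using adm \<alpha>' unfolding admissible_def by blast
  qed
  show kn: "k = k_new n \<Gamma> A a b v"
    unfolding k_new_def k_set
  proof (rule Min_eqI[symmetric])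
    fix s assume "s \<in> {s \<in> A. br s \<noteq> br a \<and> br s \<noteq> br b}"
    then show "k \<le> s" using order[of s] kl(7) by (auto split: if_splits)
  qed (use finA kl ka kb in auto)
  show "l = l_new n \<Gamma> A a v B1"
    unfolding l_new_def l_set
  proof (rule Min_eqI[symmetric])
    fix s assume s: "s \<in> {s \<in> A. br s \<in> B1 \<and> br s \<noteq> br a}"
    then have s': "s \<in> A" "br s \<in> B1" "br s \<noteq> br a" by blast+
    have "br s \<noteq> br b" using B1(3) s'(2) by metis
    moreover have "quartet Y (r + 1) a s b k" using quart_new[OF A(2) s'(1) A(3) kl(1)] B1 s'(2) by simp
    ultimately show "l \<le> s" using order[OF s'(1,3)] by simp
  qed (use finA kl ka B1 in auto)
  have "br l \<in> B1 - {br a}" "meets (br l) A"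
    unfolding meets_def using B1(2) ka(2) kl(2) branch_refl by blast+
  then show "allowable_partition n \<Gamma> A a b v B1 B2"
    unfolding allowable_partition_def kn[symmetric]
    using part branch_in[OF A(3)] branch_in[OF kl(1)] B1 by blast
qed

end

section \<open>Splitting a vertex\<close>

lemma branch_germ:
  assumes st: "stable_tree n T" and v: "v \<in> verts T" and \<beta>: "\<beta> \<in> branches n T v"
  shows "(\<exists>u. {v, u} \<in> edges T \<and> Vertex u \<in> \<beta>) \<or> (\<exists>l\<in>{1..n}. att T l = v \<and> Leg l \<in> \<beta>)"
proof -
  have tree: "is_tree (verts T) (edges T)" and V: "\<And>l. l \<in> {1..n} \<Longrightarrow> att T l \<in> verts T"
    using st by (auto simp: stable_tree_def)
  obtain z where z: "z \<in> sites n T - {Vertex v}" "\<beta> = branch n T v z" using \<beta> by (auto simp: branches_def)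
  have posV: "pos T z \<in> verts T" using z V by (auto simp: sites_def)
  show ?thesis
  proof (cases "pos T z = v")
    case True
    then obtain l where "z = Leg l" "l \<in> {1..n}" "att T l = v" using z(1) by (cases z) (auto simp: sites_def)
    then show ?thesis using z(2) branch_refl by blast
  next
    case False
    obtain f where f: "f \<in> edges T" "v \<in> f" "separates (edges T) f v (pos T z)"
      using exit_edge[OF tree v posV False[symmetric]] by blast
    obtain u where u: "f = {v, u}" using tree_edge[OF tree f(1)] f(2) by blast
    have uV: "u \<in> verts T" "u \<noteq> v" using tree_edgeD[OF tree, of v u] f(1) u by auto
    have "separates (edges T) f v u" using tree_bridge[OF tree, of v u] f(1) u by simp
    then have "branch n T v z = branch n T v (Vertex u)"
      using branch_eq_iff[OF st v z(1), of "Vertex u"] f uV by (auto simp: sites_def)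
    then have "Vertex u \<in> \<beta>" unfolding branch_eq_iff_mem z(2) .
    then show ?thesis using f(1) u by blast
  qed
qed

lemma adjacent_branch:
  "(x, y) \<in> incident n T \<Longrightarrow> x \<in> sites n T - {Vertex v} \<Longrightarrow> y \<in> sites n T - {Vertex v} \<Longrightarrow>
   branch n T v x = branch n T v y"
  unfolding branch_eq_iff_mem by (auto simp: branch_def)

definition moved_edge :: "nat \<Rightarrow> nat \<Rightarrow> site set set \<Rightarrow> nat set \<Rightarrow> nat set" where
  "moved_edge v w B1 e = (if v \<in> e \<and> (\<exists>u\<in>e. Vertex u \<in> \<Union>B1) then insert w (e - {v}) else e)"

context
  fixes n :: nat and \<Gamma> :: "'a tree_scheme" and v w :: nat and B1 B2 :: "site set set"
  assumes st: "stable_tree n \<Gamma>" and v: "v \<in> verts \<Gamma>" and w: "w \<notin> verts \<Gamma>"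
    and part: "B1 \<union> B2 = branches n \<Gamma> v" "B1 \<inter> B2 = {}"
begin

private abbreviation moved :: "nat set \<Rightarrow> nat set" where "moved \<equiv> moved_edge v w B1"
private abbreviation T :: tree where "T \<equiv> split_vertex \<Gamma> v w B1"
private abbreviation unsplit :: "nat \<Rightarrow> nat" where "unsplit \<equiv> id(w := v)"
text \<open>The function telling apart the two sides of the new edge; it is constant along all other edges, since
  neighbours other than \<open>v\<close> lie in the same branch.\<close>

private definition on_w :: "nat \<Rightarrow> bool" where "on_w x \<longleftrightarrow> x = w \<or> Vertex x \<in> \<Union>B1"

private lemma tree: "is_tree (verts \<Gamma>) (edges \<Gamma>)" and V: "\<And>l. l \<in> {1..n} \<Longrightarrow> att \<Gamma> l \<in> verts \<Gamma>"
  using st by (auto simp: stable_tree_def)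

private lemma vw: "v \<noteq> w"
  using v w by blast

private lemma v_notin: "Vertex v \<notin> \<Union>(branches n \<Gamma> v)"
  using branch_subset unfolding branches_def by blast

private lemma T_simps: "verts T = insert w (verts \<Gamma>)" "edges T = insert {v, w} (moved ` edges \<Gamma>)"
  by (simp_all add: split_vertex_def moved_edge_def)

private lemma moved_cases:
  assumes "{p, q} \<in> edges \<Gamma>"
  shows "v \<notin> {p, q} \<Longrightarrow> moved {p, q} = {p, q}"
    "p = v \<Longrightarrow> moved {p, q} = (if Vertex q \<in> \<Union>B1 then {w, q} else {v, q})"
  using v_notin part(1) tree_edgeD[OF tree assms] by (auto simp: moved_edge_def)

private lemma unsplit_moved: "e \<in> edges \<Gamma> \<Longrightarrow> unsplit ` moved e = e"
proof -
  assume "e \<in> edges \<Gamma>"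
  then have "w \<notin> e" using tree_edge[OF tree] w by blast
  then show ?thesis by (auto simp: moved_edge_def)
qed

private lemma moved_ends: "e \<in> edges \<Gamma> \<Longrightarrow> \<exists>p q. moved e = {p, q} \<and> e = {unsplit p, unsplit q} \<and> p \<in> verts T \<and> q \<in> verts T \<and> p \<noteq> q
    \<and> on_w p = on_w q"
proof -
  assume e: "e \<in> edges \<Gamma>"
  obtain p q where pq: "e = {p, q}" "p \<noteq> q" "p \<in> verts \<Gamma>" "q \<in> verts \<Gamma>" using tree_edge[OF tree e] by blast
  have ne: "p \<noteq> w" "q \<noteq> w" using pq w by auto
  show ?thesis
  proof (cases "v \<in> e")
    case False
    then have "branch n \<Gamma> v (Vertex p) = branch n \<Gamma> v (Vertex q)"
      using pq e by (intro adjacent_branch) (auto simp: incident_def sites_def)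
    moreover have "B1 \<subseteq> branches n \<Gamma> v" using part(1) by blast
    ultimately have "on_w p = on_w q"
      unfolding on_w_def using site_mem_Union_iff[of B1 n \<Gamma> v] ne by simp
    moreover have "moved e = {p, q}" using moved_cases(1)[of p q] False pq(1) e by simp
    moreover have "p \<in> verts T" "q \<in> verts T" using pq T_simps by simp_all
    moreover have "e = {unsplit p, unsplit q}" using pq(1) ne by simp
    ultimately show ?thesis using pq(2) by blast
  next
    case True
    then obtain u where u: "e = {v, u}" "u \<noteq> v" "u \<noteq> w" "u \<in> verts \<Gamma>" using pq ne by auto
    have m: "moved e = (if Vertex u \<in> \<Union>B1 then {w, u} else {v, u})" using moved_cases(2)[of v u] e u by simp
    show ?thesis
    proof (cases "Vertex u \<in> \<Union>B1")
      case True
      then show ?thesis using m u(2-4) by (intro exI[of _ w] exI[of _ u]) (simp add: T_simps on_w_def u(1))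
    next
      case False
      moreover have "\<not> on_w v" using v_notin part(1) vw by (auto simp: on_w_def)
      ultimately show ?thesis using m u(2-4) vw v by (intro exI[of _ v] exI[of _ u]) (simp add: T_simps on_w_def u(1))
    qed
  qed
qed

private lemma moved_inj: "inj_on moved (edges \<Gamma>)"
  using unsplit_moved by (rule inj_on_inverseI)

private lemma moved_not_new: "e \<in> edges \<Gamma> \<Longrightarrow> moved e \<noteq> {v, w}"
proof
  assume e: "e \<in> edges \<Gamma>" "moved e = {v, w}"
  then have "e = unsplit ` {v, w}" using unsplit_moved by metis
  then show False using tree_edge[OF tree e(1)] by auto
qed

private lemma T_edge_cases:
  assumes "{p, q} \<in> edges T"
  shows "{p, q} = {v, w} \<or> (\<exists>e\<in>edges \<Gamma>. {p, q} = moved e \<and> e = {unsplit p, unsplit q} \<and> on_w p = on_w q)"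
proof -
  consider "{p, q} = {v, w}" | e where "e \<in> edges \<Gamma>" "{p, q} = moved e" using assms T_simps by auto
  then show ?thesis
  proof cases
    case (2 e)
    obtain x y where xy: "moved e = {x, y}" "e = {unsplit x, unsplit y}" "on_w x = on_w y" using moved_ends[OF 2(1)] by blast
    then have "(p = x \<and> q = y) \<or> (p = y \<and> q = x)" using 2(2) by (simp add: doubleton_eq_iff)
    then have "on_w p = on_w q" "e = {unsplit p, unsplit q}" using xy(2,3) by (elim disjE; simp add: insert_commute)+
    then show ?thesis using 2 by blast
  qed simp
qed

lemma split_tree: "is_tree (verts T) (edges T)"
proof (rule is_treeI)
  show "finite (verts T)" "verts T \<noteq> {}" using tree_finite[OF tree] by (simp_all add: T_simps)
  show "e \<subseteq> verts T \<and> card e = 2" if e: "e \<in> edges T" for e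
  proof (cases "e = {v, w}")
    case True
    then show ?thesis using v vw by (simp add: T_simps)
  next
    case False
    then obtain f where "f \<in> edges \<Gamma>" "e = moved f" using e by (auto simp: T_simps)
    then show ?thesis using moved_ends by force
  qed
  have new: "linked (edges T) v w" by (rule linked_edge) (simp add: T_simps)
  have step: "linked (edges T) p q" if pqE: "{p, q} \<in> edges \<Gamma>" for p q
  proof -
    obtain x y where xy: "moved {p, q} = {x, y}" "{p, q} = {unsplit x, unsplit y}" using moved_ends[OF pqE] by blast
    have u: "linked (edges T) (unsplit z) z" for z using new by simp
    have "{x, y} \<in> edges T" using xy(1) pqE T_simps by auto
    then have "linked (edges T) (unsplit x) (unsplit y)"
      using u[of x] u[of y] by (meson linked_edge linked_sym linked_trans)
    moreover have "p = unsplit x \<and> q = unsplit y \<or> p = unsplit y \<and> q = unsplit x"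
      using xy(2) unfolding doubleton_eq_iff .
    ultimately show ?thesis using linked_sym by metis
  qed
  have old: "linked (edges T) p q" if "p \<in> verts \<Gamma>" "q \<in> verts \<Gamma>" for p q
    using linked_lift[OF tree_connected[OF tree that], of "edges T" "\<lambda>x. x"] step by simp
  show "linked (edges T) p q" if "p \<in> verts T" "q \<in> verts T" for p q
  proof -
    have "linked (edges T) v z" if "z \<in> verts T" for z using that old[OF v] new by (auto simp: T_simps)
    from this[OF that(1)] this[OF that(2)] show ?thesis by (meson linked_sym linked_trans)
  qed
  show "separates (edges T) {p, q} p q" if pq: "{p, q} \<in> edges T" for p q
  proof (cases "{p, q} = {v, w}")
    case True
    show ?thesis
    proof
      assume "linked (edges T - {{p, q}}) p q"
      then have "on_w p = on_w q"
        by (rule linked_invariant) (use T_edge_cases True in blast)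
      moreover have "\<not> on_w v" "on_w w" using v_notin part(1) vw by (auto simp: on_w_def)
      ultimately show False using True by (auto simp: doubleton_eq_iff)
    qed
  next
    case False
    then obtain e where e: "e \<in> edges \<Gamma>" "{p, q} = moved e" "e = {unsplit p, unsplit q}" using T_edge_cases[OF pq] by blast
    show ?thesis
    proof
      assume "linked (edges T - {{p, q}}) p q"
      then have "linked (edges \<Gamma> - {e}) (unsplit p) (unsplit q)"
      proof (rule linked_lift)
        fix x y assume xy: "{x, y} \<in> edges T - {{p, q}}"
        then consider "{x, y} = {v, w}" | f where "f \<in> edges \<Gamma>" "{x, y} = moved f" "f = {unsplit x, unsplit y}"
          using T_edge_cases by blast
        then show "linked (edges \<Gamma> - {e}) (unsplit x) (unsplit y)"
        proof cases
          case 1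
          then have "unsplit x = unsplit y" by (auto simp: doubleton_eq_iff)
          then show ?thesis by simp
        next
          case (2 f)
          then have "f \<noteq> e" using xy e(2) by (metis Diff_iff singletonI)
          then have "{unsplit x, unsplit y} \<in> edges \<Gamma> - {e}" using 2(1) unfolding 2(3)[symmetric] by blast
          then show ?thesis by (rule linked_edge)
        qed
      qed
      then show False using tree_bridge[OF tree, of "unsplit p" "unsplit q"] e(1,3) by simp
    qed
  qed
qed

lemma split_contraction: "contraction n unsplit T {v, w} \<Gamma>"
proof -
  have "verts \<Gamma> = unsplit ` verts T" using v w by (auto simp: T_simps image_iff)
  moreover have "unsplit x = unsplit y \<longleftrightarrow> x = y \<or> {x, y} = {v, w}" if "x \<in> verts T" "y \<in> verts T" for x y
    using that by (auto simp: doubleton_eq_iff)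
  moreover have "edges \<Gamma> = (\<lambda>e. unsplit ` e) ` (edges T - {{v, w}})"
  proof -
    have "edges T - {{v, w}} = moved ` edges \<Gamma>" using moved_not_new by (auto simp: T_simps)
    then show ?thesis using unsplit_moved by (simp add: image_image)
  qed
  moreover have "att \<Gamma> l = unsplit (att T l)" if "l \<in> {1..n}" for l
    using V[OF that] w by (auto simp: split_vertex_def)
  ultimately show ?thesis unfolding contraction_def by (simp add: T_simps)
qed

lemma split_cut:
  assumes c: "c \<in> {1..n}" and d: "d \<in> {1..n}"
  shows "separates (edges T) {v, w} (att T c) (att T d) \<longleftrightarrow> (branch n \<Gamma> v (Leg c) \<in> B1) \<noteq> (branch n \<Gamma> v (Leg d) \<in> B1)"
proof -
  have B1: "B1 \<subseteq> branches n \<Gamma> v" using part(1) by blast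
  have on: "on_w (att T l) \<longleftrightarrow> branch n \<Gamma> v (Leg l) \<in> B1" if l: "l \<in> {1..n}" for l
  proof (cases "att \<Gamma> l = v")
    case True
    then show ?thesis unfolding site_mem_Union_iff[OF B1, symmetric] using v_notin part(1) vw
      by (auto simp: split_vertex_def on_w_def)
  next
    case False
    then have "branch n \<Gamma> v (Vertex (att \<Gamma> l)) = branch n \<Gamma> v (Leg l)"
      using l V[OF l] by (intro adjacent_branch) (auto simp: incident_def sites_def)
    moreover have "att T l = att \<Gamma> l" "att \<Gamma> l \<noteq> w" using False V[OF l] w by (auto simp: split_vertex_def)
    ultimately show ?thesis unfolding on_w_def using site_mem_Union_iff[OF B1] by simp
  qed
  have "separates (edges T) {v, w} (att T c) (att T d) \<longleftrightarrow> on_w (att T c) \<noteq> on_w (att T d)"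
  proof (rule cut_function[OF split_tree])
    show "{v, w} \<in> edges T" by (simp add: T_simps)
    show "on_w x = on_w y" if "{x, y} \<in> edges T" "{x, y} \<noteq> {v, w}" for x y using T_edge_cases[OF that(1)] that(2) by blast
    show "on_w x \<noteq> on_w y" if "{x, y} = {v, w}" for x y
      using that v_notin part(1) vw by (auto simp: on_w_def doubleton_eq_iff)
    show "att T c \<in> verts T" "att T d \<in> verts T" using V[OF c] V[OF d] by (auto simp: split_vertex_def)
  qed
  then show ?thesis using on[OF c] on[OF d] by simp
qed

text \<open>Each of the two new vertices carries the new edge and a germ of every branch assigned to it.\<close>

lemma split_stable:
  assumes two: "\<exists>\<beta>\<in>B1. \<exists>\<beta>'\<in>B1. \<beta> \<noteq> \<beta>'" "\<exists>\<beta>\<in>B2. \<exists>\<beta>'\<in>B2. \<beta> \<noteq> \<beta>'"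
  shows "stable_tree n T"
proof -
  have attT: "att T l \<in> verts T" if "l \<in> {1..n}" for l using V[OF that] by (auto simp: split_vertex_def)
  have finT: "finite (edges T)" using tree_finite[OF split_tree] by blast
  have ends: "card {e \<in> edges T. x \<in> e} + card {l \<in> {1..n}. att T l = x} \<ge> 3"
    if x: "x \<in> {v, w}" and B: "\<beta> \<in> B" "\<beta>' \<in> B" "\<beta> \<noteq> \<beta>'" "B \<subseteq> branches n \<Gamma> v"
      and germE: "\<And>u. {v, u} \<in> edges \<Gamma> \<Longrightarrow> Vertex u \<in> \<Union>B \<Longrightarrow> {x, u} \<in> edges T"
      and germL: "\<And>l. l \<in> {1..n} \<Longrightarrow> att \<Gamma> l = v \<Longrightarrow> Leg l \<in> \<Union>B \<Longrightarrow> att T l = x" for x B \<beta> \<beta>'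
  proof -
    let ?G = "{e \<in> edges T. x \<in> e} <+> {l \<in> {1..n}. att T l = x}"
    define R where "R g s \<longleftrightarrow> (\<exists>u. g = Inl {x, u} \<and> s = Vertex u \<and> u \<noteq> v \<and> u \<noteq> w) \<or> (\<exists>l. g = Inr l \<and> s = Leg l)"
      for g :: "nat set + nat" and s
    have Rfun: "s = s'" if "R g s" "R g s'" for g s s'
      using that by (auto simp: R_def doubleton_eq_iff)
    have Rnew: "\<not> R (Inl {v, w}) s" for s using x by (auto simp: R_def doubleton_eq_iff)
    have germ: "\<exists>g\<in>?G. \<exists>s\<in>\<gamma>. R g s" if \<gamma>: "\<gamma> \<in> B" for \<gamma>
    proof -
      have "\<gamma> \<in> branches n \<Gamma> v" using \<gamma> B(4) by blast
      from branch_germ[OF st v this] show ?thesis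
      proof
        assume "\<exists>u. {v, u} \<in> edges \<Gamma> \<and> Vertex u \<in> \<gamma>"
        then obtain u where u: "{v, u} \<in> edges \<Gamma>" "Vertex u \<in> \<gamma>" by blast
        have "{x, u} \<in> edges T" using germE[OF u(1)] u(2) \<gamma> by blast
        moreover have "u \<noteq> v" "u \<noteq> w" using tree_edgeD[OF tree u(1)] w by auto
        ultimately have "Inl {x, u} \<in> ?G" "R (Inl {x, u}) (Vertex u)" by (auto simp: R_def)
        then show ?thesis using u(2) by blast
      next
        assume "\<exists>l\<in>{1..n}. att \<Gamma> l = v \<and> Leg l \<in> \<gamma>"
        then obtain l where l: "l \<in> {1..n}" "att \<Gamma> l = v" "Leg l \<in> \<gamma>" by blast
        have "att T l = x" using germL[OF l(1,2)] l(3) \<gamma> by blast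
        then have "Inr l \<in> ?G" "R (Inr l) (Leg l)" using l(1) by (auto simp: R_def)
        then show ?thesis using l(3) by blast
      qed
    qed
    obtain g s where g: "g \<in> ?G" "s \<in> \<beta>" "R g s" using germ[OF B(1)] by blast
    obtain g' s' where g': "g' \<in> ?G" "s' \<in> \<beta>'" "R g' s'" using germ[OF B(2)] by blast
    have gg: "g \<noteq> g'"
    proof
      assume "g = g'"
      then have "s \<in> \<beta> \<and> s \<in> \<beta>'" using Rfun g g' by blast
      moreover obtain y y' where "\<beta> = branch n \<Gamma> v y" "\<beta>' = branch n \<Gamma> v y'"
        using B(1,2,4) unfolding branches_def by blast
      ultimately have "\<beta> = branch n \<Gamma> v s" "\<beta>' = branch n \<Gamma> v s" using branch_eq_iff_mem by metis+
      then show False using B(3) by simp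
    qed
    have newG: "Inl {v, w} \<in> ?G" using x by (auto simp: T_simps)
    have "g \<noteq> Inl {v, w}" "g' \<noteq> Inl {v, w}" using Rnew g(3) g'(3) by metis+
    then have "\<exists>a\<in>?G. \<exists>b\<in>?G. \<exists>c\<in>?G. a \<noteq> b \<and> a \<noteq> c \<and> b \<noteq> c"
      by (intro bexI[OF _ g(1)] bexI[OF _ g'(1)] bexI[OF _ newG] conjI gg)
    moreover have "finite ?G" using finT by (intro finite_Plus) auto
    ultimately have "card ?G \<ge> 3" using card_ge_3_iff[of ?G] by simp
    then show ?thesis using finT by (simp add: card_Plus)
  qed
  have "card {e \<in> edges T. x \<in> e} + card {l \<in> {1..n}. att T l = x} \<ge> 3" if x: "x \<in> verts T" for x
  proof -
    consider "x = w" | "x = v" | "x \<in> verts \<Gamma>" "x \<noteq> v" "x \<noteq> w" using x by (auto simp: T_simps)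
    then show ?thesis
    proof cases
      case 1
      obtain \<beta> \<beta>' where "\<beta> \<in> B1" "\<beta>' \<in> B1" "\<beta> \<noteq> \<beta>'" using two(1) by blast
      then show ?thesis
      proof (rule ends[rotated])
        show "B1 \<subseteq> branches n \<Gamma> v" using part(1) by blast
        show "{x, u} \<in> edges T" if u: "{v, u} \<in> edges \<Gamma>" "Vertex u \<in> \<Union>B1" for u
        proof -
          have "moved {v, u} = {w, u}" using moved_cases(2)[OF u(1)] u(2) by simp
          then show ?thesis using u(1) 1 T_simps by (metis image_eqI insertI2)
        qed
        show "att T l = x" if "att \<Gamma> l = v" "Leg l \<in> \<Union>B1" for l using that 1 by (auto simp: split_vertex_def)
      qed (use 1 in simp)
    next
      case 2
      obtain \<beta> \<beta>' where "\<beta> \<in> B2" "\<beta>' \<in> B2" "\<beta> \<noteq> \<beta>'" using two(2) by blast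
      then show ?thesis
      proof (rule ends[rotated])
        show sub: "B2 \<subseteq> branches n \<Gamma> v" using part(1) by blast
        have dis: "z \<notin> \<Union>B1" if "z \<in> \<Union>B2" for z
          using that site_mem_Union_iff[of B1 n \<Gamma> v z] site_mem_Union_iff[OF sub, of z] part by blast
        show "{x, u} \<in> edges T" if u: "{v, u} \<in> edges \<Gamma>" "Vertex u \<in> \<Union>B2" for u
        proof -
          have "moved {v, u} = {v, u}" using moved_cases(2)[OF u(1)] dis[OF u(2)] by simp
          then show ?thesis using u(1) 2 T_simps by (metis image_eqI insertI2)
        qed
        show "att T l = x" if "att \<Gamma> l = v" "Leg l \<in> \<Union>B2" for l
          using that(1) dis[OF that(2)] 2 by (auto simp: split_vertex_def)
      qed (use 2 in simp)
    next
      case 3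
      have "{e \<in> edges T. x \<in> e} = moved ` {e \<in> edges \<Gamma>. x \<in> e}"
      proof -
        have "x \<in> moved e \<longleftrightarrow> x \<in> e" for e using 3 by (auto simp: moved_edge_def)
        then show ?thesis using 3 by (auto simp: T_simps)
      qed
      moreover have "inj_on moved {e \<in> edges \<Gamma>. x \<in> e}" using moved_inj by (rule inj_on_subset) blast
      ultimately have "card {e \<in> edges T. x \<in> e} = card {e \<in> edges \<Gamma>. x \<in> e}" by (simp add: card_image)
      moreover have "{l \<in> {1..n}. att T l = x} = {l \<in> {1..n}. att \<Gamma> l = x}" using 3 by (auto simp: split_vertex_def)
      ultimately show ?thesis using st 3(1) by (simp add: stable_tree_def)
    qed
  qed
  then show ?thesis unfolding stable_tree_def using split_tree attT by blast
qed

end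

section \<open>Contracting the shortest edge\<close>

context hypersurfaces
begin

text \<open>The intervals prescribed for the lengths are disjoint.\<close>

lemma edge_numbering_unique:
  assumes e: "edge_numbering n B r \<Gamma> e" and e': "edge_numbering n B r \<Gamma> e'" and q: "q \<in> {1..r}"
  shows "e q = e' q"
proof -
  have bij: "bij_betw e {1..r} (edges \<Gamma>)" "bij_betw e' {1..r} (edges \<Gamma>)"
    and sz: "\<And>s. s \<in> {1..r} \<Longrightarrow> scale s / 2 \<le> len \<Gamma> (e s) \<and> len \<Gamma> (e s) \<le> real n * scale s"
      "\<And>s. s \<in> {1..r} \<Longrightarrow> scale s / 2 \<le> len \<Gamma> (e' s) \<and> len \<Gamma> (e' s) \<le> real n * scale s"
    using e e' by (auto simp: edge_numbering_def scale_def)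
  obtain t where t: "t \<in> {1..r}" "e q = e' t" using bij q unfolding bij_betw_def by blast
  have "t = q"
  proof (rule ccontr)
    assume "t \<noteq> q"
    then consider "t < q" | "q < t" by linarith
    then show False
      using c_gap'[of t q] c_gap'[of q t] sz(1)[OF q] sz(2)[OF t(1)] t q by cases auto
  qed
  then show ?thesis using t by simp
qed

lemma trop_data_sum:
  "trop_data n B S i j r \<Gamma> e k l \<Longrightarrow> q \<in> {1..r} \<Longrightarrow>
    sum (\<lambda>s. len \<Gamma> (e s)) {s \<in> {1..r}. quartet (\<lambda>s. cut \<Gamma> (e s)) s (i q) (l q) (j q) (k q)} =
      (real (l q) - real (k q)) * scale q"
  unfolding trop_data_def scale_def by blast

lemma trop_data_numbering:
  assumes d: "trop_data n B S i j r \<Gamma> e k l"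
  shows "edge_numbering n B r \<Gamma> e"
proof -
  have "(real n - 1) * scale q \<le> real n * scale q" for q using c_pos[of q] by (simp add: algebra_simps)
  then show ?thesis
    unfolding edge_numbering_def using d trop_data_sizes[OF d] order.trans
    by (fastforce simp: trop_data_def scale_def)
qed

lemma isometric_trop_data:
  assumes \<Gamma>: "\<Gamma> \<in> M0n_trop n" and d: "trop_data n B S i j r \<Gamma> e k l" and iso: "isometric n \<Gamma> \<Gamma>'"
  shows "\<Gamma>' \<in> M0n_trop n" "\<exists>e. trop_data n B S i j r \<Gamma>' e k l"
proof -
  have st: "stable_tree n \<Gamma>" using \<Gamma> by (simp add: M0n_trop_def)
  then have tree: "is_tree (verts \<Gamma>) (edges \<Gamma>)" by (simp add: stable_tree_def)
  obtain f where col: "collapses f (verts \<Gamma>) (edges \<Gamma>) {} (verts \<Gamma>') (edges \<Gamma>')"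
    and "bij_betw f (verts \<Gamma>) (verts \<Gamma>')"
    and att: "\<And>a. a \<in> {1..n} \<Longrightarrow> att \<Gamma>' a = f (att \<Gamma> a)" and len: "\<And>e. e \<in> edges \<Gamma> \<Longrightarrow> len \<Gamma>' (f ` e) = len \<Gamma> e"
    by (rule isometric_collapses[OF iso]) (rule that)
  have E: "edges \<Gamma>' = (\<lambda>e. f ` e) ` edges \<Gamma>" using collapse_edges[OF tree col] by simp
  have "stable_tree n \<Gamma>'" using collapse_stable[OF st col _ att] by blast
  then show "\<Gamma>' \<in> M0n_trop n" using \<Gamma> len by (auto simp: M0n_trop_def E)
  have e: "bij_betw e {1..r} (edges \<Gamma>)" using d by (simp add: trop_data_def)
  have eE: "e s \<in> edges \<Gamma>" if "s \<in> {1..r}" for s using bij_betwE[OF e] that by blast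
  have cut: "cut \<Gamma>' (f ` e s) a = cut \<Gamma> (e s) a" if "s \<in> {1..r}" "a \<in> {1..n}" for s a
    using collapse_cut[OF st _ col att _ that(2), of "e s"] eE[OF that(1)] n3 by simp
  have "trop_data n B S i j r \<Gamma>' (\<lambda>s. f ` e s) k l"
    unfolding trop_data_def
  proof (intro conjI ballI)
    have "bij_betw (\<lambda>e. f ` e) (edges \<Gamma>) (edges \<Gamma>')"
      using collapse_inj[OF tree col] E by (simp add: bij_betw_def)
    then show "bij_betw (\<lambda>s. f ` e s) {1..r} (edges \<Gamma>')"
      using bij_betw_trans[OF e] by (simp add: comp_def)
    fix q assume q: "q \<in> {1..r}"
    note leg = S_legs[OF q]
    have adm: "admissible (\<lambda>s. cut \<Gamma> (e s)) (S q) (i q) (j q) q (k q) (l q)" using d q by (simp add: trop_data_def)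
    moreover have "admissible (\<lambda>s. cut \<Gamma>' (f ` e s)) (S q) (i q) (j q) q (k q) (l q) =
        admissible (\<lambda>s. cut \<Gamma> (e s)) (S q) (i q) (j q) q (k q) (l q)"
      using cut q leg by (intro admissible_cong) auto
    ultimately show "admissible (\<lambda>s. cut \<Gamma>' (f ` e s)) (S q) (i q) (j q) q (k q) (l q)" by simp
    have kl: "{i q, l q, j q, k q} \<subseteq> {1..n}" using adm leg unfolding admissible_def by blast
    have "quartet (\<lambda>s. cut \<Gamma>' (f ` e s)) s (i q) (l q) (j q) (k q) = quartet (\<lambda>s. cut \<Gamma> (e s)) s (i q) (l q) (j q) (k q)"
      if "s \<in> {1..r}" for s unfolding quartet_def using cut[OF that] kl by simp
    then have "{s. s \<in> {1..r} \<and> quartet (\<lambda>s. cut \<Gamma>' (f ` e s)) s (i q) (l q) (j q) (k q)} =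
        {s. s \<in> {1..r} \<and> quartet (\<lambda>s. cut \<Gamma> (e s)) s (i q) (l q) (j q) (k q)}" by blast
    moreover have "(\<Sum>s | s \<in> {1..r} \<and> quartet (\<lambda>s. cut \<Gamma> (e s)) s (i q) (l q) (j q) (k q). len \<Gamma>' (f ` e s)) =
        (\<Sum>s | s \<in> {1..r} \<and> quartet (\<lambda>s. cut \<Gamma> (e s)) s (i q) (l q) (j q) (k q). len \<Gamma> (e s))"
      using len eE by (intro sum.cong) auto
    ultimately show "(\<Sum>s | s \<in> {1..r} \<and> quartet (\<lambda>s. cut \<Gamma>' (f ` e s)) s (i q) (l q) (j q) (k q). len \<Gamma>' (f ` e s))
        = (real (l q) - real (k q)) * real B ^ (n - 3 - q)"
      using d q unfolding trop_data_def by simp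
  qed
  then show "\<exists>e. trop_data n B S i j r \<Gamma>' e k l" by blast
qed

text \<open>The separating edges are those of the triangular system, so the lengths are the only solution.\<close>

lemma readjusted_len_eq:
  assumes st: "stable_tree n T" and e: "bij_betw e {1..r} (edges T)"
    and legs: "\<And>q. q \<in> {1..r} \<Longrightarrow> k q \<in> {1..n} \<and> l q \<in> {1..n}"
    and tri: "triangular (\<lambda>q. {s \<in> {1..r}. quartet (\<lambda>s. cut T (e s)) s (i q) (l q) (j q) (k q)}) r"
    and L: "\<And>q. q \<in> {1..r} \<Longrightarrow> (\<Sum>s | s \<in> {1..r} \<and> quartet (\<lambda>s. cut T (e s)) s (i q) (l q) (j q) (k q). L s)
              = (real (l q) - real (k q)) * real B ^ (n - 3 - q)"
    and q: "q \<in> {1..r}"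
  shows "readjusted_len n B i j k l r T (e q) = L q"
proof -
  let ?P = "\<lambda>q. {s \<in> {1..r}. quartet (\<lambda>s. cut T (e s)) s (i q) (l q) (j q) (k q)}"
  have sep: "separating_edges T (i q) (l q) (j q) (k q) = {x \<in> edges T. quartet (cut T) x (i q) (l q) (j q) (k q)}"
    if q: "q \<in> {1..r}" for q
  proof -
    have "{i q, l q, j q, k q} \<subseteq> {1..n}" using legs[OF q] S_legs[OF q] by blast
    then have "separates (edges T) x (att T a) (att T b) \<longleftrightarrow> cut T x a \<noteq> cut T x b"
      if "x \<in> edges T" "a \<in> {i q, l q, j q, k q}" "b \<in> {i q, l q, j q, k q}" for x a b
      using cut_neq_iff[OF st that(1)] that n3 by (metis One_nat_def Suc_leI le_trans one_le_numeral subsetD)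
    then show ?thesis unfolding separating_edges_def quartet_def by blast
  qed
  have sum: "(\<Sum>x\<in>separating_edges T (i q) (l q) (j q) (k q). f x) = sum (\<lambda>s. f (e s)) (?P q)"
    if q: "q \<in> {1..r}" for q and f :: "nat set \<Rightarrow> real"
    unfolding sep[OF q]
    using sum_filter_bij[OF e, where R = "\<lambda>x. quartet (cut T) x (i q) (l q) (j q) (k q)" and L = f]
    by (simp only: quartet_reindex)
  define F where "F x = (if x \<in> edges T then L (inv_into {1..r} e x) else 0)" for x
  have Fe: "F (e s) = L s" if "s \<in> {1..r}" for s
    using bij_betw_inv_into_left[OF e that] bij_betwE[OF e] that by (simp add: F_def)
  have "readjusted_len n B i j k l r T = F"
    unfolding readjusted_len_def
  proof (rule the_equality)
    have "sum (\<lambda>s. F (e s)) (?P q) = sum L (?P q)" for q using Fe by (intro sum.cong) auto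
    then show "(\<forall>x. x \<notin> edges T \<longrightarrow> F x = 0) \<and> (\<forall>q\<in>{1..r}. sum F (separating_edges T (i q) (l q) (j q) (k q)) =
        (real (l q) - real (k q)) * real B ^ (n - 3 - q))"
      using sum L by (simp add: F_def)
    fix f assume f: "(\<forall>x. x \<notin> edges T \<longrightarrow> f x = 0) \<and> (\<forall>q\<in>{1..r}. sum f (separating_edges T (i q) (l q) (j q) (k q)) =
        (real (l q) - real (k q)) * real B ^ (n - 3 - q))"
    have "sum (\<lambda>s. f (e s)) (?P q) = sum L (?P q)" if "q \<in> {1..r}" for q
      using f[THEN conjunct2, THEN bspec, OF that] sum[OF that, of f] L[OF that] by simp
    from triangular_unique[OF tri this] have fL: "f (e s) = L s" if "s \<in> {1..r}" for s using that by blast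
    show "f = F"
    proof
      fix x show "f x = F x"
      proof (cases "x \<in> edges T")
        case True
        then obtain s where "s \<in> {1..r}" "x = e s" using e unfolding bij_betw_def by blast
        then show ?thesis using fL Fe by simp
      qed (use f in \<open>simp add: F_def\<close>)
    qed
  qed
  then show ?thesis using Fe[OF q] by simp
qed

end

locale hypersurface_step = hypersurfaces n B "r + 1" S i j
  for n B r :: nat and S :: "nat \<Rightarrow> nat set" and i j :: "nat \<Rightarrow> nat"

sublocale hypersurface_step \<subseteq> prev: hypersurfaces n B r S i j
  using n3 B_large r_le S by unfold_locales auto

context hypersurface_step
begin

context
  fixes \<Gamma>' :: mtree and e :: "nat \<Rightarrow> nat set" and k l :: "nat \<Rightarrow> nat"
  assumes \<Gamma>': "\<Gamma>' \<in> M0n_trop n" and d': "trop_data n B S i j (r + 1) \<Gamma>' e k l"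
begin

private abbreviation P :: "nat \<Rightarrow> nat set" where
  "P q \<equiv> {s \<in> {1..r + 1}. quartet (\<lambda>s. cut \<Gamma>' (e s)) s (i q) (l q) (j q) (k q)}"

private lemma st': "stable_tree n \<Gamma>'"
  using \<Gamma>' by (simp add: M0n_trop_def)

private lemma tree': "is_tree (verts \<Gamma>') (edges \<Gamma>')"
  using st' by (simp add: stable_tree_def)

private lemma e': "bij_betw e {1..r + 1} (edges \<Gamma>')"
  using d' by (simp add: trop_data_def)

private lemma eE: "s \<in> {1..r + 1} \<Longrightarrow> e s \<in> edges \<Gamma>'"
  using bij_betwE[OF e'] by blast

private lemma adm': "q \<in> {1..r + 1} \<Longrightarrow> admissible (\<lambda>s. cut \<Gamma>' (e s)) (S q) (i q) (j q) q (k q) (l q)"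
  using d' by (simp add: trop_data_def)

private lemma legs': "q \<in> {1..r + 1} \<Longrightarrow> {i q, l q, j q, k q} \<subseteq> {1..n} \<and> k q < l q"
  using adm' S_legs unfolding admissible_def by blast

private lemma triP: "triangular P (r + 1)"
  using adm' by (intro admissible_triangular) auto

private lemma sumP: "q \<in> {1..r + 1} \<Longrightarrow> sum (\<lambda>s. len \<Gamma>' (e s)) (P q) = (real (l q) - real (k q)) * scale q"
  using d' by (simp add: trop_data_def scale_def)

private lemma remaining: "edges \<Gamma>' - {e (r + 1)} = e ` {1..r}" "s \<in> {1..r} \<Longrightarrow> e s \<in> edges \<Gamma>' - {e (r + 1)}"
proof -
  have "{1..r + 1} = insert (r + 1) {1..r}" by auto
  then have "edges \<Gamma>' = insert (e (r + 1)) (e ` {1..r})" using e' by (simp add: bij_betw_def)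
  moreover have ne: "e (r + 1) \<notin> e ` {1..r}"
  proof
    assume "e (r + 1) \<in> e ` {1..r}"
    then obtain s where "s \<in> {1..r}" "e (r + 1) = e s" by blast
    then show False using inj_onD[of e "{1..r + 1}" "r + 1" s] e' by (auto simp: bij_betw_def)
  qed
  ultimately show "edges \<Gamma>' - {e (r + 1)} = e ` {1..r}" by blast
  then show "s \<in> {1..r} \<Longrightarrow> e s \<in> edges \<Gamma>' - {e (r + 1)}" by blast
qed

context
  fixes \<Gamma> :: mtree and \<pi> :: "nat \<Rightarrow> nat"
  assumes con: "contraction n \<pi> \<Gamma>' (e (r + 1)) \<Gamma>"
begin

private lemma col: "collapses \<pi> (verts \<Gamma>') (edges \<Gamma>') {e (r + 1)} (verts \<Gamma>) (edges \<Gamma>)"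
  using contraction_collapses[OF con] .

private lemma att: "a \<in> {1..n} \<Longrightarrow> att \<Gamma> a = \<pi> (att \<Gamma>' a)"
  using con by (simp add: contraction_def)

lemma contraction_stable: "stable_tree n \<Gamma>"
  using collapse_stable[OF st' col _ att] by blast

lemma contraction_bij: "bij_betw (\<lambda>s. \<pi> ` e s) {1..r} (edges \<Gamma>)"
proof -
  have "bij_betw e {1..r} (edges \<Gamma>' - {e (r + 1)})"
    unfolding remaining(1) using e' by (auto simp: bij_betw_def inj_on_def)
  moreover have "bij_betw (\<lambda>f. \<pi> ` f) (edges \<Gamma>' - {e (r + 1)}) (edges \<Gamma>)"
    using collapse_inj[OF tree' col] collapse_edges[OF tree' col] by (simp add: bij_betw_def)
  ultimately show ?thesis using bij_betw_trans by (fastforce simp: comp_def)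
qed

lemma contraction_cut: "s \<in> {1..r} \<Longrightarrow> a \<in> {1..n} \<Longrightarrow> cut \<Gamma> (\<pi> ` e s) a = cut \<Gamma>' (e s) a"
  using collapse_cut[OF st' _ col att remaining(2)] n3 by auto

text \<open>The condition with index \<open>q\<close> concerns the splits with index at most \<open>q\<close> only, and these are not changed.\<close>

lemma contraction_admissible:
  assumes q: "q \<in> {1..r}"
  shows "admissible (\<lambda>s. cut \<Gamma> (\<pi> ` e s)) (S q) (i q) (j q) q (k q) (l q)"
proof -
  have q': "q \<in> {1..r + 1}" using q by simp
  have "admissible (\<lambda>s. cut \<Gamma> (\<pi> ` e s)) (S q) (i q) (j q) q (k q) (l q) =
      admissible (\<lambda>s. cut \<Gamma>' (e s)) (S q) (i q) (j q) q (k q) (l q)"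
    using S_legs[OF q'] q contraction_cut by (intro admissible_cong) auto
  then show ?thesis using adm'[OF q'] by simp
qed

lemma contraction_splits:
  assumes q: "q \<in> {1..r}"
  shows "{s \<in> {1..r}. quartet (\<lambda>s. cut \<Gamma> (\<pi> ` e s)) s (i q) (l q) (j q) (k q)} = P q - {r + 1}"
proof -
  have "{i q, l q, j q, k q} \<subseteq> {1..n}" using legs'[of q] q by auto
  then have "quartet (\<lambda>s. cut \<Gamma> (\<pi> ` e s)) s (i q) (l q) (j q) (k q) = quartet (\<lambda>s. cut \<Gamma>' (e s)) s (i q) (l q) (j q) (k q)"
    if "s \<in> {1..r}" for s unfolding quartet_def using contraction_cut[OF that] by simp
  then show ?thesis by auto
qed

text \<open>The splits of \<open>\<Gamma>\<close> determine its numbering and minimizing indices, which therefore are those inherited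
  from \<open>\<Gamma>'\<close>.\<close>

lemma contraction_trop_data:
  assumes \<Gamma>: "\<Gamma> \<in> M0n_trop n" and d: "trop_data n B S i j r \<Gamma> f k2 l2"
  shows "trop_data n B S i j r \<Gamma> (\<lambda>s. \<pi> ` e s) k l"
proof -
  have f: "bij_betw f {1..r} (edges \<Gamma>)" using d by (simp add: trop_data_def)
  have "\<forall>q\<in>{1..r}. f q = \<pi> ` e q \<and> k2 q = k q \<and> l2 q = l q"
  proof (rule admissible_numbering_unique[OF f contraction_bij, where Y = "cut \<Gamma>" and F = "{1..n}" and A = S and i = i and j = j])
    show "compatible (cut \<Gamma>) (edges \<Gamma>) {1..n}" using cut_family_compatible[OF contraction_stable] n3 by simp
    fix q assume q: "q \<in> {1..r}"
    show "S q \<subseteq> {1..n} \<and> i q \<in> S q \<and> j q \<in> S q" using prev.S_legs[OF q] .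
    show "admissible (\<lambda>s. cut \<Gamma> (f s)) (S q) (i q) (j q) q (k2 q) (l2 q)" using d q by (simp add: trop_data_def)
    show "admissible (\<lambda>s. cut \<Gamma> (\<pi> ` e s)) (S q) (i q) (j q) q (k q) (l q)" using contraction_admissible[OF q] .
  qed
  then have eq: "f q = \<pi> ` e q" "k2 q = k q" "l2 q = l q" if "q \<in> {1..r}" for q using that by auto
  have "(\<Sum>s | s \<in> {1..r} \<and> quartet (\<lambda>s. cut \<Gamma> (\<pi> ` e s)) s (i q) (l q) (j q) (k q). len \<Gamma> (\<pi> ` e s))
          = (real (l q) - real (k q)) * real B ^ (n - 3 - q)" if q: "q \<in> {1..r}" for q
  proof -
    have "(\<Sum>s | s \<in> {1..r} \<and> quartet (\<lambda>s. cut \<Gamma> (\<pi> ` e s)) s (i q) (l q) (j q) (k q). len \<Gamma> (\<pi> ` e s)) =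
       (\<Sum>s | s \<in> {1..r} \<and> quartet (\<lambda>s. cut \<Gamma> (f s)) s (i q) (l2 q) (j q) (k2 q). len \<Gamma> (f s))"
      unfolding eq(2,3)[OF q]
      by (intro sum.cong Collect_cong conj_cong refl) (simp_all only: quartet_def eq(1) mem_Collect_eq)
    also have "\<dots> = (real (l2 q) - real (k2 q)) * real B ^ (n - 3 - q)"
      using prev.trop_data_sum[OF d q] unfolding scale_def .
    finally show ?thesis unfolding eq(2,3)[OF q] .
  qed
  then show ?thesis unfolding trop_data_def using contraction_bij contraction_admissible by blast
qed

lemma contraction_near:
  assumes d: "trop_data n B S i j r \<Gamma> (\<lambda>s. \<pi> ` e s) k l"
  shows "near_contraction n B r \<Gamma>' \<Gamma>"
  unfolding near_contraction_def
proof (intro exI conjI ballI)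
  show "edge_numbering n B (r + 1) \<Gamma>' e" using trop_data_numbering[OF d'] .
  show "contraction n \<pi> \<Gamma>' (e (r + 1)) \<Gamma>" by (rule con)
  fix q assume q: "q \<in> {1..r}"
  let ?L = "\<lambda>s. len \<Gamma>' (e s)" and ?L' = "\<lambda>s. len \<Gamma> (\<pi> ` e s)"
  have eqs: "sum ?L (P q) = sum ?L' (P q - {r + 1})" if q: "q \<in> {1..r}" for q
    using sumP[of q] prev.trop_data_sum[OF d q] q unfolding contraction_splits[OF q] by simp
  have last: "scale (r + 1) / 2 \<le> ?L (r + 1)" "?L (r + 1) \<le> (real n - 1) * scale (r + 1)"
    using trop_data_sizes[OF d', of "r + 1"] by auto
  then have "?L (r + 1) \<ge> 0" using c_pos[of "r + 1"] by linarith
  then have "\<bar>?L q - ?L' q\<bar> \<le> 2 ^ (r - q) * ?L (r + 1)"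
    using triangular_perturbation[OF triP eqs _ q] by simp
  also have "\<dots> \<le> 2 ^ n * ((real n - 1) * scale (r + 1))"
    using r_le \<open>?L (r + 1) \<ge> 0\<close> last(2) by (intro mult_mono power_increasing) auto
  also have "\<dots> < 2 ^ n * (real n * scale (r + 1))"
    using c_pos[of "r + 1"] by (intro mult_strict_left_mono mult_strict_right_mono) auto
  finally show "\<bar>len \<Gamma>' (e q) - len \<Gamma> (\<pi> ` e q)\<bar> < real n * 2 ^ n * real B ^ (n - 3 - (r + 1))"
    by (simp add: scale_def mult_ac)
qed

end

text \<open>The triangular system without its last unknown has a solution, which is positive by \<open>triangular_sizes\<close>.\<close>

lemma contraction_exists:
  "\<exists>\<Gamma> \<pi>. contraction n \<pi> \<Gamma>' (e (r + 1)) \<Gamma> \<and> \<Gamma> \<in> M0n_trop n \<and> trop_data n B S i j r \<Gamma> (\<lambda>s. \<pi> ` e s) k l"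
proof -
  obtain x y where xy: "e (r + 1) = {x, y}" "x \<noteq> y" "x \<in> verts \<Gamma>'" "y \<in> verts \<Gamma>'"
    using tree_edge[OF tree' eE[of "r + 1"]] by auto
  define \<pi> where "\<pi> u = (if u = y then x else u)" for u
  define T where "T len = \<lparr>verts = \<pi> ` verts \<Gamma>', edges = (\<lambda>f. \<pi> ` f) ` (edges \<Gamma>' - {e (r + 1)}), att = \<lambda>a. \<pi> (att \<Gamma>' a),
      len = len\<rparr>" for len :: "nat set \<Rightarrow> real"
  have con: "contraction n \<pi> \<Gamma>' (e (r + 1)) (T len)" for len
  proof -
    have "\<pi> u = \<pi> v \<longleftrightarrow> u = v \<or> {u, v} = e (r + 1)" for u v
      unfolding xy(1) \<pi>_def by (auto simp: doubleton_eq_iff)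
    then show ?thesis unfolding contraction_def using eE[of "r + 1"] by (auto simp: T_def)
  qed
  let ?T0 = "T (\<lambda>_. 0)"
  let ?Q = "\<lambda>q. {s \<in> {1..r}. quartet (\<lambda>s. cut ?T0 (\<pi> ` e s)) s (i q) (l q) (j q) (k q)}"
  have tri: "triangular ?Q r" using contraction_admissible[OF con] by (intro admissible_triangular) auto
  obtain L :: "nat \<Rightarrow> real" where L: "\<And>q. q \<in> {1..r} \<Longrightarrow> sum L (?Q q) = (real (l q) - real (k q)) * scale q"
    using triangular_solvable[OF tri, of "\<lambda>q. (real (l q) - real (k q)) * scale q"] by blast
  let ?e = "\<lambda>s. \<pi> ` e s"
  define \<Gamma> where "\<Gamma> = T (\<lambda>f. L (inv_into {1..r} ?e f))"
  have con\<Gamma>: "contraction n \<pi> \<Gamma>' (e (r + 1)) \<Gamma>" unfolding \<Gamma>_def by (rule con)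
  have bij: "bij_betw ?e {1..r} (edges \<Gamma>)" using contraction_bij[OF con\<Gamma>] .
  have len: "len \<Gamma> (?e s) = L s" if "s \<in> {1..r}" for s
    using bij_betw_inv_into_left[OF bij that] by (simp add: \<Gamma>_def T_def)
  have cut: "cut \<Gamma> = cut ?T0" unfolding \<Gamma>_def T_def cut_def by (simp add: fun_eq_iff)
  have pos: "L q > 0" if q: "q \<in> {1..r}" for q
  proof -
    have "scale q / 2 \<le> L q \<and> L q \<le> (real n - 1) * scale q"
    proof (rule prev.triangular_sizes[OF tri _ q])
      fix q assume q: "q \<in> {1..r}"
      then have "k q \<in> {1..n}" "l q \<in> {1..n}" "k q < l q" using legs'[of q] by auto
      then show "scale q \<le> sum L (?Q q) \<and> sum L (?Q q) \<le> (real n - 1) * scale q"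
        unfolding L[OF q] using difference_bounds by blast
    qed
    then show ?thesis using c_pos[of q] by linarith
  qed
  have "\<Gamma> \<in> M0n_trop n"
  proof -
    have "len \<Gamma> f > 0" if "f \<in> edges \<Gamma>" for f
    proof -
      obtain s where "s \<in> {1..r}" "f = ?e s" using \<open>f \<in> edges \<Gamma>\<close> bij unfolding bij_betw_def by blast
      then show ?thesis using len pos by simp
    qed
    then show ?thesis unfolding M0n_trop_def using contraction_stable[OF con\<Gamma>] by blast
  qed
  moreover have "trop_data n B S i j r \<Gamma> ?e k l"
  proof -
    have "sum (\<lambda>s. len \<Gamma> (?e s)) (?Q q) = sum L (?Q q)" for q using len by (intro sum.cong) auto
    then show ?thesis unfolding trop_data_def cut
      using bij contraction_admissible[OF con] L by (simp add: scale_def)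
  qed
  ultimately show ?thesis using con\<Gamma> by blast
qed

text \<open>The lengths of both trees solve the same triangular system.\<close>

lemma contraction_unique:
  assumes con: "contraction n \<pi> \<Gamma>' (e (r + 1)) \<Gamma>" "contraction n \<pi>2 \<Gamma>' (e (r + 1)) \<Gamma>2"
    and d: "trop_data n B S i j r \<Gamma> (\<lambda>s. \<pi> ` e s) k l" "trop_data n B S i j r \<Gamma>2 (\<lambda>s. \<pi>2 ` e s) k l"
  shows "isometric n \<Gamma> \<Gamma>2"
proof -
  define f where "f u = \<pi>2 (inv_into (verts \<Gamma>') \<pi> u)" for u
  note col = contraction_collapses[OF con(1)] and col2 = contraction_collapses[OF con(2)]
  note V = collapse_verts[OF tree' col] collapse_verts[OF tree' col2]
  have f: "f (\<pi> u) = \<pi>2 u" if u: "u \<in> verts \<Gamma>'" for u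
  proof -
    let ?u = "inv_into (verts \<Gamma>') \<pi> (\<pi> u)"
    have "?u \<in> verts \<Gamma>'" "\<pi> ?u = \<pi> u" using u by (auto intro: inv_into_into f_inv_into_f)
    then show ?thesis unfolding f_def
      using collapse_fibre[OF tree' col _ u] collapse_fibre[OF tree' col2 _ u] by blast
  qed
  have fi: "f ` (\<pi> ` A) = \<pi>2 ` A" if "A \<subseteq> verts \<Gamma>'" for A
    using f that by (auto simp: image_image intro!: image_cong)
  have edgeV: "g \<subseteq> verts \<Gamma>'" if "g \<in> edges \<Gamma>'" for g using tree_edge[OF tree' that] by blast
  have bij: "bij_betw f (verts \<Gamma>) (verts \<Gamma>2)"
  proof -
    have "inj_on f (verts \<Gamma>)"
    proof (rule inj_onI)
      fix a b assume ab: "a \<in> verts \<Gamma>" "b \<in> verts \<Gamma>" "f a = f b"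
      then obtain u w where uw: "u \<in> verts \<Gamma>'" "a = \<pi> u" "w \<in> verts \<Gamma>'" "b = \<pi> w" using V(1) by auto
      then show "a = b" using ab(3) f collapse_fibre[OF tree' col uw(1,3)] collapse_fibre[OF tree' col2 uw(1,3)] by metis
    qed
    then show ?thesis unfolding bij_betw_def V using fi[of "verts \<Gamma>'"] by simp
  qed
  have E: "edges \<Gamma> = (\<lambda>s. \<pi> ` e s) ` {1..r}" "edges \<Gamma>2 = (\<lambda>s. \<pi>2 ` e s) ` {1..r}"
    using contraction_bij[OF con(1)] contraction_bij[OF con(2)] by (simp_all add: bij_betw_def)
  have fe: "f ` (\<pi> ` e s) = \<pi>2 ` e s" if "s \<in> {1..r}" for s using that eE[of s] edgeV by (intro fi) auto
  have lens: "len \<Gamma> (\<pi> ` e s) = len \<Gamma>2 (\<pi>2 ` e s)" if s: "s \<in> {1..r}" for s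
  proof (rule triangular_unique[OF _ _ s, where L = "\<lambda>s. len \<Gamma> (\<pi> ` e s)" and L' = "\<lambda>s. len \<Gamma>2 (\<pi>2 ` e s)"])
    show "triangular (\<lambda>q. {s \<in> {1..r}. quartet (\<lambda>s. cut \<Gamma> (\<pi> ` e s)) s (i q) (l q) (j q) (k q)}) r"
      using contraction_admissible[OF con(1)] by (intro admissible_triangular) auto
    fix q assume q: "q \<in> {1..r}"
    have "sum (\<lambda>s. len \<Gamma> (\<pi> ` e s)) (P q - {r + 1}) = sum (\<lambda>s. len \<Gamma>2 (\<pi>2 ` e s)) (P q - {r + 1})"
      using prev.trop_data_sum[OF d(1) q] prev.trop_data_sum[OF d(2) q]
      unfolding contraction_splits[OF con(1) q] contraction_splits[OF con(2) q] by simp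
    then show "sum (\<lambda>s. len \<Gamma> (\<pi> ` e s)) {s \<in> {1..r}. quartet (\<lambda>s. cut \<Gamma> (\<pi> ` e s)) s (i q) (l q) (j q) (k q)} =
      sum (\<lambda>s. len \<Gamma>2 (\<pi>2 ` e s)) {s \<in> {1..r}. quartet (\<lambda>s. cut \<Gamma> (\<pi> ` e s)) s (i q) (l q) (j q) (k q)}"
      unfolding contraction_splits[OF con(1) q] .
  qed
  show ?thesis unfolding isometric_def
  proof (intro exI[of _ f] conjI ballI)
    have "(\<lambda>g. f ` g) ` edges \<Gamma> = (\<lambda>s. f ` (\<pi> ` e s)) ` {1..r}" unfolding E(1) by (rule image_image)
    also have "\<dots> = edges \<Gamma>2" unfolding E(2) by (intro image_cong refl fe)
    finally show "edges \<Gamma>2 = (\<lambda>g. f ` g) ` edges \<Gamma>" ..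
    show "att \<Gamma>2 a = f (att \<Gamma> a)" if "a \<in> {1..n}" for a
      using that con f st' by (simp add: contraction_def stable_tree_def)
    show "len \<Gamma>2 (f ` g) = len \<Gamma> g" if "g \<in> edges \<Gamma>" for g using that fe lens unfolding E by auto
  qed (rule bij)
qed

end

end

section \<open>Insertions and contractions are inverse to each other\<close>

lemma isometric_near_contraction:
  assumes st: "stable_tree n \<Gamma>1" and iso: "isometric n \<Gamma>1 \<Gamma>2"
    and near: "near_contraction n B r \<Gamma>1 \<Gamma>"
  shows "near_contraction n B r \<Gamma>2 \<Gamma>"
proof -
  have tree: "is_tree (verts \<Gamma>1) (edges \<Gamma>1)" using st by (simp add: stable_tree_def)
  obtain f where f: "bij_betw f (verts \<Gamma>1) (verts \<Gamma>2)" "edges \<Gamma>2 = (\<lambda>e. f ` e) ` edges \<Gamma>1"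
    "\<forall>l\<in>{1..n}. att \<Gamma>2 l = f (att \<Gamma>1 l)" "\<forall>e\<in>edges \<Gamma>1. len \<Gamma>2 (f ` e) = len \<Gamma>1 e"
    using iso by (auto simp: isometric_def)
  obtain e \<pi> where e: "edge_numbering n B (r + 1) \<Gamma>1 e" and con: "contraction n \<pi> \<Gamma>1 (e (r + 1)) \<Gamma>"
    and close: "\<forall>q\<in>{1..r}. \<bar>len \<Gamma>1 (e q) - len \<Gamma> (\<pi> ` e q)\<bar> < real n * 2 ^ n * real B ^ (n - 3 - (r + 1))"
    using near by (auto simp: near_contraction_def)
  define g where "g = inv_into (verts \<Gamma>1) f"
  have gf: "g (f u) = u" if "u \<in> verts \<Gamma>1" for u using bij_betw_inv_into_left[OF f(1) that] by (simp add: g_def)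
  have edgeV: "x \<subseteq> verts \<Gamma>1" if "x \<in> edges \<Gamma>1" for x using tree_edge[OF tree that] by blast
  have gfi: "g ` f ` A = A" if "A \<subseteq> verts \<Gamma>1" for A
  proof -
    have "g ` f ` A = (\<lambda>u. u) ` A" unfolding image_image using gf that by (intro image_cong) auto
    then show ?thesis by simp
  qed
  have bij: "bij_betw e {1..r + 1} (edges \<Gamma>1)" using e by (simp add: edge_numbering_def)
  have eE: "e q \<in> edges \<Gamma>1" if "q \<in> {1..r + 1}" for q using bij_betwE[OF bij] that by blast
  have inj: "inj_on (\<lambda>x. f ` x) (edges \<Gamma>1)"
    by (rule inj_on_inverseI[of _ "\<lambda>x. g ` x"]) (use gfi edgeV in blast)
  have fe: "(\<pi> \<circ> g) ` (f ` x) = \<pi> ` x" if "x \<in> edges \<Gamma>1" for x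
    by (simp only: image_comp[symmetric] gfi[OF edgeV[OF that]])
  show ?thesis unfolding near_contraction_def
  proof (intro exI conjI ballI)
    have "bij_betw (\<lambda>q. f ` e q) {1..r + 1} (edges \<Gamma>2)"
    proof -
      have "bij_betw (\<lambda>x. f ` x) (edges \<Gamma>1) (edges \<Gamma>2)" using inj f(2) by (simp add: bij_betw_def)
      from bij_betw_trans[OF bij this] show ?thesis by (simp add: comp_def)
    qed
    then show "edge_numbering n B (r + 1) \<Gamma>2 (\<lambda>q. f ` e q)"
      using e f(4) eE unfolding edge_numbering_def by simp
    have "verts \<Gamma> = (\<pi> \<circ> g) ` verts \<Gamma>2"
    proof -
      have "verts \<Gamma>2 = f ` verts \<Gamma>1" using f(1) by (simp add: bij_betw_def)
      then have "(\<pi> \<circ> g) ` verts \<Gamma>2 = \<pi> ` verts \<Gamma>1"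
        by (simp only: image_comp[symmetric] gfi[OF order.refl])
      then show ?thesis using con by (simp add: contraction_def)
    qed
    moreover have "(\<pi> \<circ> g) u = (\<pi> \<circ> g) w \<longleftrightarrow> u = w \<or> {u, w} = f ` e (r + 1)"
      if uw: "u \<in> verts \<Gamma>2" "w \<in> verts \<Gamma>2" for u w
    proof -
      obtain a b where ab: "u = f a" "a \<in> verts \<Gamma>1" "w = f b" "b \<in> verts \<Gamma>1"
        using uw f(1) unfolding bij_betw_def by blast
      have "u = w \<longleftrightarrow> a = b" using ab gf by metis
      moreover have "{u, w} = f ` e (r + 1) \<longleftrightarrow> {a, b} = e (r + 1)"
      proof
        assume "{u, w} = f ` e (r + 1)"
        then have "f ` {a, b} = f ` e (r + 1)" using ab by simp
        then have "g ` f ` {a, b} = g ` f ` e (r + 1)" by simp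
        then show "{a, b} = e (r + 1)" using gfi[of "{a, b}"] gfi[OF edgeV[OF eE[of "r + 1"]]] ab by simp
      next
        assume "{a, b} = e (r + 1)"
        from this[symmetric] show "{u, w} = f ` e (r + 1)" using ab by simp
      qed
      ultimately show ?thesis using con ab gf by (simp add: contraction_def)
    qed
    moreover have "edges \<Gamma> = (\<lambda>x. (\<pi> \<circ> g) ` x) ` (edges \<Gamma>2 - {f ` e (r + 1)})"
    proof -
      have "edges \<Gamma>2 - {f ` e (r + 1)} = (\<lambda>x. f ` x) ` (edges \<Gamma>1 - {e (r + 1)})"
        using inj_on_image_set_diff[OF inj, of "edges \<Gamma>1" "{e (r + 1)}"] eE[of "r + 1"] f(2) by simp
      then have "(\<lambda>x. (\<pi> \<circ> g) ` x) ` (edges \<Gamma>2 - {f ` e (r + 1)}) = (\<lambda>x. (\<pi> \<circ> g) ` (f ` x)) ` (edges \<Gamma>1 - {e (r + 1)})"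
        by (simp only: image_image)
      also have "\<dots> = (\<lambda>x. \<pi> ` x) ` (edges \<Gamma>1 - {e (r + 1)})" by (rule image_cong[OF refl]) (rule fe, blast)
      finally show ?thesis using con by (simp add: contraction_def)
    qed
    moreover have "att \<Gamma> l = (\<pi> \<circ> g) (att \<Gamma>2 l)" if l: "l \<in> {1..n}" for l
      using con f(3) gf st l by (simp add: contraction_def stable_tree_def)
    ultimately show "contraction n (\<pi> \<circ> g) \<Gamma>2 (f ` e (r + 1)) \<Gamma>"
      unfolding contraction_def using f(2) eE[of "r + 1"] by auto
    fix q assume q: "q \<in> {1..r}"
    then have qE: "e q \<in> edges \<Gamma>1" using eE by simp
    show "\<bar>len \<Gamma>2 (f ` e q) - len \<Gamma> ((\<pi> \<circ> g) ` (f ` e q))\<bar> < real n * 2 ^ n * real B ^ (n - 3 - (r + 1))"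
      unfolding fe[OF qE] using f(4) qE close q by simp
  qed
qed

context hypersurface_step
begin

text \<open>Splitting \<open>v\<close> adds the split described in \<open>allowable_imp_admissible\<close> to those of \<open>\<Gamma>\<close>, and the conditions on the
  latter persist. Hence the readjusted lengths solve a triangular system and are positive.\<close>

lemma insertion_near_contraction:
  assumes \<Gamma>: "\<Gamma> \<in> M0n_trop n" and d: "trop_data n B S i j r \<Gamma> e k l"
    and ins: "allowable_insertion n B S i j r \<Gamma> \<Gamma>'"
  shows "\<Gamma>' \<in> M0n_trop n \<and> (\<exists>e k l. trop_data n B S i j (r + 1) \<Gamma>' e k l) \<and> near_contraction n B r \<Gamma>' \<Gamma>"
proof -
  let ?A = "S (r + 1)" and ?a = "i (r + 1)" and ?b = "j (r + 1)"
  obtain v w B1 B2 where hull: "hull_vertex n \<Gamma> ?A ?a v" and w: "w \<notin> verts \<Gamma>"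
    and all: "allowable_partition n \<Gamma> ?A ?a ?b v B1 B2"
    and iso: "let T = split_vertex \<Gamma> v w B1;
             k = (\<lambda>q. if q \<le> r then fst (min_pair n B S i j \<Gamma> q) else k_new n \<Gamma> ?A ?a ?b v);
             l = (\<lambda>q. if q \<le> r then snd (min_pair n B S i j \<Gamma> q) else l_new n \<Gamma> ?A ?a v B1)
         in isometric n \<lparr> verts = verts T, edges = edges T, att = att T,
                len = readjusted_len n B i j k l (r + 1) T \<rparr> \<Gamma>'"
    using ins unfolding allowable_insertion_def by blast
  define T where "T = split_vertex \<Gamma> v w B1"
  define kk where "kk = (\<lambda>q. if q \<le> r then fst (min_pair n B S i j \<Gamma> q) else k_new n \<Gamma> ?A ?a ?b v)"
  define ll where "ll = (\<lambda>q. if q \<le> r then snd (min_pair n B S i j \<Gamma> q) else l_new n \<Gamma> ?A ?a v B1)"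
  define T' where "T' = \<lparr> verts = verts T, edges = edges T, att = att T, len = readjusted_len n B i j kk ll (r + 1) T \<rparr>"
  have iso': "isometric n T' \<Gamma>'" using iso unfolding Let_def T'_def T_def kk_def ll_def .
  have st: "stable_tree n \<Gamma>" using \<Gamma> by (simp add: M0n_trop_def)
  have A: "?A \<subseteq> {1..n}" "?a \<in> ?A" "?b \<in> ?A" "?a \<noteq> ?b" using S[of "r + 1"] by auto
  have v: "v \<in> verts \<Gamma>" using hull unfolding hull_vertex_iff[OF \<Gamma> A(1,2)] by blast
  note all' = all[unfolded allowable_partition_def]
  have part: "B1 \<union> B2 = branches n \<Gamma> v" "B1 \<inter> B2 = {}" "branch n \<Gamma> v (Leg ?a) \<in> B1" using all' by blast+
  note split = st v w part(1,2)
  have two1: "\<exists>\<beta>\<in>B1. \<exists>\<beta>'\<in>B1. \<beta> \<noteq> \<beta>'" using all' by blast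
  have two2: "\<exists>\<beta>\<in>B2. \<exists>\<beta>'\<in>B2. \<beta> \<noteq> \<beta>'"
  proof (intro bexI)
    let ?K = "{s \<in> ?A. Leg s \<notin> branch n \<Gamma> v (Leg ?a) \<union> branch n \<Gamma> v (Leg ?b)}"
    obtain \<beta> s where s: "\<beta> \<in> B1 - {branch n \<Gamma> v (Leg ?a)}" "s \<in> ?A" "Leg s \<in> \<beta>" using all' by (auto simp: meets_def)
    have sub: "B1 - {branch n \<Gamma> v (Leg ?a)} \<subseteq> branches n \<Gamma> v" using part(1) by blast
    have bs: "branch n \<Gamma> v (Leg s) \<in> B1 - {branch n \<Gamma> v (Leg ?a)}" using site_mem_Union_iff[OF sub] s by blast
    have "branch n \<Gamma> v (Leg ?b) \<in> B2" using all' by simp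
    then have "branch n \<Gamma> v (Leg ?b) \<noteq> branch n \<Gamma> v (Leg s)"
      "branch n \<Gamma> v (Leg ?a) \<noteq> branch n \<Gamma> v (Leg s)" using bs part(2) by auto
    then have "s \<in> ?K" using s(2) unfolding branch_eq_iff_mem by blast
    then have "?K \<noteq> {}" by blast
    moreover have "finite ?K" using A(1) finite_subset by fastforce
    ultimately have "k_new n \<Gamma> ?A ?a ?b v \<in> ?K" unfolding k_new_def by (rule Min_in[rotated])
    then have "Leg (k_new n \<Gamma> ?A ?a ?b v) \<notin> branch n \<Gamma> v (Leg ?b)" by blast
    then show "branch n \<Gamma> v (Leg ?b) \<noteq> branch n \<Gamma> v (Leg (k_new n \<Gamma> ?A ?a ?b v))"
      unfolding branch_eq_iff_mem .
  qed (use all' in blast)+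
  have stT: "stable_tree n T" unfolding T_def using split_stable[OF split two1 two2] .
  have treeT: "is_tree (verts T) (edges T)" using stT by (simp add: stable_tree_def)
  define \<rho> where "\<rho> = id(w := v)"
  have conT: "contraction n \<rho> T {v, w} \<Gamma>" unfolding T_def \<rho>_def using split_contraction[OF split] .
  note colT = contraction_collapses[OF conT]
  have attT: "att \<Gamma> a = \<rho> (att T a)" if "a \<in> {1..n}" for a using conT that by (simp add: contraction_def)
  have e: "bij_betw e {1..r} (edges \<Gamma>)" using d by (simp add: trop_data_def)
  have bijc: "bij_betw (\<lambda>f. \<rho> ` f) (edges T - {{v, w}}) (edges \<Gamma>)"
    using collapse_inj[OF treeT colT] collapse_edges[OF treeT colT] by (simp add: bij_betw_def)
  define e' where "e' s = (if s \<le> r then inv_into (edges T - {{v, w}}) (\<lambda>f. \<rho> ` f) (e s) else {v, w})" for s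
  have vwT: "{v, w} \<in> edges T" using conT by (simp add: contraction_def)
  have old: "e' s \<in> edges T - {{v, w}}" "\<rho> ` e' s = e s" if s: "s \<in> {1..r}" for s
  proof -
    have eE: "e s \<in> edges \<Gamma>" using bij_betwE[OF e] s by blast
    have es: "e' s = inv_into (edges T - {{v, w}}) (\<lambda>f. \<rho> ` f) (e s)" using s by (simp add: e'_def)
    show "e' s \<in> edges T - {{v, w}}" unfolding es using bij_betwE[OF bij_betw_inv_into[OF bijc]] eE by blast
    show "\<rho> ` e' s = e s" unfolding es using bij_betw_inv_into_right[OF bijc eE] .
  qed
  have last: "e' (r + 1) = {v, w}" by (simp add: e'_def)
  have bij': "bij_betw e' {1..r + 1} (edges T)"
  proof -
    have "bij_betw (inv_into (edges T - {{v, w}}) (\<lambda>f. \<rho> ` f) \<circ> e) {1..r} (edges T - {{v, w}})"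
      using bij_betw_trans[OF e bij_betw_inv_into[OF bijc]] .
    then have "bij_betw e' {1..r} (edges T - {{v, w}})"
      by (rule bij_betw_cong[THEN iffD1, rotated]) (simp add: e'_def)
    then have "bij_betw e' ({1..r} \<union> {r + 1}) ((edges T - {{v, w}}) \<union> {{v, w}})"
      by (rule bij_betw_combine) (use last in \<open>auto simp: bij_betw_def\<close>)
    moreover have "{1..r} \<union> {r + 1} = {1..r + 1}" "(edges T - {{v, w}}) \<union> {{v, w}} = edges T" using vwT by auto
    ultimately show ?thesis by simp
  qed
  define Y where "Y s = cut T (e' s)" for s
  have Yold: "Y s c = cut \<Gamma> (e s) c" if "s \<in> {1..r}" "c \<in> {1..n}" for s c
    using collapse_cut[OF stT _ colT attT old(1)[OF that(1)] that(2)] n3 old(2)[OF that(1)] by (simp add: Y_def)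
  have Ynew: "Y (r + 1) c = Y (r + 1) d \<longleftrightarrow> (branch n \<Gamma> v (Leg c) \<in> B1 \<longleftrightarrow> branch n \<Gamma> v (Leg d) \<in> B1)"
    if "c \<in> {1..n}" "d \<in> {1..n}" for c d
    using cut_neq_iff[OF stT vwT that] split_cut[OF split that] n3 unfolding Y_def last T_def by auto
  have adm: "admissible Y (S q) (i q) (j q) q (kk q) (ll q)" if q: "q \<in> {1..r + 1}" for q
  proof (cases "q \<le> r")
    case True
    then have q': "q \<in> {1..r}" using q by simp
    have kl: "kk q = k q" "ll q = l q"
      using True prev.trop_data_min_pair[OF \<Gamma> d q'] by (simp_all add: kk_def ll_def)
    have "admissible Y (S q) (i q) (j q) q (k q) (l q) = admissible (\<lambda>s. cut \<Gamma> (e s)) (S q) (i q) (j q) q (k q) (l q)"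
      using prev.S_legs[OF q'] q' Yold by (intro admissible_cong) auto
    then show ?thesis using d q' unfolding kl by (simp add: trop_data_def)
  next
    case False
    then have "q = r + 1" using q by simp
    then show ?thesis
      using allowable_imp_admissible[OF \<Gamma> e Yold A v part Ynew hull all] by (simp add: kk_def ll_def)
  qed
  have legs: "kk q \<in> {1..n} \<and> ll q \<in> {1..n}" "kk q < ll q" if "q \<in> {1..r + 1}" for q
    using adm[OF that] S_legs[OF that] unfolding admissible_def by blast+
  let ?P = "\<lambda>q. {s \<in> {1..r + 1}. quartet (\<lambda>s. cut T (e' s)) s (i q) (ll q) (j q) (kk q)}"
  have tri: "triangular ?P (r + 1)" using adm unfolding Y_def by (intro admissible_triangular) auto
  obtain L :: "nat \<Rightarrow> real" where L: "\<And>q. q \<in> {1..r + 1} \<Longrightarrow> sum L (?P q) = (real (ll q) - real (kk q)) * scale q"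
    using triangular_solvable[OF tri, of "\<lambda>q. (real (ll q) - real (kk q)) * scale q"] by blast
  have len: "len T' (e' q) = L q" if "q \<in> {1..r + 1}" for q
    using readjusted_len_eq[OF stT bij' legs(1) tri _ that] L unfolding T'_def scale_def by simp
  have pos: "L q > 0" if q: "q \<in> {1..r + 1}" for q
  proof -
    have "scale q / 2 \<le> L q \<and> L q \<le> (real n - 1) * scale q"
    proof (rule triangular_sizes[OF tri _ q])
      fix q assume q: "q \<in> {1..r + 1}"
      show "scale q \<le> sum L (?P q) \<and> sum L (?P q) \<le> (real n - 1) * scale q"
        unfolding L[OF q] using difference_bounds legs[OF q] by blast
    qed
    then show ?thesis using c_pos[of q] by linarith
  qed
  have T'_simps: "verts T' = verts T" "edges T' = edges T" "att T' = att T" by (simp_all add: T'_def)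
  have T'M: "T' \<in> M0n_trop n"
  proof -
    have "stable_tree n T'" using stT unfolding stable_tree_def T'_simps .
    moreover have "len T' f > 0" if f: "f \<in> edges T'" for f
    proof -
      obtain s where "s \<in> {1..r + 1}" "f = e' s" using f bij' unfolding bij_betw_def T'_simps by blast
      then show ?thesis using len pos by simp
    qed
    ultimately show ?thesis by (simp add: M0n_trop_def)
  qed
  have cut': "cut T' = cut T" by (simp add: fun_eq_iff cut_def T'_simps)
  have d': "trop_data n B S i j (r + 1) T' e' kk ll"
  proof -
    have "sum (\<lambda>s. len T' (e' s)) (?P q) = (real (ll q) - real (kk q)) * real B ^ (n - 3 - q)" if q: "q \<in> {1..r + 1}" for q
    proof -
      have "sum (\<lambda>s. len T' (e' s)) (?P q) = sum L (?P q)" using len by (intro sum.cong) auto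
      then show ?thesis using L[OF q] by (simp add: scale_def)
    qed
    then show ?thesis unfolding trop_data_def cut' T'_simps using bij' adm unfolding Y_def by blast
  qed
  have con': "contraction n \<rho> T' (e' (r + 1)) \<Gamma>" using conT unfolding last contraction_def T'_simps .
  have "near_contraction n B r T' \<Gamma>"
    using contraction_near[OF T'M d' con' contraction_trop_data[OF T'M d' con' \<Gamma> d]] .
  then have "near_contraction n B r \<Gamma>' \<Gamma>"
    using isometric_near_contraction[OF _ iso'] T'M by (simp add: M0n_trop_def)
  then show ?thesis using isometric_trop_data[OF T'M d' iso'] by blast
qed

lemma readjusted_len_cong:
  assumes "\<And>q. q \<in> {1..s} \<Longrightarrow> k q = k' q \<and> l q = l' q"
  shows "readjusted_len n B i j k l s T = readjusted_len n B i j k' l' s T"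
proof -
  have "(\<forall>q\<in>{1..s}. (\<Sum>e\<in>separating_edges T (i q) (l q) (j q) (k q). f e) = (real (l q) - real (k q)) * real B ^ (n - 3 - q)) \<longleftrightarrow>
      (\<forall>q\<in>{1..s}. (\<Sum>e\<in>separating_edges T (i q) (l' q) (j q) (k' q). f e) = (real (l' q) - real (k' q)) * real B ^ (n - 3 - q))"
    for f :: "nat set \<Rightarrow> real"
    using assms by (intro ball_cong refl) simp
  then show ?thesis unfolding readjusted_len_def by simp
qed

text \<open>Conversely, the branches of \<open>\<Gamma>\<close> at the vertex onto which an edge of \<open>\<Gamma>'\<close> was contracted fall into
  two classes, according to the end of that edge that they are attached to.\<close>

lemma near_contraction_insertion:
  assumes \<Gamma>: "\<Gamma> \<in> M0n_trop n" and d: "trop_data n B S i j r \<Gamma> f k0 l0"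
    and \<Gamma>': "\<Gamma>' \<in> M0n_trop n" and d': "trop_data n B S i j (r + 1) \<Gamma>' e k l"
    and near: "near_contraction n B r \<Gamma>' \<Gamma>"
  shows "allowable_insertion n B S i j r \<Gamma> \<Gamma>'"
proof -
  let ?A = "S (r + 1)" and ?a = "i (r + 1)" and ?b = "j (r + 1)" and ?e0 = "e (r + 1)"
  have st: "stable_tree n \<Gamma>" and st': "stable_tree n \<Gamma>'" using \<Gamma> \<Gamma>' by (simp_all add: M0n_trop_def)
  have tree: "is_tree (verts \<Gamma>) (edges \<Gamma>)" and tree': "is_tree (verts \<Gamma>') (edges \<Gamma>')"
    and V: "\<And>c. c \<in> {1..n} \<Longrightarrow> att \<Gamma> c \<in> verts \<Gamma>" and V': "\<And>c. c \<in> {1..n} \<Longrightarrow> att \<Gamma>' c \<in> verts \<Gamma>'"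
    using st st' by (auto simp: stable_tree_def)
  have A: "?A \<subseteq> {1..n}" "?a \<in> ?A" "?b \<in> ?A" "?a \<noteq> ?b" using S[of "r + 1"] by auto
  obtain e2 \<pi> where e2: "edge_numbering n B (r + 1) \<Gamma>' e2" and con2: "contraction n \<pi> \<Gamma>' (e2 (r + 1)) \<Gamma>"
    using near by (auto simp: near_contraction_def)
  have con: "contraction n \<pi> \<Gamma>' ?e0 \<Gamma>"
    using con2 edge_numbering_unique[OF e2 trop_data_numbering[OF d'], of "r + 1"] by simp
  note col = contraction_collapses[OF con]
  note fib = collapse_fibre[OF tree' col]
  have vertsG: "verts \<Gamma> = \<pi> ` verts \<Gamma>'" and edgesG: "edges \<Gamma> = (\<lambda>x. \<pi> ` x) ` (edges \<Gamma>' - {?e0})"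
    using collapse_verts[OF tree' col] collapse_edges[OF tree' col] .
  have e0E: "?e0 \<in> edges \<Gamma>'" using con by (simp add: contraction_def)
  have att: "att \<Gamma> c = \<pi> (att \<Gamma>' c)" if "c \<in> {1..n}" for c using con that by (simp add: contraction_def)
  have dG: "trop_data n B S i j r \<Gamma> (\<lambda>s. \<pi> ` e s) k l" using contraction_trop_data[OF \<Gamma>' d' con \<Gamma> d] .
  let ?sep = "separates (edges \<Gamma>')"
  have aV: "att \<Gamma>' ?a \<in> verts \<Gamma>'" using V' A by blast
  obtain x y where xy: "?e0 = {x, y}" "x \<in> verts \<Gamma>'" "y \<in> verts \<Gamma>'" "x \<noteq> y" "\<not> ?sep ?e0 x (att \<Gamma>' ?a)"
  proof -
    obtain p q where pq: "?e0 = {p, q}" "p \<noteq> q" "p \<in> verts \<Gamma>'" "q \<in> verts \<Gamma>'" using tree_edge[OF tree' e0E] by blast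
    have "\<not> ?sep ?e0 p (att \<Gamma>' ?a) \<or> \<not> ?sep ?e0 q (att \<Gamma>' ?a)"
      using edge_sides[OF tree', of p q "att \<Gamma>' ?a"] pq(1) e0E aV by simp
    then show thesis using that[of p q] that[of q p] pq by (auto simp: insert_commute)
  qed
  have sxy: "?sep ?e0 x y" using tree_bridge[OF tree', of x y] e0E xy(1) by simp
  define v where "v = \<pi> x"
  have py: "\<pi> y = v" using fib[OF xy(2,3)] xy(1) by (simp add: v_def)
  have v: "v \<in> verts \<Gamma>" using xy(2) vertsG by (simp add: v_def)
  have over_v: "\<pi> u = v \<longleftrightarrow> u = x \<or> u = y" if "u \<in> verts \<Gamma>'" for u
    using fib[OF that xy(2)] xy(1,4) unfolding v_def by (auto simp: doubleton_eq_iff)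
  have over_other: "\<pi> u = \<pi> u' \<longleftrightarrow> u = u'" if "u \<in> verts \<Gamma>'" "u' \<in> verts \<Gamma>'" "\<pi> u \<noteq> v" for u u'
    using fib[OF that(1,2)] over_v[OF that(1)] that(3) xy(1) by (auto simp: doubleton_eq_iff)
  obtain w where w: "w \<notin> verts \<Gamma>" using tree_finite(1)[OF tree] ex_new_if_finite infinite_UNIV_nat by metis
  have vw: "v \<noteq> w" using v w by metis
  define g where "g u = inv_into (verts \<Gamma>') \<pi> u" for u
  have g: "g u \<in> verts \<Gamma>'" "\<pi> (g u) = u" if "u \<in> verts \<Gamma>" for u
    using that unfolding vertsG g_def by (auto intro: inv_into_into f_inv_into_f)
  have g\<pi>: "g (\<pi> u) = u" if u: "u \<in> verts \<Gamma>'" "\<pi> u \<noteq> v" for u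
  proof -
    have "\<pi> u \<in> verts \<Gamma>" using u vertsG by blast
    then show ?thesis using over_other[OF u(1) g(1) u(2)] g(2) by metis
  qed
  \<comment> \<open>A site of \<open>\<Gamma>\<close> other than \<open>v\<close> has a unique position in \<open>\<Gamma>'\<close>; for a leg at \<open>v\<close> this tells the end of the edge.\<close>
  define lift where "lift z = (case z of Vertex u \<Rightarrow> g u | Leg c \<Rightarrow> att \<Gamma>' c)" for z
  have lift: "lift z \<in> verts \<Gamma>'" "\<pi> (lift z) = pos \<Gamma> z" if "z \<in> sites n \<Gamma>" for z
    using that g V' att by (auto simp: sites_def lift_def)
  define onside where "onside z \<longleftrightarrow> \<not> ?sep ?e0 x (lift z)" for z
  have same_side: "onside z = onside z'"
    if z: "z \<in> sites n \<Gamma> - {Vertex v}" "z' \<in> sites n \<Gamma> - {Vertex v}" "branch n \<Gamma> v z = branch n \<Gamma> v z'" for z z'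
  proof (cases "z = z'")
    case False
    then obtain h where h: "h \<in> edges \<Gamma>" "separates (edges \<Gamma>) h v (pos \<Gamma> z)" "separates (edges \<Gamma>) h v (pos \<Gamma> z')"
      using branch_eq_iff[OF st v z(1,2)] z(3) by blast
    obtain h' where h': "h' \<in> edges \<Gamma>' - {?e0}" "h = \<pi> ` h'" using h(1) edgesG by blast
    have L: "lift z \<in> verts \<Gamma>'" "lift z' \<in> verts \<Gamma>'" "\<pi> (lift z) = pos \<Gamma> z" "\<pi> (lift z') = pos \<Gamma> z'"
      using lift z by blast+
    note cs = collapse_separates[OF tree' col h'(1)]
    have s: "?sep h' x (lift z)" "?sep h' x (lift z')"
      using cs[OF xy(2) L(1)] cs[OF xy(2) L(2)] h(2,3) unfolding L(3,4) v_def[symmetric] h'(2) by blast+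
    have "?sep h' y (lift z)"
      using cs[OF xy(3) L(1)] h(2) unfolding L(3) py h'(2) by blast
    then have "\<not> ?sep h' x y"
      using s(1) separates_xor[OF tree', of h' x y "lift z"] h'(1) xy L(1) linked_sym by blast
    moreover have "\<not> ?sep h' (lift z) (lift z')"
      using s separates_xor[OF tree', of h' "lift z" "lift z'" x] h'(1) xy L by blast
    ultimately have "\<not> ?sep ?e0 (lift z) (lift z')"
      using quadrant_empty[OF tree', of h' ?e0 "lift z" "lift z'" x y] h'(1) e0E L xy(2,3) s(1) sxy linked_sym by blast
    then show ?thesis unfolding onside_def by (meson linked_sym linked_trans)
  qed simp
  define B1 where "B1 = branch n \<Gamma> v ` {z \<in> sites n \<Gamma> - {Vertex v}. onside z}"
  define B2 where "B2 = branch n \<Gamma> v ` {z \<in> sites n \<Gamma> - {Vertex v}. \<not> onside z}"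
  have inB1: "branch n \<Gamma> v z \<in> B1 \<longleftrightarrow> onside z" if z: "z \<in> sites n \<Gamma> - {Vertex v}" for z
  proof
    assume "branch n \<Gamma> v z \<in> B1"
    then obtain z' where "z' \<in> sites n \<Gamma> - {Vertex v}" "onside z'" "branch n \<Gamma> v z = branch n \<Gamma> v z'"
      unfolding B1_def by blast
    then show "onside z" using same_side[OF z] by blast
  qed (use z in \<open>auto simp: B1_def\<close>)
  have part: "B1 \<union> B2 = branches n \<Gamma> v" "B1 \<inter> B2 = {}"
  proof -
    show "B1 \<union> B2 = branches n \<Gamma> v" unfolding B1_def B2_def branches_def by blast
    have "\<beta> \<notin> B1" if \<beta>: "\<beta> \<in> B2" for \<beta>
    proof -
      obtain z where "z \<in> sites n \<Gamma> - {Vertex v}" "\<not> onside z" "\<beta> = branch n \<Gamma> v z" using \<beta> unfolding B2_def by blast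
      then show ?thesis using inB1 by blast
    qed
    then show "B1 \<inter> B2 = {}" by blast
  qed
  have B1sub: "B1 \<subseteq> branches n \<Gamma> v" using part(1) by blast
  have legB1: "branch n \<Gamma> v (Leg c) \<in> B1 \<longleftrightarrow> \<not> ?sep ?e0 x (att \<Gamma>' c)" if "c \<in> {1..n}" for c
    using inB1[of "Leg c"] that by (auto simp: sites_def onside_def lift_def)
  have aB: "branch n \<Gamma> v (Leg ?a) \<in> B1" using legB1[of ?a] A xy(5) by blast
  define Y where "Y s = cut \<Gamma>' (e s)" for s
  have Yold: "Y s c = cut \<Gamma> (\<pi> ` e s) c" if "s \<in> {1..r}" "c \<in> {1..n}" for s c
    using contraction_cut[OF \<Gamma>' d' con that] by (simp add: Y_def)
  have Ynew: "Y (r + 1) c = Y (r + 1) d \<longleftrightarrow> (branch n \<Gamma> v (Leg c) \<in> B1 \<longleftrightarrow> branch n \<Gamma> v (Leg d) \<in> B1)"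
    if "c \<in> {1..n}" "d \<in> {1..n}" for c d
    using cut_neq_iff[OF st' e0E that] n3 separates_xor[OF tree' e0E V'[OF that(1)] V'[OF that(2)] xy(2)]
    unfolding Y_def legB1[OF that(1)] legB1[OF that(2)] by auto
  have bijG: "bij_betw (\<lambda>s. \<pi> ` e s) {1..r} (edges \<Gamma>)" using dG by (simp add: trop_data_def)
  have adm: "admissible Y ?A ?a ?b (r + 1) (k (r + 1)) (l (r + 1))"
  proof -
    have "Y = (\<lambda>s. cut \<Gamma>' (e s))" by (simp add: Y_def fun_eq_iff)
    moreover have "r + 1 \<in> {1..r + 1}" by simp
    ultimately show ?thesis using d' unfolding trop_data_def by blast
  qed
  note all = admissible_imp_allowable[OF \<Gamma> bijG Yold A v part aB Ynew adm]
  define T where "T = split_vertex \<Gamma> v w B1"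
  define F where "F u = (if u = w then x else if u = v then y else g u)" for u
  define G where "G u = inv_into (verts T) F u" for u
  have vT: "verts T = insert w (verts \<Gamma>)" by (simp add: T_def split_vertex_def)
  have eT: "edges T = insert {v, w} (moved_edge v w B1 ` edges \<Gamma>)"
    by (simp add: T_def split_vertex_def moved_edge_def)
  have F\<pi>: "F (\<pi> u) = u" if u: "u \<in> verts \<Gamma>'" "\<pi> u \<noteq> v" for u
  proof -
    have "\<pi> u \<noteq> w" using u vertsG w by blast
    then show ?thesis using g\<pi>[OF u] u(2) by (simp add: F_def)
  qed
  have Fvw: "F w = x" "F v = y" using vw by (simp_all add: F_def)
  have gne: "g u \<notin> {x, y}" "\<pi> (g u) = u" if "u \<in> verts \<Gamma>" "u \<noteq> v" for u
    using g[OF that(1)] over_v[OF g(1)[OF that(1)]] that(2) by auto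
  have bijF: "bij_betw F (verts T) (verts \<Gamma>')"
    unfolding bij_betw_def
  proof
    show "inj_on F (verts T)"
    proof (rule inj_onI)
      fix p q assume pq: "p \<in> verts T" "q \<in> verts T" "F p = F q"
      consider "p \<in> {v, w}" "q \<in> {v, w}" | "p \<in> {v, w}" "q \<in> verts \<Gamma>" "q \<notin> {v, w}"
        | "q \<in> {v, w}" "p \<in> verts \<Gamma>" "p \<notin> {v, w}" | "p \<in> verts \<Gamma>" "q \<in> verts \<Gamma>" "p \<notin> {v, w}" "q \<notin> {v, w}"
        using pq(1,2) vT by blast
      then show "p = q"
      proof cases
        case 1
        then show ?thesis using pq(3) Fvw xy(4) by auto
      next
        case 2
        then show ?thesis using pq(3) Fvw gne[of q] by (auto simp: F_def)
      next
        case 3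
        then show ?thesis using pq(3) Fvw gne[of p] by (auto simp: F_def)
      next
        case 4
        then have "g p = g q" using pq(3) by (simp add: F_def)
        moreover have "\<pi> (g p) = p" "\<pi> (g q) = q" using gne(2) 4 by simp_all
        ultimately show ?thesis by metis
      qed
    qed
    show "F ` verts T = verts \<Gamma>'"
    proof (intro equalityI subsetI)
      fix u assume "u \<in> F ` verts T"
      then show "u \<in> verts \<Gamma>'" using g(1) xy(2,3) unfolding vT F_def by (auto split: if_splits)
    next
      fix u assume u: "u \<in> verts \<Gamma>'"
      show "u \<in> F ` verts T"
      proof (cases "\<pi> u = v")
        case True
        then have "u = F w \<or> u = F v" using over_v[OF u] Fvw by auto
        then show ?thesis using v vT by blast
      next
        case False
        then show ?thesis using F\<pi>[OF u False] u vertsG vT by (metis image_eqI insertI2)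
      qed
    qed
  qed
  have Fmoved: "F ` moved_edge v w B1 (\<pi> ` h) = h" if h: "h \<in> edges \<Gamma>' - {?e0}" for h
  proof -
    have hE: "h \<in> edges \<Gamma>'" using h by blast
    obtain p q where pq: "h = {p, q}" "p \<noteq> q" "p \<in> verts \<Gamma>'" "q \<in> verts \<Gamma>'" using tree_edge[OF tree' hE] by blast
    have ph: "{\<pi> p, \<pi> q} \<in> edges \<Gamma>"
    proof -
      have "\<pi> ` h \<in> edges \<Gamma>" unfolding edgesG using h by (rule imageI)
      then show ?thesis using pq(1) by simp
    qed
    have ne: "\<pi> p \<noteq> \<pi> q" using tree_edgeD(3)[OF tree ph] .
    have at_v: "F ` moved_edge v w B1 {\<pi> p, \<pi> q} = {p, q}"
      if pv: "\<pi> p = v" and p: "p \<in> verts \<Gamma>'" and q: "q \<in> verts \<Gamma>'" "\<pi> q \<noteq> v" and pqh: "{p, q} = h" for p q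
    proof -
      have qs: "Vertex (\<pi> q) \<in> sites n \<Gamma> - {Vertex v}" using q vertsG by (auto simp: sites_def)
      have notv: "Vertex v \<notin> \<Union>B1" using B1sub branch_subset unfolding branches_def by blast
      have "Vertex (\<pi> q) \<in> \<Union>B1 \<longleftrightarrow> \<not> ?sep ?e0 x q"
        unfolding site_mem_Union_iff[OF B1sub] inB1[OF qs] onside_def lift_def using g\<pi>[OF q] by simp
      moreover have "linked (edges \<Gamma>' - {?e0}) p q" using h pqh by (intro linked_edge) simp
      then have "?sep ?e0 x q \<longleftrightarrow> ?sep ?e0 x p" by (meson linked_sym linked_trans)
      moreover have "p = x \<or> p = y" using over_v[OF p] pv by blast
      then have "?sep ?e0 x p \<longleftrightarrow> p = y" using sxy xy(4) by auto
      ultimately have mem: "Vertex (\<pi> q) \<in> \<Union>B1 \<longleftrightarrow> p = x" using \<open>p = x \<or> p = y\<close> xy(4) by blast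
      have "\<pi> q \<noteq> w" using q vertsG w by blast
      have "moved_edge v w B1 {\<pi> p, \<pi> q} = (if p = x then {w, \<pi> q} else {v, \<pi> q})"
        unfolding moved_edge_def pv using mem notv q(2) by auto
      then show ?thesis using Fvw F\<pi>[OF q] \<open>p = x \<or> p = y\<close> by auto
    qed
    show ?thesis
    proof (cases "\<pi> p = v \<or> \<pi> q = v")
      case True
      then show ?thesis
      proof
        assume "\<pi> p = v"
        then show ?thesis using at_v[of p q] pq ne by simp
      next
        assume "\<pi> q = v"
        then show ?thesis using at_v[of q p] pq ne by (simp add: insert_commute)
      qed
    next
      case False
      then have "moved_edge v w B1 {\<pi> p, \<pi> q} = {\<pi> p, \<pi> q}" by (auto simp: moved_edge_def)
      then show ?thesis using F\<pi>[OF pq(3)] F\<pi>[OF pq(4)] False pq(1) by simp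
    qed
  qed
  have edgesF: "edges \<Gamma>' = (\<lambda>h. F ` h) ` edges T"
  proof -
    have "(\<lambda>h. F ` h) ` edges T = insert ?e0 ((\<lambda>h. F ` moved_edge v w B1 (\<pi> ` h)) ` (edges \<Gamma>' - {?e0}))"
      unfolding eT edgesG image_insert image_image using Fvw xy(1) by (simp add: insert_commute)
    also have "(\<lambda>h. F ` moved_edge v w B1 (\<pi> ` h)) ` (edges \<Gamma>' - {?e0}) = (\<lambda>h. h) ` (edges \<Gamma>' - {?e0})"
      by (intro image_cong refl Fmoved)
    finally show ?thesis using e0E by auto
  qed
  have attF: "att \<Gamma>' c = F (att T c)" if c: "c \<in> {1..n}" for c
  proof (cases "att \<Gamma> c = v")
    case True
    then have "att \<Gamma>' c = x \<or> att \<Gamma>' c = y" using over_v[OF V'[OF c]] att[OF c] by simp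
    moreover have "Leg c \<in> \<Union>B1 \<longleftrightarrow> \<not> ?sep ?e0 x (att \<Gamma>' c)" unfolding site_mem_Union_iff[OF B1sub] legB1[OF c] ..
    ultimately show ?thesis using True sxy Fvw by (auto simp: T_def split_vertex_def)
  next
    case False
    then show ?thesis using F\<pi>[OF V'[OF c]] att[OF c] by (simp add: T_def split_vertex_def)
  qed
  \<comment> \<open>The tree \<open>\<Gamma>'\<close> transported to the vertices of \<open>T\<close>; its lengths have to be compared with the readjusted ones.\<close>
  define R where "R = \<lparr>verts = verts T, edges = edges T, att = att T, len = \<lambda>h. len \<Gamma>' (F ` h)\<rparr>"
  have edgeTV: "h \<subseteq> verts T" if h: "h \<in> edges T" for h
  proof
    fix u assume u: "u \<in> h"
    consider "h = {v, w}" | m where "m \<in> edges \<Gamma>" "h = moved_edge v w B1 m" using h eT by blast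
    then show "u \<in> verts T"
    proof cases
      case 1
      then show ?thesis using u v vT by auto
    next
      case (2 m)
      then have "u \<in> insert w m" using u by (auto simp: moved_edge_def split: if_splits)
      moreover have "m \<subseteq> verts \<Gamma>" using tree_edge[OF tree 2(1)] by blast
      ultimately show ?thesis using vT by blast
    qed
  qed
  have GF: "G (F u) = u" if "u \<in> verts T" for u
    unfolding G_def using bij_betw_inv_into_left[OF bijF that] .
  have GFi: "G ` F ` h = h" if "h \<in> edges T" for h
  proof -
    have "G ` F ` h = (\<lambda>u. u) ` h" unfolding image_image using GF edgeTV[OF that] by (intro image_cong) auto
    then show ?thesis by simp
  qed
  have isoR: "isometric n \<Gamma>' R"
    unfolding isometric_def
  proof (intro exI[of _ G] conjI ballI)
    show "bij_betw G (verts \<Gamma>') (verts R)"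
      using bij_betw_inv_into[OF bijF] unfolding R_def G_def by simp
    have "(\<lambda>h. G ` h) ` edges \<Gamma>' = (\<lambda>h. G ` F ` h) ` edges T" unfolding edgesF by (rule image_image)
    also have "\<dots> = (\<lambda>h. h) ` edges T" by (intro image_cong refl GFi)
    finally show "edges R = (\<lambda>h. G ` h) ` edges \<Gamma>'" by (simp add: R_def)
    show "att R c = G (att \<Gamma>' c)" if c: "c \<in> {1..n}" for c
    proof -
      have "att T c \<in> verts T" using V[OF c] vT by (simp add: T_def split_vertex_def)
      then show ?thesis unfolding attF[OF c] using GF by (simp add: R_def)
    qed
    show "len R (G ` h) = len \<Gamma>' h" if h: "h \<in> edges \<Gamma>'" for h
    proof -
      obtain h' where "h' \<in> edges T" "h = F ` h'" using h edgesF by blast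
      then show ?thesis using GFi by (simp add: R_def)
    qed
  qed
  obtain e3 where RM: "R \<in> M0n_trop n" and dR: "trop_data n B S i j (r + 1) R e3 k l"
    using isometric_trop_data[OF \<Gamma>' d' isoR] by blast
  have R_simps: "verts R = verts T" "edges R = edges T" "att R = att T" by (simp_all add: R_def)
  have cutR: "cut R = cut T" by (simp add: fun_eq_iff cut_def R_simps)
  have "stable_tree n R" using RM by (simp add: M0n_trop_def)
  then have stT: "stable_tree n T" unfolding stable_tree_def R_simps .
  have e3: "bij_betw e3 {1..r + 1} (edges T)" using dR unfolding trop_data_def R_simps by blast
  define kk where "kk = (\<lambda>q. if q \<le> r then fst (min_pair n B S i j \<Gamma> q) else k_new n \<Gamma> ?A ?a ?b v)"
  define ll where "ll = (\<lambda>q. if q \<le> r then snd (min_pair n B S i j \<Gamma> q) else l_new n \<Gamma> ?A ?a v B1)"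
  have kk: "kk q = k q \<and> ll q = l q" if q: "q \<in> {1..r + 1}" for q
  proof (cases "q \<le> r")
    case True
    then show ?thesis using prev.trop_data_min_pair[OF \<Gamma> dG, of q] q by (simp add: kk_def ll_def)
  next
    case False
    then have "q = r + 1" using q by simp
    then show ?thesis using all(3,4) by (simp add: kk_def ll_def)
  qed
  have legs: "k q \<in> {1..n} \<and> l q \<in> {1..n}" if "q \<in> {1..r + 1}" for q
    using d' S_legs[OF that] that unfolding trop_data_def admissible_def by blast
  have "readjusted_len n B i j kk ll (r + 1) T h = len \<Gamma>' (F ` h)" if h: "h \<in> edges T" for h
  proof -
    obtain q where q: "q \<in> {1..r + 1}" "h = e3 q" using h e3 unfolding bij_betw_def by blast
    have "readjusted_len n B i j k l (r + 1) T (e3 q) = len R (e3 q)"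
    proof (rule readjusted_len_eq[OF stT e3 legs _ _ q(1), where L = "\<lambda>s. len R (e3 s)"])
      show "triangular (\<lambda>q. {s \<in> {1..r + 1}. quartet (\<lambda>s. cut T (e3 s)) s (i q) (l q) (j q) (k q)}) (r + 1)"
        using dR unfolding trop_data_def cutR by (intro admissible_triangular) blast
      show "(\<Sum>s | s \<in> {1..r + 1} \<and> quartet (\<lambda>s. cut T (e3 s)) s (i q) (l q) (j q) (k q). len R (e3 s)) =
          (real (l q) - real (k q)) * real B ^ (n - 3 - q)" if "q \<in> {1..r + 1}" for q
        using trop_data_sum[OF dR that] unfolding cutR scale_def .
    qed
    moreover have "readjusted_len n B i j kk ll (r + 1) T = readjusted_len n B i j k l (r + 1) T"
      by (rule readjusted_len_cong[OF kk])
    ultimately show ?thesis using q(2) by (simp add: R_def)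
  qed
  then have "isometric n \<lparr>verts = verts T, edges = edges T, att = att T, len = readjusted_len n B i j kk ll (r + 1) T\<rparr> \<Gamma>'"
    unfolding isometric_def using bijF edgesF attF by (intro exI[of _ F]) simp
  then show ?thesis
    unfolding allowable_insertion_def Let_def kk_def ll_def T_def using all(1,2) w by blast
qed

end

theorem theorem4:
  fixes n m B r :: nat and S :: "nat \<Rightarrow> nat set" and i j :: "nat \<Rightarrow> nat"
  assumes "n \<ge> 3" and "m \<le> n - 3" and "B \<ge> 2 * n + 1"
    and "\<And>q. q \<in> {1..m} \<Longrightarrow>
           S q \<subseteq> {1..n} \<and> card (S q) \<ge> 3 \<and> i q \<in> S q \<and> j q \<in> S q \<and> i q \<noteq> j q"
    and "\<exists>h :: 'k::{alg_closed_field, field_char_0} fls \<Rightarrow> 'u. inj h"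
    and "r < m"
  shows
    "let FW' = FW TYPE('k) TYPE('u) n B S i j in
     (\<forall>\<Gamma>'\<in>FW' (r + 1).
        card (edges \<Gamma>') = r + 1 \<and>
        (\<exists>e'. edge_numbering n B (r + 1) \<Gamma>' e' \<and>
              (\<forall>q\<in>{1..r}. len \<Gamma>' (e' (r + 1)) < len \<Gamma>' (e' q)))) \<and>
     (\<forall>\<Gamma>'\<in>FW' (r + 1). \<exists>\<Gamma>\<in>FW' r.
        near_contraction n B r \<Gamma>' \<Gamma> \<and>
        (\<forall>\<Gamma>2\<in>FW' r. near_contraction n B r \<Gamma>' \<Gamma>2 \<longrightarrow> isometric n \<Gamma> \<Gamma>2)) \<and>
     (\<forall>\<Gamma>\<in>FW' r.
        {\<Gamma>' \<in> FW' (r + 1). near_contraction n B r \<Gamma>' \<Gamma>} =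
        {\<Gamma>'. allowable_insertion n B S i j r \<Gamma> \<Gamma>'})"
proof -
  interpret hypersurface_step n B r S i j
    using assms(1-4,6) by (unfold_locales) auto
  obtain h :: "'k fls \<Rightarrow> 'u" where h: "inj h" using assms(5) by blast
  note FW' = FW_iff[OF h] and FWr = prev.FW_iff[OF h]
  have a: "card (edges \<Gamma>') = r + 1 \<and> (\<exists>e'. edge_numbering n B (r + 1) \<Gamma>' e' \<and>
              (\<forall>q\<in>{1..r}. len \<Gamma>' (e' (r + 1)) < len \<Gamma>' (e' q)))"
    if \<Gamma>': "\<Gamma>' \<in> FW TYPE('k) TYPE('u) n B S i j (r + 1)" for \<Gamma>'
  proof -
    obtain e k l where d: "trop_data n B S i j (r + 1) \<Gamma>' e k l" using \<Gamma>' FW' by blast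
    have "bij_betw e {1..r + 1} (edges \<Gamma>')" using d by (simp add: trop_data_def)
    then have "card (edges \<Gamma>') = r + 1" using bij_betw_same_card by fastforce
    moreover have "len \<Gamma>' (e (r + 1)) < len \<Gamma>' (e q)" if q: "q \<in> {1..r}" for q
    proof -
      have "len \<Gamma>' (e (r + 1)) \<le> (real n - 1) * scale (r + 1)" "scale q / 2 \<le> len \<Gamma>' (e q)"
        using trop_data_sizes[OF d] q by auto
      moreover have "real n * scale (r + 1) < scale q / 2" using c_gap'[of q "r + 1"] q by simp
      ultimately show ?thesis using c_pos[of "r + 1"] by (simp add: algebra_simps)
    qed
    ultimately show ?thesis using trop_data_numbering[OF d] by blast
  qed
  have b: "\<exists>\<Gamma>\<in>FW TYPE('k) TYPE('u) n B S i j r. near_contraction n B r \<Gamma>' \<Gamma> \<and>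
        (\<forall>\<Gamma>2\<in>FW TYPE('k) TYPE('u) n B S i j r. near_contraction n B r \<Gamma>' \<Gamma>2 \<longrightarrow> isometric n \<Gamma> \<Gamma>2)"
    if \<Gamma>': "\<Gamma>' \<in> FW TYPE('k) TYPE('u) n B S i j (r + 1)" for \<Gamma>'
  proof -
    obtain e k l where M: "\<Gamma>' \<in> M0n_trop n" and d: "trop_data n B S i j (r + 1) \<Gamma>' e k l" using \<Gamma>' FW' by blast
    obtain \<Gamma> \<pi> where con: "contraction n \<pi> \<Gamma>' (e (r + 1)) \<Gamma>" and \<Gamma>: "\<Gamma> \<in> M0n_trop n"
      and d\<Gamma>: "trop_data n B S i j r \<Gamma> (\<lambda>s. \<pi> ` e s) k l"
      using contraction_exists[OF M d] by blast
    have "isometric n \<Gamma> \<Gamma>2"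
      if \<Gamma>2: "\<Gamma>2 \<in> FW TYPE('k) TYPE('u) n B S i j r" and near: "near_contraction n B r \<Gamma>' \<Gamma>2" for \<Gamma>2
    proof -
      obtain f k2 l2 where M2: "\<Gamma>2 \<in> M0n_trop n" and d2: "trop_data n B S i j r \<Gamma>2 f k2 l2" using \<Gamma>2 FWr by blast
      obtain e2 \<pi>2 where e2: "edge_numbering n B (r + 1) \<Gamma>' e2" and con2: "contraction n \<pi>2 \<Gamma>' (e2 (r + 1)) \<Gamma>2"
        using near by (auto simp: near_contraction_def)
      have con2': "contraction n \<pi>2 \<Gamma>' (e (r + 1)) \<Gamma>2"
        using con2 edge_numbering_unique[OF e2 trop_data_numbering[OF d], of "r + 1"] by simp
      show ?thesis
        by (rule contraction_unique[OF M d con con2' d\<Gamma> contraction_trop_data[OF M d con2' M2 d2]])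
    qed
    moreover have "\<Gamma> \<in> FW TYPE('k) TYPE('u) n B S i j r" using FWr \<Gamma> d\<Gamma> by blast
    ultimately show ?thesis using contraction_near[OF M d con d\<Gamma>] by blast
  qed
  have c: "{\<Gamma>' \<in> FW TYPE('k) TYPE('u) n B S i j (r + 1). near_contraction n B r \<Gamma>' \<Gamma>} =
        {\<Gamma>'. allowable_insertion n B S i j r \<Gamma> \<Gamma>'}"
    if "\<Gamma> \<in> FW TYPE('k) TYPE('u) n B S i j r" for \<Gamma>
  proof -
    obtain f k0 l0 where \<Gamma>: "\<Gamma> \<in> M0n_trop n" and d: "trop_data n B S i j r \<Gamma> f k0 l0"
      using \<open>\<Gamma> \<in> FW TYPE('k) TYPE('u) n B S i j r\<close> FWr by blast
    show ?thesis
    proof (intro equalityI subsetI)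
      fix \<Gamma>' assume "\<Gamma>' \<in> {\<Gamma>' \<in> FW TYPE('k) TYPE('u) n B S i j (r + 1). near_contraction n B r \<Gamma>' \<Gamma>}"
      then show "\<Gamma>' \<in> {\<Gamma>'. allowable_insertion n B S i j r \<Gamma> \<Gamma>'}"
        using FW' near_contraction_insertion[OF \<Gamma> d] by blast
    next
      fix \<Gamma>' assume "\<Gamma>' \<in> {\<Gamma>'. allowable_insertion n B S i j r \<Gamma> \<Gamma>'}"
      then show "\<Gamma>' \<in> {\<Gamma>' \<in> FW TYPE('k) TYPE('u) n B S i j (r + 1). near_contraction n B r \<Gamma>' \<Gamma>}"
        using FW' insertion_near_contraction[OF \<Gamma> d] by blast
    qed
  qed
  show ?thesis unfolding Let_def using a b c by blast
qed

end
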